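(* The assignment $(\phi,u)\mapsto u$ defines a Lie algebra map $\mathfrak{grt}_1^{ell}\to\mathfrak{krv}_{1,1}$ from Enriquez' elliptic Grothendieck–Teichmüller Lie algebra to the elliptic Kashiwara–Vergne Lie algebra.
   Context: All free Lie algebras and the Lie algebras $\mathfrak t_{1,n}$ below are over $\mathbb Q$ and completed with respect to their natural gradings. **$\mathfrak{grt}_1$.** The set of Lie series $\psi(A,B)$ in the completed free Lie algebra on $A,B$ with $\psi(A,B)=-\psi(B,A)$; $\psi(A,B)+\psi(B,C)+\psi(C,A)=0$ and $[B,\psi(A,B)]+[C,\psi(A,C)]=0$ whenever $A+B+C=0$; and $\psi(t_{12},t_{23}+t_{24})+\psi(t_{13}+t_{23},t_{34})=\psi(t_{23},t_{34})+\psi(t_{12}+t_{13},t_{24}+t_{34})+\psi(t_{12},t_{23})$ in the Drinfeld–Kohno Lie algebra $\mathfrak t_4$. The bracket is the Ihara bracket $\langle\psi_1,\psi_2\rangle=[\psi_1,\psi_2]+D_{\psi_1}(\psi_2)-D_{\psi_2}(\psi_1)$, where $D_\psi$ is the derivation with $A\mapsto0$, $B\mapsto[B,\psi]$. **$\mathfrak t_{1,n}$.** Generated by $x_i^\pm$ ($1\le i\le n$) and $t_{ij}=t_{ji}$ ($i\neq j$) with relations $\sum_ix_i^\pm=0$; $[x_i^\pm,x_j^\pm]=0$ and $[x_i^+,x_j^-]=t_{ij}$ for $i\ne j$; $[x_i^+,x_i^-]=-\sum_{j\ne i}t_{ij}$; $[x_i^\pm,t_{jk}]=0$ for $i,j,k$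 distinct; $[x_i^\pm+x_j^\pm,t_{ij}]=0$; $[t_{ij},t_{ik}+t_{jk}]=0$ for $i,j,k$ distinct; $[t_{ij},t_{kl}]=0$ for $i,j,k,l$ distinct. $\mathfrak t_{1,2}$ is the completed free Lie algebra on $x_1^+,x_1^-$. For $u\in\mathfrak t_{1,2}$ and $\{i,j,k\}=\{1,2,3\}$, $u^{i,jk}\in\mathfrak t_{1,3}$ is the image of $u$ under $x_1^\pm\mapsto x_i^\pm$. For $\psi\in\mathfrak{grt}_1$ put $\psi^{i,j,k}=\psi(t_{ij},t_{jk})\in\mathfrak t_{1,3}$. **$\mathfrak{grt}_1^{ell}$.** The set of $(\psi,u_+,u_-)$ with $\psi\in\mathfrak{grt}_1$, $u_\pm\in\mathfrak t_{1,2}$ satisfying, in $\mathfrak t_{1,3}$ and with $\xi_\pm:=u_\pm^{1,23}-[\psi^{1,2,3},x_1^\pm]$, $\eta_\pm:=u_\pm^{2,13}-[\psi^{2,1,3},x_2^\pm]$: $$\xi_\pm+\eta_\pm+u_\pm^{3,12}=0,\qquad [\xi_\pm,x_3^\pm]+[x_1^\pm,u_\pm^{3,12}]=0,\qquad [\xi_+,x_2^-]+[x_1^+,\eta_-]=0.$$ Write $(\psi,u)$ with $u$ the derivation $x_1^\pm\mapsto u_\pm$ of $\mathfrak t_{1,2}$. The Lie bracket is the Ihara bracket in the first component and the commutator of derivations in the second. **$\mathfrak{krv}_{1,1}$.** Let $L$ be the completed free Lie algebra on $c_1,c_2$ (a symplectic basis of $\bar H_1(W_{1,1})$, where $W_{1,1}$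 is the torus minus a disc); $L$ is identified with $\mathfrak t_{1,2}$ by $c_1=x_1^+$, $c_2=x_1^-$. Let $T=U(L)$ be the completed free associative algebra on $c_1,c_2$, and $|T|=T/\overline{[T,T]}$ the space of cyclic words, with projection $a\mapsto|a|$. For $a\in L$, $\partial_ia\in T$ is determined by requiring that $a\mapsto\mathrm{ad}_{\partial_ia}s$ be the derivation from $L$ to the free Lie algebra on $c_1,c_2,s$ with $c_i\mapsto s$, $c_j\mapsto0$ for $j\ne i$ (here $T$ acts on $s$ through the extension of $\mathrm{ad}$). For a continuous derivation $u$ of $L$ put $\mathrm{div}(u)=\sum_i|\partial_iu(c_i)|\in|T|$. Then $$\mathfrak{krv}_{1,1}=\{u\in\mathrm{Der}(L)\mid u([c_1,c_2])=0,\ \mathrm{div}(u)=|f([c_1,c_2])|\text{ for some }f\in\mathbb Q[[t]]\}$$ with the commutator bracket. *)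

theory Defs
  imports
    Complex_Main
    "HOL-Library.Function_Algebras"
    "HOL-Library.Product_Plus"
    "HOL-Library.Numeral_Type"
    "HOL-Computational_Algebra.Formal_Power_Series"
begin

section \<open>Lie algebras and their homomorphisms\<close>

locale lie_algebra = vector_space scale
  for scale :: "'k::field \<Rightarrow> 'v::ab_group_add \<Rightarrow> 'v" +
  fixes V :: "'v set" and bracket :: "'v \<Rightarrow> 'v \<Rightarrow> 'v"
  assumes subspace_carrier: "subspace V"
    and bracket_closed: "\<And>x y. x \<in> V \<Longrightarrow> y \<in> V \<Longrightarrow> bracket x y \<in> V"
    and bracket_add_left: "\<And>x y z. x \<in> V \<Longrightarrow> y \<in> V \<Longrightarrow> z \<in> V \<Longrightarrow>
          bracket (x + y) z = bracket x z + bracket y z"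
    and bracket_add_right: "\<And>x y z. x \<in> V \<Longrightarrow> y \<in> V \<Longrightarrow> z \<in> V \<Longrightarrow>
          bracket x (y + z) = bracket x y + bracket x z"
    and bracket_scale_left: "\<And>c x y. x \<in> V \<Longrightarrow> y \<in> V \<Longrightarrow>
          bracket (scale c x) y = scale c (bracket x y)"
    and bracket_scale_right: "\<And>c x y. x \<in> V \<Longrightarrow> y \<in> V \<Longrightarrow>
          bracket x (scale c y) = scale c (bracket x y)"
    and bracket_self: "\<And>x. x \<in> V \<Longrightarrow> bracket x x = 0"
    and jacobi: "\<And>x y z. x \<in> V \<Longrightarrow> y \<in> V \<Longrightarrow> z \<in> V \<Longrightarrow>
          bracket x (bracket y z) + bracket y (bracket z x) + bracket z (bracket x y) = 0"

locale lie_algebra_hom =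
  dom: lie_algebra scale1 V1 bracket1 + cod: lie_algebra scale2 V2 bracket2
  for scale1 :: "'k::field \<Rightarrow> 'v::ab_group_add \<Rightarrow> 'v" and V1 bracket1
    and scale2 :: "'k \<Rightarrow> 'w::ab_group_add \<Rightarrow> 'w" and V2 bracket2 +
  fixes F :: "'v \<Rightarrow> 'w"
  assumes hom_closed: "\<And>x. x \<in> V1 \<Longrightarrow> F x \<in> V2"
    and hom_add: "\<And>x y. x \<in> V1 \<Longrightarrow> y \<in> V1 \<Longrightarrow> F (x + y) = F x + F y"
    and hom_scale: "\<And>c x. x \<in> V1 \<Longrightarrow> F (scale1 c x) = scale2 c (F x)"
    and hom_bracket: "\<And>x y. x \<in> V1 \<Longrightarrow> y \<in> V1 \<Longrightarrow>
          F (bracket1 x y) = bracket2 (F x) (F y)"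


section \<open>The completed free associative algebra over the rationals\<close>

text \<open>A noncommutative formal power series is the family of its coefficients at the words
  (lists of letters).\<close>

typedef 'a series = "UNIV :: ('a list \<Rightarrow> rat) set"
  morphisms wcoeff Series ..

setup_lifting type_definition_series

lemma series_eqI: "(\<And>w. wcoeff f w = wcoeff g w) \<Longrightarrow> f = g"
  by transfer auto

lemma sum_take_drop_Cons:
  fixes h :: "'a list \<Rightarrow> 'a list \<Rightarrow> rat"
  shows "(\<Sum>i\<le>length (a # w). h (take i (a # w)) (drop i (a # w))) =
    h [] (a # w) + (\<Sum>i\<le>length w. h (a # take i w) (drop i w))"
  by (simp add: sum.atMost_Suc_shift del: sum.atMost_Suc)

lemma convolution_assoc:
  fixes f g h :: "'a list \<Rightarrow> rat"
  shows "(\<Sum>i\<le>length w. (\<Sum>j\<le>length (take i w). f (take j (take i w)) * g (drop j (take i w))) * h (drop i w))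
    = (\<Sum>i\<le>length w. f (take i w) * (\<Sum>j\<le>length (drop i w). g (take j (drop i w)) * h (drop j (drop i w))))"
proof (induction w arbitrary: f)
  case Nil
  then show ?case by simp
next
  case (Cons a w)
  let ?c = "\<lambda>f g w. \<Sum>i\<le>length w. f (take i w) * (g (drop i w) :: rat)"
  have step: "?c p q (a # u) = p [] * q (a # u) + ?c (\<lambda>v. p (a # v)) q u" for p q u
    by (rule sum_take_drop_Cons[where h = "\<lambda>u v. p u * q v"])
  have "?c (?c f g) h (a # w) = f [] * g [] * h (a # w) + ?c (\<lambda>v. ?c f g (a # v)) h w"
    unfolding step[of "?c f g" _ h] by simp
  also have "?c (\<lambda>v. ?c f g (a # v)) h w =
      f [] * ?c (\<lambda>v. g (a # v)) h w + ?c (?c (\<lambda>v. f (a # v)) g) h w"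
    unfolding step[of f _ g] by (simp only: distrib_right sum.distrib sum_distrib_left mult.assoc)
  also have "?c (?c (\<lambda>v. f (a # v)) g) h w = ?c (\<lambda>v. f (a # v)) (?c g h) w"
    by (rule Cons.IH)
  also have "f [] * g [] * h (a # w) + (f [] * ?c (\<lambda>v. g (a # v)) h w + ?c (\<lambda>v. f (a # v)) (?c g h) w)
      = ?c f (?c g h) (a # w)"
    unfolding step[of f _ "?c g h"] step[of g _ h] by (simp only: distrib_left mult.assoc add.assoc)
  finally show ?case .
qed

instantiation series :: (type) ring_1
begin

lift_definition zero_series :: "'a series" is "\<lambda>_. 0" .
lift_definition one_series :: "'a series" is "\<lambda>w. if w = [] then 1 else 0" .
lift_definition plus_series :: "'a series \<Rightarrow> 'a series \<Rightarrow> 'a series" is "\<lambda>f g w. f w + g w" .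
lift_definition minus_series :: "'a series \<Rightarrow> 'a series \<Rightarrow> 'a series" is "\<lambda>f g w. f w - g w" .
lift_definition uminus_series :: "'a series \<Rightarrow> 'a series" is "\<lambda>f w. - f w" .
lift_definition times_series :: "'a series \<Rightarrow> 'a series \<Rightarrow> 'a series" is
  "\<lambda>f g w. \<Sum>i\<le>length w. f (take i w) * g (drop i w)" .

instance
proof
  fix a b c :: "'a series"
  show "a * b * c = a * (b * c)"
    by transfer (rule ext, rule convolution_assoc)
  show "1 * a = a"
  proof (rule series_eqI)
    fix w
    have "wcoeff (1 * a) w = (\<Sum>i\<le>length w. if i = 0 then wcoeff a w else 0)"
      unfolding times_series.rep_eq one_series.rep_eq by (rule sum.cong) auto
    then show "wcoeff (1 * a) w = wcoeff a w" by simp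
  qed
  show "a * 1 = a"
  proof (rule series_eqI)
    fix w
    have "wcoeff (a * 1) w = (\<Sum>i\<le>length w. if i = length w then wcoeff a w else 0)"
      unfolding times_series.rep_eq one_series.rep_eq by (rule sum.cong) auto
    then show "wcoeff (a * 1) w = wcoeff a w" by simp
  qed
  show "(a + b) * c = a * c + b * c"
    by transfer (simp add: distrib_right sum.distrib)
  show "a * (b + c) = a * b + a * c"
    by transfer (simp add: distrib_left sum.distrib)
  show "(0::'a series) \<noteq> 1"
    by transfer (metis zero_neq_one)
qed (transfer; simp add: fun_eq_iff)+

end

lift_definition qscale :: "rat \<Rightarrow> 'a series \<Rightarrow> 'a series" is "\<lambda>c f w. c * f w" .

global_interpretation series: vector_space qscale
  by unfold_locales (transfer; simp add: fun_eq_iff algebra_simps)+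

lift_definition letter :: "'a \<Rightarrow> 'a series" is "\<lambda>a w. if w = [a] then 1 else 0" .

definition br :: "'a::ring \<Rightarrow> 'a \<Rightarrow> 'a"
  where "br a b = a * b - b * a"

text \<open>Closure in the degree topology.  Any grading giving the letters positive, bounded degrees
  induces the same topology as the grading by word length, in particular the grading of
  \<open>\<tt>\<^bsub>1,n\<^esub>\<close> below, where \<open>x\<close> has degree 1 and \<open>t\<close> has degree 2.\<close>

definition deg_closure :: "'a series set \<Rightarrow> 'a series set" where
  "deg_closure S = {f. \<forall>n. \<exists>g\<in>S. \<forall>w. length w < n \<longrightarrow> wcoeff f w = wcoeff g w}"

text \<open>For a family with \<open>F w\<close> supported on words of length at least \<open>length w\<close>, this is the
  convergent sum of all \<open>f\<^sub>w F\<^sub>w\<close>.  This is the case in every use below in which the series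
  substituted for letters have no constant term, as is true of Lie series.\<close>

lift_definition wsum :: "'a::finite series \<Rightarrow> ('a list \<Rightarrow> 'b series) \<Rightarrow> 'b series" is
  "\<lambda>f F v. \<Sum>w | length w \<le> length v. f w * F w v" .

definition substitute :: "('a::finite \<Rightarrow> 'b series) \<Rightarrow> 'a series \<Rightarrow> 'b series" where
  "substitute \<sigma> f = wsum f (\<lambda>w. prod_list (map \<sigma> w))"

text \<open>\<open>der \<sigma> \<delta>\<close> is the continuous derivation along the algebra map \<open>substitute \<sigma>\<close> with value
  \<open>\<delta> a\<close> on the letter \<open>a\<close>.\<close>

primrec der_word :: "('a \<Rightarrow> 'b series) \<Rightarrow> ('a \<Rightarrow> 'b series) \<Rightarrow> 'a list \<Rightarrow> 'b series" where
  "der_word \<sigma> \<delta> [] = 0"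
| "der_word \<sigma> \<delta> (a # w) = \<delta> a * prod_list (map \<sigma> w) + \<sigma> a * der_word \<sigma> \<delta> w"

definition der :: "('a::finite \<Rightarrow> 'b series) \<Rightarrow> ('a \<Rightarrow> 'b series) \<Rightarrow> 'a series \<Rightarrow> 'b series" where
  "der \<sigma> \<delta> f = wsum f (der_word \<sigma> \<delta>)"

text \<open>The action on \<open>y\<close> of the associative series \<open>b\<close> through the extension of \<open>ad\<close>, a letter \<open>a\<close>
  acting by \<open>ad (\<sigma> a)\<close>.\<close>

definition ad_act :: "('a::finite \<Rightarrow> 'b series) \<Rightarrow> 'a series \<Rightarrow> 'b series \<Rightarrow> 'b series" where
  "ad_act \<sigma> b y = wsum b (\<lambda>w. foldr (\<lambda>a. br (\<sigma> a)) w y)"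

lift_definition fps_eval :: "rat fps \<Rightarrow> 'a series \<Rightarrow> 'a series" is
  "\<lambda>p f v. \<Sum>k\<le>length v. fps_nth p k * wcoeff (Series f ^ k) v" .


section \<open>Completed free and presented Lie algebras\<close>

text \<open>The free Lie algebra is realised as the Lie subalgebra generated by the letters in the free
  associative algebra.\<close>

inductive_set lie_poly :: "'a series set" where
  zero: "0 \<in> lie_poly"
| letter: "letter a \<in> lie_poly"
| add: "f \<in> lie_poly \<Longrightarrow> g \<in> lie_poly \<Longrightarrow> f + g \<in> lie_poly"
| scale: "f \<in> lie_poly \<Longrightarrow> qscale c f \<in> lie_poly"
| br: "f \<in> lie_poly \<Longrightarrow> g \<in> lie_poly \<Longrightarrow> br f g \<in> lie_poly"

definition lie_series :: "'a series set" where
  "lie_series = deg_closure lie_poly"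

inductive_set lie_ideal :: "'a series set \<Rightarrow> 'a series set" for R where
  zero: "0 \<in> lie_ideal R"
| rel: "r \<in> R \<Longrightarrow> r \<in> lie_ideal R"
| add: "f \<in> lie_ideal R \<Longrightarrow> g \<in> lie_ideal R \<Longrightarrow> f + g \<in> lie_ideal R"
| scale: "f \<in> lie_ideal R \<Longrightarrow> qscale c f \<in> lie_ideal R"
| br: "f \<in> lie_poly \<Longrightarrow> g \<in> lie_ideal R \<Longrightarrow> br f g \<in> lie_ideal R"

text \<open>For a set \<open>R\<close> of homogeneous Lie polynomials, the completed Lie algebra presented by \<open>R\<close> is
  the quotient of \<open>lie_series\<close> by the closed ideal generated by \<open>R\<close>; its elements are handled
  through representatives, and \<open>lie_cong R\<close> is equality in the quotient.\<close>

definition lie_cong :: "'a series set \<Rightarrow> 'a series \<Rightarrow> 'a series \<Rightarrow> bool" where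
  "lie_cong R f g \<longleftrightarrow> f - g \<in> deg_closure (lie_ideal R)"


section \<open>The Lie algebras \<open>\<tt>\<^sub>n\<close> and \<open>\<tt>\<^bsub>1,n\<^esub>\<close>\<close>

text \<open>The index set \<open>{1,\<dots>,n}\<close> is the numeral type \<open>n\<close>, in which \<open>n = 0\<close>.
  The diagonal letters \<open>t\<^sub>i\<^sub>i\<close> are redundant and are killed by a relation.\<close>

datatype 'i dk_gen = DK 'i 'i

abbreviation dk :: "'i \<Rightarrow> 'i \<Rightarrow> 'i dk_gen series" where
  "dk i j \<equiv> letter (DK i j)"

definition dk_rels :: "'i::finite dk_gen series set" where
  "dk_rels =
     {dk i i |i. True} \<union>
     {dk i j - dk j i |i j. i \<noteq> j} \<union>
     {br (dk i j) (dk k l) |i j k l. distinct [i, j, k, l]} \<union>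
     {br (dk i j) (dk i k + dk j k) |i j k. distinct [i, j, k]}"

datatype sgn = SPlus | SMinus

instance sgn :: finite
proof
  have "(UNIV :: sgn set) = {SPlus, SMinus}" by (auto intro: sgn.exhaust)
  then show "finite (UNIV :: sgn set)" by (metis finite.emptyI finite.insertI)
qed

datatype 'i ell_gen = GX sgn 'i | GT 'i 'i

abbreviation gx :: "sgn \<Rightarrow> 'i \<Rightarrow> 'i ell_gen series" where
  "gx s i \<equiv> letter (GX s i)"

abbreviation gt :: "'i \<Rightarrow> 'i \<Rightarrow> 'i ell_gen series" where
  "gt i j \<equiv> letter (GT i j)"

definition ell_rels :: "'i::finite ell_gen series set" where
  "ell_rels =
     {gt i i |i. True} \<union>
     {gt i j - gt j i |i j. i \<noteq> j} \<union>
     {(\<Sum>i\<in>UNIV. gx s i) |s. True} \<union>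
     {br (gx s i) (gx s j) |s i j. i \<noteq> j} \<union>
     {br (gx SPlus i) (gx SMinus j) - gt i j |i j. i \<noteq> j} \<union>
     {br (gx SPlus i) (gx SMinus i) + (\<Sum>j\<in>UNIV - {i}. gt i j) |i. True} \<union>
     {br (gx s i) (gt j k) |s i j k. distinct [i, j, k]} \<union>
     {br (gx s i + gx s j) (gt i j) |s i j. i \<noteq> j} \<union>
     {br (gt i j) (gt i k + gt j k) |i j k. distinct [i, j, k]} \<union>
     {br (gt i j) (gt k l) |i j k l. distinct [i, j, k, l]}"


section \<open>The Grothendieck--Teichmueller Lie algebra\<close>

datatype ab = LA | LB

instance ab :: finite
proof
  have "(UNIV :: ab set) = {LA, LB}" by (auto intro: ab.exhaust)
  then show "finite (UNIV :: ab set)" by (metis finite.emptyI finite.insertI)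
qed

definition ev :: "ab series \<Rightarrow> 'b series \<Rightarrow> 'b series \<Rightarrow> 'b series" where
  "ev \<psi> a b = substitute (case_ab a b) \<psi>"

definition grt1 :: "ab series set" where
  "grt1 = {\<psi> \<in> lie_series.
     (let A = letter LA; B = letter LB; C = - A - B in
       \<psi> = - ev \<psi> B A \<and>
       \<psi> + ev \<psi> B C + ev \<psi> C A = 0 \<and>
       br B \<psi> + br C (ev \<psi> A C) = 0) \<and>
     lie_cong (dk_rels :: 4 dk_gen series set)
       (ev \<psi> (dk 1 2) (dk 2 3 + dk 2 4) + ev \<psi> (dk 1 3 + dk 2 3) (dk 3 4))
       (ev \<psi> (dk 2 3) (dk 3 4) + ev \<psi> (dk 1 2 + dk 1 3) (dk 2 4 + dk 3 4) +
        ev \<psi> (dk 1 2) (dk 2 3))}"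

definition ihara_der :: "ab series \<Rightarrow> ab series \<Rightarrow> ab series" where
  "ihara_der \<psi> = der letter (case_ab 0 (br (letter LB) \<psi>))"

definition ihara_bracket :: "ab series \<Rightarrow> ab series \<Rightarrow> ab series" where
  "ihara_bracket \<psi> \<phi> = br \<psi> \<phi> + ihara_der \<psi> \<phi> - ihara_der \<phi> \<psi>"


section \<open>The elliptic Grothendieck--Teichmueller Lie algebra\<close>

text \<open>\<open>\<tt>\<^bsub>1,2\<^esub>\<close> is \<open>lie_series :: sgn series set\<close>, with \<open>x\<^sub>1\<^sup>+ = letter SPlus\<close> and
  \<open>x\<^sub>1\<^sup>- = letter SMinus\<close>.  \<open>ins i u\<close> is \<open>u\<close> with superscript \<open>i,jk\<close>.\<close>

definition ins :: "3 \<Rightarrow> sgn series \<Rightarrow> 3 ell_gen series" where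
  "ins i u = substitute (\<lambda>s. gx s i) u"

definition psi3 :: "ab series \<Rightarrow> 3 \<Rightarrow> 3 \<Rightarrow> 3 \<Rightarrow> 3 ell_gen series" where
  "psi3 \<psi> i j k = ev \<psi> (gt i j) (gt j k)"

definition ell_xi :: "ab series \<Rightarrow> (sgn \<Rightarrow> sgn series) \<Rightarrow> sgn \<Rightarrow> 3 ell_gen series" where
  "ell_xi \<psi> u s = ins 1 (u s) - br (psi3 \<psi> 1 2 3) (gx s 1)"

definition ell_eta :: "ab series \<Rightarrow> (sgn \<Rightarrow> sgn series) \<Rightarrow> sgn \<Rightarrow> 3 ell_gen series" where
  "ell_eta \<psi> u s = ins 2 (u s) - br (psi3 \<psi> 2 1 3) (gx s 2)"

text \<open>A triple \<open>(\<psi>, u\<^sub>+, u\<^sub>-)\<close> is represented by \<open>\<psi>\<close> and the family \<open>u\<close> indexed by the sign.\<close>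

definition grt1_ell :: "(ab series \<times> (sgn \<Rightarrow> sgn series)) set" where
  "grt1_ell = {(\<psi>, u). \<psi> \<in> grt1 \<and> (\<forall>s. u s \<in> lie_series) \<and>
     (\<forall>s. lie_cong ell_rels (ell_xi \<psi> u s + ell_eta \<psi> u s + ins 3 (u s)) 0) \<and>
     (\<forall>s. lie_cong ell_rels (br (ell_xi \<psi> u s) (gx s 3) + br (gx s 1) (ins 3 (u s))) 0) \<and>
     lie_cong ell_rels
       (br (ell_xi \<psi> u SPlus) (gx SMinus 2) + br (gx SPlus 1) (ell_eta \<psi> u SMinus)) 0}"

definition scale_ell ::
  "rat \<Rightarrow> ab series \<times> (sgn \<Rightarrow> sgn series) \<Rightarrow> ab series \<times> (sgn \<Rightarrow> sgn series)" where
  "scale_ell c = (\<lambda>(\<psi>, u). (qscale c \<psi>, \<lambda>s. qscale c (u s)))"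

text \<open>The second component is the commutator of the derivations given by \<open>u\<close> and \<open>v\<close>, evaluated
  on the generators.\<close>

definition ell_bracket ::
  "ab series \<times> (sgn \<Rightarrow> sgn series) \<Rightarrow> ab series \<times> (sgn \<Rightarrow> sgn series) \<Rightarrow>
   ab series \<times> (sgn \<Rightarrow> sgn series)" where
  "ell_bracket = (\<lambda>(\<psi>, u) (\<phi>, v).
     (ihara_bracket \<psi> \<phi>, \<lambda>s. der letter u (v s) - der letter v (u s)))"


section \<open>The elliptic Kashiwara--Vergne Lie algebra\<close>

text \<open>A derivation of \<open>L = lie_series\<close> is represented by a function on all series that vanishes
  outside \<open>L\<close>, so that derivations of \<open>L\<close> are equal iff the representing functions are; the
  pointwise operations of functions are those of \<open>Der(L)\<close>.\<close>

definition Der_L :: "(sgn series \<Rightarrow> sgn series) set" where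
  "Der_L = {u.
     (\<forall>f\<in>lie_series. u f \<in> lie_series) \<and>
     (\<forall>f. f \<notin> lie_series \<longrightarrow> u f = 0) \<and>
     (\<forall>f\<in>lie_series. \<forall>g\<in>lie_series. u (f + g) = u f + u g) \<and>
     (\<forall>c. \<forall>f\<in>lie_series. u (qscale c f) = qscale c (u f)) \<and>
     (\<forall>f\<in>lie_series. \<forall>g\<in>lie_series. u (br f g) = br (u f) g + br f (u g)) \<and>
     (\<forall>n. \<exists>m. \<forall>f\<in>lie_series. (\<forall>w. length w < m \<longrightarrow> wcoeff f w = 0) \<longrightarrow>
        (\<forall>w. length w < n \<longrightarrow> wcoeff (u f) w = 0))}"

definition scale_Der ::
  "rat \<Rightarrow> (sgn series \<Rightarrow> sgn series) \<Rightarrow> (sgn series \<Rightarrow> sgn series)" where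
  "scale_Der c u = (\<lambda>f. qscale c (u f))"

definition commutator ::
  "(sgn series \<Rightarrow> sgn series) \<Rightarrow> (sgn series \<Rightarrow> sgn series) \<Rightarrow> (sgn series \<Rightarrow> sgn series)" where
  "commutator u v = (\<lambda>f. u (v f) - v (u f))"

definition derivation_of :: "(sgn \<Rightarrow> sgn series) \<Rightarrow> sgn series \<Rightarrow> sgn series" where
  "derivation_of u = (\<lambda>f. if f \<in> lie_series then der letter u f else 0)"

text \<open>\<open>c\<^sub>1 = letter SPlus\<close> and \<open>c\<^sub>2 = letter SMinus\<close>.  The letter \<open>s\<close> is \<open>None\<close>, and \<open>c\<^sub>i\<close> becomes
  \<open>Some i\<close> in the larger alphabet.\<close>

definition pd :: "sgn \<Rightarrow> sgn series \<Rightarrow> sgn series" where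
  "pd i a = (THE b.
     ad_act (\<lambda>j. letter (Some j)) b (letter None) =
     der (\<lambda>j. letter (Some j)) (\<lambda>j. if j = i then letter None else 0) a)"

text \<open>\<open>cyc a\<close> is the class \<open>|a|\<close> of \<open>a\<close> modulo the closed span of the commutators.\<close>

definition cyc :: "'a series \<Rightarrow> 'a series set" where
  "cyc a = {b. b - a \<in> deg_closure (series.span {f * g - g * f |f g. True})}"

text \<open>The sum of the classes \<open>|\<partial>\<^sub>i u(c\<^sub>i)|\<close> is the class of the sum.\<close>

definition divergence :: "(sgn series \<Rightarrow> sgn series) \<Rightarrow> sgn series set" where
  "divergence u = cyc (\<Sum>i\<in>UNIV. pd i (u (letter i)))"

definition krv11 :: "(sgn series \<Rightarrow> sgn series) set" where
  "krv11 = {u \<in> Der_L.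
     u (br (letter SPlus) (letter SMinus)) = 0 \<and>
     (\<exists>p. divergence u = cyc (fps_eval p (br (letter SPlus) (letter SMinus))))}"

end

theory Submission
  imports Defs "HOL-Analysis.Cartesian_Space"
begin

text \<open>An element \<open>(\<psi>, u)\<close> of \<open>\<gg>\<rr>\<tt>\<^sub>1\<^sup>e\<^sup>l\<^sup>l\<close> defines a derivation of \<open>\<tt>\<^bsub>1,3\<^esub>\<close> that conjugation by the cyclic permutation
  of the strands changes by \<open>ad \<psi>\<^sup>1\<^sup>,\<^sup>2\<^sup>,\<^sup>3\<close>.  Commutators of such derivations have the same form, so the elliptic
  equations are preserved by the bracket; the hexagon and pentagon equations are treated in the same way with
  cyclic symmetries of order 3 and 5.

  Setting \<open>x\<^sub>3 = 0\<close> in the defining equations shows that \<open>u\<close> is odd and \<open>u(\<omega>) = 0\<close> for \<open>\<omega> = [c\<^sub>1, c\<^sub>2]\<close>.  For the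
  divergence, \<open>\<tt>\<^bsub>1,3\<^esub>\<close> is mapped to \<open>4 \<times> 4\<close> matrices over \<open>T\<close>, linear in \<open>t\<^sub>1\<^sub>2\<close>.  The upper right entry of the
  equation \<open>\<xi> + \<eta> + u\<^sup>3\<^sup>,\<^sup>1\<^sup>2 = 0\<close> says that contracting adjacent letters of \<open>u\<^sub>\<plusminus>\<close> with the symplectic form gives
  \<open>c\<^sub>\<plusminus> \<rho>(\<omega>) - \<rho>'(\<omega>) c\<^sub>\<plusminus>\<close>, where the power series \<open>\<rho>\<close>, \<open>\<rho>'\<close> are read off the part of \<open>\<psi>\<close> of degree one in \<open>A\<close>.
  As \<open>u\<close> is Hamiltonian, these contractions are, up to sign, the cyclic derivatives of \<open>div(u)\<close>, and Euler's
  formula for cyclic words recovers \<open>div(u)\<close> as \<open>|f(\<omega>)|\<close>.\<close>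

section \<open>Continuous linear maps of series\<close>

text \<open>The claim has three parts: each side is a Lie algebra, and the map respects brackets.
  Closure of \<open>grt1_ell\<close> rests on closure of \<open>grt1\<close> under the Ihara
  bracket, so the latter has to be proved too.

  The obstacle is that presented Lie algebras are handled through representatives modulo a closed
  ideal. A derivation given on free generators says something about the quotient only once it is
  known to preserve that ideal. Symmetry settles this: a rotation permutes the relations and changes
  the derivation by an inner one only, so one relation per orbit is checked by hand.

  Contractions arise because [x_1^+, x_2^-] = t_12: in u(-x_1 - x_2) the part linear in t_12 comes
  from the places where an x_1 letter is followed by an x_2 letter, and such a pair is replaced by
  its symplectic pairing. The contraction of a Hamiltonian derivation computes cyclic sums of
  coefficients of its divergence. A further sum over rotations multiplies the left side by the word
  length, which explains the denominators 2k in the series f. The empty word carries no cyclic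
  information, and the constant term of f is fitted separately.\<close>

lemmas wcoeff_simps [simp] =
  zero_series.rep_eq one_series.rep_eq plus_series.rep_eq minus_series.rep_eq
  uminus_series.rep_eq qscale.rep_eq letter.rep_eq

lemma wcoeff_mult: "wcoeff (f * g) w = (\<Sum>i\<le>length w. wcoeff f (take i w) * wcoeff g (drop i w))"
  by (simp add: times_series.rep_eq)

lemma wcoeff_mult_Nil [simp]: "wcoeff (f * g) [] = wcoeff f [] * wcoeff g []"
  by (simp add: wcoeff_mult)

lemma wcoeff_sum: "wcoeff (sum f A) w = (\<Sum>x\<in>A. wcoeff (f x) w)"
  by (induction A rule: infinite_finite_induct) auto

lemma qscale_mult_left: "qscale c f * g = qscale c (f * g)"
  by (rule series_eqI) (simp add: wcoeff_mult sum_distrib_left mult.assoc)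

lemma qscale_mult_right: "f * qscale c g = qscale c (f * g)"
  by (rule series_eqI) (simp add: wcoeff_mult sum_distrib_left mult.left_commute)

lemma qscale_add: "qscale c (f + g) = qscale c f + qscale c g"
  by (rule series.scale_right_distrib)

lemma qscale_diff: "qscale c (f - g) = qscale c f - qscale c g"
  by (rule series.scale_right_diff_distrib)

lemma qscale_minus_one: "qscale (- 1) f = - f"
  by (rule series_eqI) simp

lemma br_self [simp]: "br f f = 0"
  by (simp add: br_def)

lemma br_zero [simp]: "br 0 f = 0" "br f 0 = 0"
  by (simp_all add: br_def)

lemma br_add_left: "br (f + g) h = br f h + br g h"
  and br_add_right: "br f (g + h) = br f g + br f h"
  and br_diff_left: "br (f - g) h = br f h - br g h"
  and br_diff_right: "br f (g - h) = br f g - br f h"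
  and br_minus_left: "br (- f) h = - br f h"
  and br_minus_right: "br f (- h) = - br f h"
  for f g h :: "'a::ring"
  by (simp_all add: br_def algebra_simps)

lemma br_swap: "br f g = - br g f" for f g :: "'a::ring"
  by (simp add: br_def)

lemma br_jacobi: "br f (br g h) = br (br f g) h + br g (br f h)" for f g h :: "'a::ring"
  by (simp add: br_def algebra_simps)

lemma br_qscale: "br (qscale c f) g = qscale c (br f g)" "br f (qscale c g) = qscale c (br f g)"
  by (simp_all add: br_def qscale_mult_left qscale_mult_right qscale_diff)

lemma br_sum_left: "br (sum f A) g = (\<Sum>x\<in>A. br (f x) g)" for g :: "'a::ring"
  by (simp add: br_def sum_distrib_left sum_distrib_right sum_subtractf)

lemma br_sum_right: "br g (sum f A) = (\<Sum>x\<in>A. br g (f x))" for g :: "'a::ring"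
  by (simp add: br_def sum_distrib_left sum_distrib_right sum_subtractf)

section \<open>The degree filtration and continuous linear maps\<close>

definition vanish :: "nat \<Rightarrow> 'a series \<Rightarrow> bool" where
  "vanish n f \<longleftrightarrow> (\<forall>w. length w < n \<longrightarrow> wcoeff f w = 0)"

lemma vanishI: "(\<And>w. length w < n \<Longrightarrow> wcoeff f w = 0) \<Longrightarrow> vanish n f"
  by (simp add: vanish_def)

lemma vanishD: "vanish n f \<Longrightarrow> length w < n \<Longrightarrow> wcoeff f w = 0"
  by (simp add: vanish_def)

lemma vanish_mono: "vanish n f \<Longrightarrow> m \<le> n \<Longrightarrow> vanish m f"
  by (simp add: vanish_def)

lemma vanish_0 [simp]: "vanish 0 f"
  by (simp add: vanish_def)

lemma vanish_zero [simp]: "vanish n 0"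
  by (simp add: vanish_def)

lemma vanish_add: "vanish n f \<Longrightarrow> vanish n g \<Longrightarrow> vanish n (f + g)"
  and vanish_diff: "vanish n f \<Longrightarrow> vanish n g \<Longrightarrow> vanish n (f - g)"
  and vanish_uminus: "vanish n f \<Longrightarrow> vanish n (- f)"
  and vanish_qscale: "vanish n f \<Longrightarrow> vanish n (qscale c f)"
  by (simp_all add: vanish_def)

lemma vanish_mult:
  assumes "vanish m f" "vanish n g"
  shows "vanish (m + n) (f * g)"
proof (rule vanishI)
  fix w :: "'a list" assume w: "length w < m + n"
  have "wcoeff f (take i w) * wcoeff g (drop i w) = 0" if "i \<le> length w" for i
    using assms w that unfolding vanish_def by (cases "i < m") auto
  then show "wcoeff (f * g) w = 0"
    unfolding wcoeff_mult by (intro sum.neutral) auto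
qed

lemma vanish_br: "vanish m f \<Longrightarrow> vanish n g \<Longrightarrow> vanish (m + n) (br f g)"
  unfolding br_def using vanish_mult[of m f n g] vanish_mult[of n g m f]
  by (auto intro: vanish_diff simp: add.commute)

lemma vanish_1_iff: "vanish (Suc 0) f \<longleftrightarrow> wcoeff f [] = 0"
  by (auto simp: vanish_def)

lemma vanish_prod_list:
  "(\<And>a. a \<in> set w \<Longrightarrow> wcoeff (\<sigma> a) [] = 0) \<Longrightarrow> vanish (length w) (prod_list (map \<sigma> w))"
proof (induction w)
  case (Cons a w)
  then have "vanish (Suc 0 + length w) (\<sigma> a * prod_list (map \<sigma> w))"
    by (intro vanish_mult) (auto simp: vanish_1_iff)
  then show ?case by simp
qed simp

text \<open>For a linear map, continuity at 0 in the degree topology. The degree loss may be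
  arbitrary: \<open>rquot\<close> lowers degrees by one and matrix entries lower them by up to
  two.\<close>

definition clin :: "('a series \<Rightarrow> 'b series) \<Rightarrow> bool" where
  "clin F \<longleftrightarrow> (\<forall>f g. F (f + g) = F f + F g) \<and> (\<forall>c f. F (qscale c f) = qscale c (F f)) \<and>
     (\<forall>n. \<exists>m. \<forall>f. vanish m f \<longrightarrow> vanish n (F f))"

lemma clinI:
  assumes "\<And>f g. F (f + g) = F f + F g" "\<And>c f. F (qscale c f) = qscale c (F f)"
    "\<And>n. \<exists>m. \<forall>f. vanish m f \<longrightarrow> vanish n (F f)"
  shows "clin F"
  using assms by (simp add: clin_def)

lemma clin_add: "clin F \<Longrightarrow> F (f + g) = F f + F g"
  and clin_scale: "clin F \<Longrightarrow> F (qscale c f) = qscale c (F f)"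
  and clin_cont: "clin F \<Longrightarrow> \<exists>m. \<forall>f. vanish m f \<longrightarrow> vanish n (F f)"
  by (simp_all add: clin_def)

lemma clin_zero: "clin F \<Longrightarrow> F 0 = 0"
  by (metis clin_add add_cancel_left_right)

lemma clin_minus: "clin F \<Longrightarrow> F (- f) = - F f"
  by (metis clin_scale qscale_minus_one)

lemma clin_diff: "clin F \<Longrightarrow> F (f - g) = F f - F g"
  by (metis clin_add clin_minus diff_conv_add_uminus)

lemma clin_sum: "clin F \<Longrightarrow> F (sum f A) = (\<Sum>x\<in>A. F (f x))"
  by (induction A rule: infinite_finite_induct) (auto simp: clin_zero clin_add)

lemma clin_id [intro!]: "clin (\<lambda>f. f)"
  by (rule clinI) auto

lemma clin_0 [intro!]: "clin (\<lambda>f. 0)"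
  by (rule clinI) auto

lemma clin_comp:
  assumes "clin F" "clin G"
  shows "clin (\<lambda>f. F (G f))"
proof (rule clinI)
  fix n
  from clin_cont[OF assms(1), of n] obtain m where "\<forall>f. vanish m f \<longrightarrow> vanish n (F f)" by blast
  moreover from clin_cont[OF assms(2), of m] obtain k where "\<forall>f. vanish k f \<longrightarrow> vanish m (G f)" by blast
  ultimately show "\<exists>m. \<forall>f. vanish m f \<longrightarrow> vanish n (F (G f))" by blast
qed (simp_all add: assms clin_add clin_scale)

lemma clin_plus [intro!]:
  assumes "clin F" "clin G"
  shows "clin (\<lambda>f. F f + G f)"
proof (rule clinI)
  fix n
  from clin_cont[OF assms(1), of n] obtain m where "\<forall>f. vanish m f \<longrightarrow> vanish n (F f)" by blast
  moreover from clin_cont[OF assms(2), of n] obtain k where "\<forall>f. vanish k f \<longrightarrow> vanish n (G f)" by blast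
  ultimately show "\<exists>m. \<forall>f. vanish m f \<longrightarrow> vanish n (F f + G f)"
    by (intro exI[of _ "max m k"]) (metis max.cobounded1 max.cobounded2 vanish_add vanish_mono)
qed (simp_all add: assms clin_add clin_scale qscale_add)

lemma clin_qscale [intro!]:
  assumes "clin F"
  shows "clin (\<lambda>f. qscale c (F f))"
proof (rule clinI)
  fix n
  from clin_cont[OF assms(1), of n] show "\<exists>m. \<forall>f. vanish m f \<longrightarrow> vanish n (qscale c (F f))"
    by (auto intro: vanish_qscale)
qed (simp_all add: assms clin_add clin_scale qscale_add series.scale_left_commute mult.commute)

lemma clin_uminus [intro!]: "clin F \<Longrightarrow> clin (\<lambda>f. - F f)"
  using clin_qscale[of F "-1"] by (simp add: qscale_minus_one)

lemma clin_minusI [intro!]: "clin F \<Longrightarrow> clin G \<Longrightarrow> clin (\<lambda>f. F f - G f)"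
  using clin_plus[of F "\<lambda>f. - G f"] by auto

lemma clin_sumI [intro!]: "(\<And>x. x \<in> A \<Longrightarrow> clin (F x)) \<Longrightarrow> clin (\<lambda>f. \<Sum>x\<in>A. F x f)"
  by (induction A rule: infinite_finite_induct) auto

lemma clin_mult_left [intro!]:
  assumes "clin F" shows "clin (\<lambda>f. F f * g)"
proof (rule clinI)
  fix n
  from clin_cont[OF assms(1), of n] obtain m where "\<forall>f. vanish m f \<longrightarrow> vanish n (F f)" by blast
  then show "\<exists>m. \<forall>f. vanish m f \<longrightarrow> vanish n (F f * g)"
    using vanish_mult[of n _ 0 g] by auto
qed (simp_all add: assms clin_add clin_scale distrib_right qscale_mult_left)

lemma clin_mult_right [intro!]:
  assumes "clin F" shows "clin (\<lambda>f. g * F f)"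
proof (rule clinI)
  fix n
  from clin_cont[OF assms(1), of n] obtain m where "\<forall>f. vanish m f \<longrightarrow> vanish n (F f)" by blast
  then show "\<exists>m. \<forall>f. vanish m f \<longrightarrow> vanish n (g * F f)"
    using vanish_mult[of 0 g n] by auto
qed (simp_all add: assms clin_add clin_scale distrib_left qscale_mult_right)

lemma clin_br [intro!]: "clin F \<Longrightarrow> clin (\<lambda>f. br (F f) g)" "clin F \<Longrightarrow> clin (\<lambda>f. br g (F f))"
  unfolding br_def by auto

lift_definition mon :: "'a list \<Rightarrow> 'a series" is "\<lambda>w v. if v = w then 1 else 0" .

lemma wcoeff_mon [simp]: "wcoeff (mon w) v = (if v = w then 1 else 0)"
  by (simp add: mon.rep_eq)

lemma mon_Nil [simp]: "mon [] = 1"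
  by (rule series_eqI) simp

lemma mon_single: "mon [a] = letter a"
  by (rule series_eqI) simp

lemma wcoeff_letter_mult:
  "wcoeff (letter a * f) w = (case w of [] \<Rightarrow> 0 | b # v \<Rightarrow> if b = a then wcoeff f v else 0)"
proof (cases w)
  case (Cons b v)
  have "wcoeff (letter a * f) w = (\<Sum>i\<le>length w. if i = Suc 0 then (if b = a then wcoeff f v else 0) else 0)"
    unfolding wcoeff_mult Cons by (rule sum.cong) (auto simp: take_Cons' split: nat.splits)
  also have "\<dots> = (if b = a then wcoeff f v else 0)"
    using Cons by (subst sum.delta) auto
  finally show ?thesis by (simp add: Cons)
qed (simp add: wcoeff_mult)

lemma wcoeff_mult_letter_snoc:
  "wcoeff (f * letter a) (v @ [b]) = (if b = a then wcoeff f v else 0)"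
proof -
  have "wcoeff (f * letter a) (v @ [b]) =
      (\<Sum>i\<le>length (v @ [b]). if i = length v then (if b = a then wcoeff f v else 0) else 0)"
    unfolding wcoeff_mult
  proof (rule sum.cong)
    fix i assume "i \<in> {..length (v @ [b])}"
    then consider "i < length v" | "i = length v" | "i = Suc (length v)" by force
    then show "wcoeff f (take i (v @ [b])) * wcoeff (letter a) (drop i (v @ [b])) =
        (if i = length v then if b = a then wcoeff f v else 0 else 0)"
      by cases (auto simp: append_eq_Cons_conv)
  qed simp
  then show ?thesis by simp
qed

lemma letter_mult_mon: "letter a * mon w = mon (a # w)"
  by (rule series_eqI) (simp add: wcoeff_letter_mult split: list.splits)

lemma prod_list_letter [simp]: "prod_list (map letter w) = mon w"
  by (induction w) (simp_all add: letter_mult_mon)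

lemma mon_mult: "mon u * mon v = mon (u @ v)"
  by (simp flip: prod_list_letter)

lemma finite_words_le: "finite {w :: 'a::finite list. length w \<le> n}"
  using finite_lists_length_le[of "UNIV :: 'a set" n] by simp

lemma finite_words_less: "finite {w :: 'a::finite list. length w < n}"
  by (rule finite_subset[OF _ finite_words_le[of n]]) auto

lemma wcoeff_trunc:
  "wcoeff (\<Sum>w | length w < m. qscale (wcoeff f w) (mon w)) v =
    (if length v < m then wcoeff f v else 0)" for f :: "'a::finite series"
proof -
  have "wcoeff (\<Sum>w | length w < m. qscale (wcoeff f w) (mon w)) v =
      (\<Sum>w | length w < m. if w = v then wcoeff f v else 0)"
    unfolding wcoeff_sum by (rule sum.cong) auto
  also have "\<dots> = (if length v < m then wcoeff f v else 0)"
    by (simp add: finite_words_less)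
  finally show ?thesis .
qed

text \<open>Over a finite alphabet a truncation is a finite combination of monomials, and continuity
  controls the remainder in each fixed degree.\<close>

lemma clin_eq_0:
  fixes F :: "'a::finite series \<Rightarrow> 'b series"
  assumes F: "clin F" and 0: "\<And>w. F (mon w) = 0"
  shows "F f = 0"
proof (rule series_eqI)
  fix v :: "'b list"
  from clin_cont[OF F, of "Suc (length v)"] obtain m
    where m: "\<And>f. vanish m f \<Longrightarrow> vanish (Suc (length v)) (F f)" by blast
  let ?t = "\<Sum>w | length w < m. qscale (wcoeff f w) (mon w)"
  have "vanish m (f - ?t)"
    by (rule vanishI) (simp add: wcoeff_trunc)
  then have "vanish (Suc (length v)) (F (f - ?t))" by (rule m)
  moreover have "F ?t = 0"
    by (simp add: clin_sum[OF F] clin_scale[OF F] 0)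
  ultimately show "wcoeff (F f) v = wcoeff 0 v"
    by (simp add: clin_diff[OF F] vanishD)
qed

lemma clin_ext:
  fixes F G :: "'a::finite series \<Rightarrow> 'b series"
  assumes "clin F" "clin G" "\<And>w. F (mon w) = G (mon w)"
  shows "F f = G f"
  using clin_eq_0[of "\<lambda>f. F f - G f" f] assms by auto

text \<open>\<open>wsumd d\<close> is \<open>wsum\<close> for families in which \<open>F w\<close> is supported on words of length at least
  \<open>length w - d\<close>.\<close>

lift_definition wsumd :: "nat \<Rightarrow> 'a::finite series \<Rightarrow> ('a list \<Rightarrow> 'b series) \<Rightarrow> 'b series" is
  "\<lambda>d f F v. \<Sum>w | length w \<le> length v + d. f w * F w v" .

lemma wsum_eq_wsumd: "wsum = wsumd 0"
  by (intro ext, transfer) simp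

lemma wcoeff_wsumd: "wcoeff (wsumd d f F) v = (\<Sum>w | length w \<le> length v + d. wcoeff f w * wcoeff (F w) v)"
  by (simp add: wsumd.rep_eq)

lemma clin_wsumd:
  "clin (\<lambda>f. wsumd d f F)"
proof (rule clinI)
  fix n
  have "vanish n (wsumd d f F)" if "vanish (n + d) f" for f
    using that by (intro vanishI) (auto simp: wcoeff_wsumd vanish_def intro!: sum.neutral)
  then show "\<exists>m. \<forall>f. vanish m f \<longrightarrow> vanish n (wsumd d f F)" by blast
qed (auto intro!: series_eqI simp: wcoeff_wsumd distrib_right sum.distrib sum_distrib_left mult.assoc)

lemma wsumd_mon:
  assumes "vanish (length w - d) (F w)"
  shows "wsumd d (mon w) F = F w"
proof (rule series_eqI)
  fix v
  have "wcoeff (wsumd d (mon w) F) v =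
      (\<Sum>u | length u \<le> length v + d. if u = w then wcoeff (F w) v else 0)"
    unfolding wcoeff_wsumd by (rule sum.cong) auto
  also have "\<dots> = (if length w \<le> length v + d then wcoeff (F w) v else 0)"
    by (simp add: finite_words_le)
  also have "\<dots> = wcoeff (F w) v"
    using assms by (auto simp: vanish_def)
  finally show "wcoeff (wsumd d (mon w) F) v = wcoeff (F w) v" .
qed

section \<open>Substitutions and derivations\<close>

abbreviation nc :: "('a \<Rightarrow> 'b series) \<Rightarrow> bool" where
  "nc \<sigma> \<equiv> \<forall>a. wcoeff (\<sigma> a) [] = 0"

lemma clin_substitute [intro!]: "clin (substitute \<sigma>)"
  unfolding substitute_def wsum_eq_wsumd by (rule clin_wsumd)

lemma clin_der [intro!]: "clin (der \<sigma> \<delta>)"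
  unfolding der_def wsum_eq_wsumd by (rule clin_wsumd)

lemma clin_substituteI [intro!]: "clin F \<Longrightarrow> clin (\<lambda>f. substitute \<sigma> (F f))"
  by (rule clin_comp[OF clin_substitute])

lemma clin_derI [intro!]: "clin F \<Longrightarrow> clin (\<lambda>f. der \<sigma> \<delta> (F f))"
  by (rule clin_comp[OF clin_der])

lemma substitute_mon: "nc \<sigma> \<Longrightarrow> substitute \<sigma> (mon w) = prod_list (map \<sigma> w)"
  unfolding substitute_def wsum_eq_wsumd by (subst wsumd_mon) (auto intro: vanish_prod_list)

lemma substitute_letter [simp]: "nc \<sigma> \<Longrightarrow> substitute \<sigma> (letter a) = \<sigma> a"
  using substitute_mon[of \<sigma> "[a]"] by (simp add: mon_single)

lemma substitute_one [simp]: "nc \<sigma> \<Longrightarrow> substitute \<sigma> 1 = 1"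
  using substitute_mon[of \<sigma> "[]"] by simp

lemma bilinear_ext:
  fixes B C :: "'a::finite series \<Rightarrow> 'b::finite series \<Rightarrow> 'c series"
  assumes "\<And>g. clin (\<lambda>f. B f g)" "\<And>f. clin (B f)" "\<And>g. clin (\<lambda>f. C f g)" "\<And>f. clin (C f)"
    and "\<And>u v. B (mon u) (mon v) = C (mon u) (mon v)"
  shows "B f g = C f g"
proof -
  have "B (mon u) g = C (mon u) g" for u
    by (rule clin_ext[of "B (mon u)"]) (use assms in auto)
  then show ?thesis
    using clin_ext[of "\<lambda>f. B f g" "\<lambda>f. C f g" f] assms by auto
qed

lemma substitute_mult: "nc \<sigma> \<Longrightarrow> substitute \<sigma> (f * g) = substitute \<sigma> f * substitute \<sigma> g"
  by (rule bilinear_ext[of "\<lambda>f g. substitute \<sigma> (f * g)"]) (auto simp: mon_mult substitute_mon)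

lemmas substitute_add = clin_add[OF clin_substitute]
  and substitute_diff = clin_diff[OF clin_substitute]
  and substitute_minus = clin_minus[OF clin_substitute]
  and substitute_qscale = clin_scale[OF clin_substitute]
  and substitute_zero [simp] = clin_zero[OF clin_substitute]
  and substitute_sum = clin_sum[OF clin_substitute]

lemma substitute_br: "nc \<sigma> \<Longrightarrow> substitute \<sigma> (br f g) = br (substitute \<sigma> f) (substitute \<sigma> g)"
  by (simp add: br_def substitute_diff substitute_mult)

lemma substitute_Nil [simp]: "wcoeff (substitute \<sigma> f) [] = wcoeff f []"
  unfolding substitute_def wsum_eq_wsumd by (simp add: wcoeff_wsumd)

lemma substitute_substitute:
  assumes "nc \<sigma>" "nc \<tau>"
  shows "substitute \<sigma> (substitute \<tau> f) = substitute (\<lambda>a. substitute \<sigma> (\<tau> a)) f"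
proof (rule clin_ext[of "\<lambda>f. substitute \<sigma> (substitute \<tau> f)"])
  fix w
  have "substitute \<sigma> (prod_list (map \<tau> w)) = prod_list (map (\<lambda>a. substitute \<sigma> (\<tau> a)) w)"
    by (induction w) (simp_all add: assms substitute_mult)
  then show "substitute \<sigma> (substitute \<tau> (mon w)) = substitute (\<lambda>a. substitute \<sigma> (\<tau> a)) (mon w)"
    using assms by (simp add: substitute_mon)
qed auto

lemma substitute_letter_id: "substitute letter f = f"
  by (rule clin_ext[of "substitute letter"]) (auto simp: substitute_mon)

lemma vanish_der_word:
  assumes "nc \<sigma>" "nc \<delta>"
  shows "vanish (length w) (der_word \<sigma> \<delta> w)"
proof (induction w)
  case (Cons a w)
  have "vanish (Suc 0 + length w) (\<delta> a * prod_list (map \<sigma> w))"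
    using assms by (intro vanish_mult vanish_prod_list) (auto simp: vanish_1_iff)
  moreover have "vanish (Suc 0 + length w) (\<sigma> a * der_word \<sigma> \<delta> w)"
    using assms Cons by (intro vanish_mult) (auto simp: vanish_1_iff)
  ultimately show ?case by (simp add: vanish_add)
qed simp

lemma der_mon: "nc \<sigma> \<Longrightarrow> nc \<delta> \<Longrightarrow> der \<sigma> \<delta> (mon w) = der_word \<sigma> \<delta> w"
  unfolding der_def wsum_eq_wsumd by (subst wsumd_mon) (auto intro: vanish_der_word)

lemma der_word_append:
  "der_word \<sigma> \<delta> (u @ v) = der_word \<sigma> \<delta> u * prod_list (map \<sigma> v) + prod_list (map \<sigma> u) * der_word \<sigma> \<delta> v"
  by (induction u) (simp_all add: algebra_simps)

lemma der_mult:
  "nc \<sigma> \<Longrightarrow> nc \<delta> \<Longrightarrow> der \<sigma> \<delta> (f * g) = der \<sigma> \<delta> f * substitute \<sigma> g + substitute \<sigma> f * der \<sigma> \<delta> g"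
  by (rule bilinear_ext[of "\<lambda>f g. der \<sigma> \<delta> (f * g)"])
    (auto simp: mon_mult der_mon substitute_mon der_word_append)

lemma der_letter [simp]: "nc \<sigma> \<Longrightarrow> nc \<delta> \<Longrightarrow> der \<sigma> \<delta> (letter a) = \<delta> a"
  using der_mon[of \<sigma> \<delta> "[a]"] by (simp add: mon_single)

lemma der_one [simp]: "nc \<sigma> \<Longrightarrow> nc \<delta> \<Longrightarrow> der \<sigma> \<delta> 1 = 0"
  using der_mon[of \<sigma> \<delta> "[]"] by simp

lemmas der_add = clin_add[OF clin_der]
  and der_diff = clin_diff[OF clin_der]
  and der_minus = clin_minus[OF clin_der]
  and der_qscale = clin_scale[OF clin_der]
  and der_zero [simp] = clin_zero[OF clin_der]
  and der_sum = clin_sum[OF clin_der]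

lemma der_br:
  "nc \<sigma> \<Longrightarrow> nc \<delta> \<Longrightarrow> der \<sigma> \<delta> (br f g) = br (der \<sigma> \<delta> f) (substitute \<sigma> g) + br (substitute \<sigma> f) (der \<sigma> \<delta> g)"
  by (simp add: br_def der_diff der_mult algebra_simps)

lemma der_Nil [simp]: "wcoeff (der \<sigma> \<delta> f) [] = 0"
  unfolding der_def wsum_eq_wsumd by (simp add: wcoeff_wsumd)

lemma vanish_der: "vanish n f \<Longrightarrow> vanish n (der \<sigma> \<delta> f)"
  unfolding der_def wsum_eq_wsumd
  by (intro vanishI) (auto simp: wcoeff_wsumd vanish_def intro!: sum.neutral)

lemma nc_letter [simp]: "nc letter"
  by simp

abbreviation deriv :: "('a::finite \<Rightarrow> 'a series) \<Rightarrow> 'a series \<Rightarrow> 'a series" where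
  "deriv \<equiv> der letter"

lemma deriv_mult: "nc \<delta> \<Longrightarrow> deriv \<delta> (f * g) = deriv \<delta> f * g + f * deriv \<delta> g"
  by (simp add: der_mult substitute_letter_id)

lemma deriv_br: "nc \<delta> \<Longrightarrow> deriv \<delta> (br f g) = br (deriv \<delta> f) g + br f (deriv \<delta> g)"
  by (simp add: der_br substitute_letter_id)

text \<open>Taking both factors equal to 1 forces \<open>F 1 = G 1 = 0\<close>; monomials are then
  built up letter by letter.\<close>

lemma derivation_ext:
  fixes F G :: "'a::finite series \<Rightarrow> 'b series"
  assumes F: "clin F" "\<And>f g. F (f * g) = F f * S g + S f * F g"
    and G: "clin G" "\<And>f g. G (f * g) = G f * S g + S f * G g"
    and S: "S 1 = 1"
    and eq: "\<And>a. F (letter a) = G (letter a)"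
  shows "F f = G f"
proof (rule clin_ext[OF F(1) G(1)])
  have 1: "F 1 = 0" "G 1 = 0"
    using F(2)[of 1 1] G(2)[of 1 1] S by simp_all
  fix w show "F (mon w) = G (mon w)"
    by (induction w) (simp_all add: 1 F(2) G(2) eq flip: letter_mult_mon)
qed

section \<open>Lie series and closed Lie ideals\<close>

lemma deg_closure_iff: "f \<in> deg_closure S \<longleftrightarrow> (\<forall>n. \<exists>g\<in>S. vanish n (f - g))"
  by (simp add: deg_closure_def vanish_def)

lemma deg_closureD:
  assumes "f \<in> deg_closure S" obtains g where "g \<in> S" "vanish n (f - g)"
  using assms by (auto simp: deg_closure_iff)

lemma deg_closure_subset: "S \<subseteq> deg_closure S"
  unfolding deg_closure_iff by (metis diff_self subsetI vanish_zero deg_closure_iff)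

lemma deg_closure_idem: "deg_closure (deg_closure S) = deg_closure S"
proof -
  have "f \<in> deg_closure S" if f: "f \<in> deg_closure (deg_closure S)" for f
    unfolding deg_closure_iff
  proof
    fix n
    obtain g where g: "g \<in> deg_closure S" "vanish n (f - g)"
      using f by (rule deg_closureD)
    obtain h where h: "h \<in> S" "vanish n (g - h)"
      using g(1) by (rule deg_closureD)
    have "vanish n (f - h)"
      using vanish_add[OF g(2) h(2)] by simp
    then show "\<exists>g\<in>S. vanish n (f - g)" using h by blast
  qed
  then show ?thesis using deg_closure_subset by blast
qed

lemma deg_closure_zero: "0 \<in> S \<Longrightarrow> 0 \<in> deg_closure S"
  using deg_closure_subset by blast

lemma deg_closure_add:
  assumes "\<And>f g. f \<in> S \<Longrightarrow> g \<in> S \<Longrightarrow> f + g \<in> S" "f \<in> deg_closure S" "g \<in> deg_closure S"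
  shows "f + g \<in> deg_closure S"
  unfolding deg_closure_iff
proof
  fix n
  obtain f' where f: "f' \<in> S" "vanish n (f - f')" using assms(2) by (rule deg_closureD)
  obtain g' where g: "g' \<in> S" "vanish n (g - g')" using assms(3) by (rule deg_closureD)
  have "vanish n (f + g - (f' + g'))"
    using vanish_add[OF f(2) g(2)] by (simp add: algebra_simps)
  then show "\<exists>h\<in>S. vanish n (f + g - h)" using assms(1) f g by blast
qed

lemma deg_closure_image:
  assumes "clin F" "f \<in> deg_closure S" "\<And>g. g \<in> S \<Longrightarrow> F g \<in> deg_closure T"
  shows "F f \<in> deg_closure T"
proof -
  have "F f \<in> deg_closure (deg_closure T)"
    unfolding deg_closure_iff[of _ "deg_closure T"]
  proof
    fix n
    from clin_cont[OF assms(1), of n] obtain m where m: "\<And>f. vanish m f \<Longrightarrow> vanish n (F f)" by blast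
    obtain g where g: "g \<in> S" "vanish m (f - g)" using assms(2) by (rule deg_closureD)
    have "vanish n (F f - F g)" using m[OF g(2)] by (simp add: clin_diff[OF assms(1)])
    then show "\<exists>h\<in>deg_closure T. vanish n (F f - h)" using assms(3) g by blast
  qed
  then show ?thesis by (simp add: deg_closure_idem)
qed

lemma lie_poly_Nil: "f \<in> lie_poly \<Longrightarrow> wcoeff f [] = 0"
  by (induction rule: lie_poly.induct) (auto simp: br_def)

lemma lie_poly_in_series: "f \<in> lie_poly \<Longrightarrow> f \<in> lie_series"
  unfolding lie_series_def using deg_closure_subset by blast

lemma lie_series_Nil: "f \<in> lie_series \<Longrightarrow> wcoeff f [] = 0"
  unfolding lie_series_def
  by (erule deg_closureD[where n = 1]) (use lie_poly_Nil vanishD[where w = "[]" and n = 1] in fastforce)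

lemma nc_lie: "(\<And>a. \<sigma> a \<in> lie_series) \<Longrightarrow> nc \<sigma>"
  by (simp add: lie_series_Nil)

lemma lie_series_zero [simp]: "0 \<in> lie_series"
  and lie_series_letter [simp]: "letter a \<in> lie_series"
  by (auto intro: lie_poly_in_series lie_poly.intros)

lemma lie_series_add: "f \<in> lie_series \<Longrightarrow> g \<in> lie_series \<Longrightarrow> f + g \<in> lie_series"
  unfolding lie_series_def by (rule deg_closure_add) (auto intro: lie_poly.intros)

lemma lie_series_image:
  assumes "clin F" "f \<in> lie_series" "\<And>g. g \<in> lie_poly \<Longrightarrow> F g \<in> lie_series"
  shows "F f \<in> lie_series"
  using assms unfolding lie_series_def by (rule deg_closure_image)

lemma lie_series_qscale: "f \<in> lie_series \<Longrightarrow> qscale c f \<in> lie_series"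
  by (rule lie_series_image[of "qscale c"]) (auto intro: lie_poly_in_series lie_poly.intros)

lemma lie_series_minus: "f \<in> lie_series \<Longrightarrow> - f \<in> lie_series"
  using lie_series_qscale[of f "-1"] by (simp add: qscale_minus_one)

lemma lie_series_diff: "f \<in> lie_series \<Longrightarrow> g \<in> lie_series \<Longrightarrow> f - g \<in> lie_series"
  using lie_series_add[of f "- g"] by (simp add: lie_series_minus)

lemma lie_series_sum: "(\<And>x. x \<in> A \<Longrightarrow> f x \<in> lie_series) \<Longrightarrow> sum f A \<in> lie_series"
  by (induction A rule: infinite_finite_induct) (auto intro: lie_series_add)

lemma lie_series_br:
  assumes "f \<in> lie_series" "g \<in> lie_series"
  shows "br f g \<in> lie_series"
proof (rule lie_series_image[of "\<lambda>f. br f g"])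
  fix h :: "'a series" assume h: "h \<in> lie_poly"
  show "br h g \<in> lie_series"
    by (rule lie_series_image[of "br h"]) (use assms h in \<open>auto intro: lie_poly_in_series lie_poly.intros\<close>)
qed (use assms in auto)

lemmas lie_series_intros [simp, intro] =
  lie_series_add lie_series_qscale lie_series_minus lie_series_diff lie_series_sum lie_series_br

definition lie_hom :: "('a series \<Rightarrow> 'b series) \<Rightarrow> bool" where
  "lie_hom S \<longleftrightarrow> clin S \<and> (\<forall>f g. S (br f g) = br (S f) (S g)) \<and> (\<forall>f\<in>lie_series. S f \<in> lie_series)"

lemma lie_hom_substitute:
  assumes "\<And>a. \<sigma> a \<in> lie_series"
  shows "lie_hom (substitute \<sigma>)"
proof -
  have nc: "nc \<sigma>" by (intro nc_lie assms)
  have *: "substitute \<sigma> f \<in> lie_series" if "f \<in> lie_poly" for f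
    using that by induction (auto simp: assms nc substitute_br substitute_add substitute_qscale)
  then have "substitute \<sigma> f \<in> lie_series" if "f \<in> lie_series" for f
    using that by (auto intro: lie_series_image[of "substitute \<sigma>"])
  then show ?thesis by (auto simp: lie_hom_def substitute_br nc)
qed

lemma lie_substitute [simp, intro]:
  "(\<And>a. \<sigma> a \<in> lie_series) \<Longrightarrow> f \<in> lie_series \<Longrightarrow> substitute \<sigma> f \<in> lie_series"
  using lie_hom_substitute unfolding lie_hom_def by blast

lemma lie_deriv [simp, intro]:
  assumes "\<And>a. \<delta> a \<in> lie_series" "f \<in> lie_series"
  shows "deriv \<delta> f \<in> lie_series"
proof -
  have nc: "nc \<delta>" by (intro nc_lie assms)
  have "deriv \<delta> f \<in> lie_series" if "f \<in> lie_poly" for f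
    using that by induction
      (auto simp: assms nc deriv_br der_add der_qscale intro!: lie_series_intros intro: lie_poly_in_series)
  then show ?thesis
    using assms by (auto intro: lie_series_image[of "deriv \<delta>"])
qed

section \<open>Computation modulo closed Lie ideals\<close>

definition closed_ideal :: "'a series set \<Rightarrow> bool" where
  "closed_ideal I \<longleftrightarrow> 0 \<in> I \<and> (\<forall>f\<in>I. \<forall>g\<in>I. f + g \<in> I) \<and> (\<forall>c. \<forall>f\<in>I. qscale c f \<in> I) \<and>
     (\<forall>f\<in>lie_series. \<forall>g\<in>I. br f g \<in> I) \<and> deg_closure I \<subseteq> I"

locale closed_lie_ideal =
  fixes I :: "'a::finite series set"
  assumes closed_ideal: "closed_ideal I"
begin

lemma ideal_zero [simp]: "0 \<in> I"
  and ideal_add: "f \<in> I \<Longrightarrow> g \<in> I \<Longrightarrow> f + g \<in> I"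
  and ideal_qscale: "f \<in> I \<Longrightarrow> qscale c f \<in> I"
  and ideal_br_right: "f \<in> lie_series \<Longrightarrow> g \<in> I \<Longrightarrow> br f g \<in> I"
  and ideal_closure: "f \<in> deg_closure I \<Longrightarrow> f \<in> I"
  using closed_ideal by (auto simp: closed_ideal_def)

lemma ideal_minus: "f \<in> I \<Longrightarrow> - f \<in> I"
  using ideal_qscale[of f "-1"] by (simp add: qscale_minus_one)

lemma ideal_diff: "f \<in> I \<Longrightarrow> g \<in> I \<Longrightarrow> f - g \<in> I"
  using ideal_add[of f "- g"] by (simp add: ideal_minus)

lemma ideal_br_left: "f \<in> lie_series \<Longrightarrow> g \<in> I \<Longrightarrow> br g f \<in> I"
  using ideal_minus[OF ideal_br_right[of f g]] by (simp add: br_def)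

lemma ideal_sum: "(\<And>x. x \<in> A \<Longrightarrow> f x \<in> I) \<Longrightarrow> sum f A \<in> I"
  by (induction A rule: infinite_finite_induct) (auto intro: ideal_add)

lemma ideal_cong: "f - g \<in> I \<Longrightarrow> g \<in> I \<Longrightarrow> f \<in> I"
  using ideal_add[of "f - g" g] by simp

lemma ideal_trans: "f - g \<in> I \<Longrightarrow> g - h \<in> I \<Longrightarrow> f - h \<in> I"
  using ideal_add[of "f - g" "g - h"] by simp

lemma ideal_sym: "f - g \<in> I \<Longrightarrow> g - f \<in> I"
  using ideal_minus[of "f - g"] by simp

lemma ideal_refl: "f - f \<in> I"
  by simp

lemma ideal_br_cong:
  assumes "f - f' \<in> I" "g - g' \<in> I" "f \<in> lie_series" "g' \<in> lie_series"
  shows "br f g - br f' g' \<in> I"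
proof -
  have "br f g - br f' g' = br f (g - g') + br (f - f') g'"
    by (simp add: br_add_left br_diff_left br_diff_right)
  then show ?thesis using assms by (auto intro: ideal_add ideal_br_left ideal_br_right)
qed

lemma ideal_add_cong: "f - f' \<in> I \<Longrightarrow> g - g' \<in> I \<Longrightarrow> (f + g) - (f' + g') \<in> I"
  using ideal_add[of "f - f'" "g - g'"] by (simp add: algebra_simps)

lemma ideal_diff_cong: "f - f' \<in> I \<Longrightarrow> g - g' \<in> I \<Longrightarrow> (f - g) - (f' - g') \<in> I"
  using ideal_diff[of "f - f'" "g - g'"] by (simp add: algebra_simps)

lemma ideal_image:
  assumes "clin F" "f \<in> deg_closure S" "\<And>g. g \<in> S \<Longrightarrow> F g \<in> I"
  shows "F f \<in> I"
proof (rule ideal_closure, rule deg_closure_image[OF assms(1,2)])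
  fix g assume "g \<in> S"
  then show "F g \<in> deg_closure I" using assms(3) deg_closure_subset by blast
qed

text \<open>The uniqueness principle behind all comparisons modulo \<open>I\<close> below: it applies to the difference
  of two homomorphisms (\<open>S\<close> and \<open>S'\<close>) as well as to a derivation along a homomorphism \<open>S = S'\<close>.\<close>

lemma twisted_derivation_in_ideal:
  assumes F: "clin F" and S: "lie_hom S" "lie_hom S'"
    and der: "\<And>f g. f \<in> lie_series \<Longrightarrow> g \<in> lie_series \<Longrightarrow> F (br f g) = br (F f) (S g) + br (S' f) (F g)"
    and letters: "\<And>a. F (letter a) \<in> I" and f: "f \<in> lie_series"
  shows "F f \<in> I"
proof -
  have "F f \<in> I" if "f \<in> lie_poly" for f
    using that
  proof induction
    case (br f g)
    then have "S g \<in> lie_series" "S' f \<in> lie_series" using S by (auto simp: lie_hom_def lie_poly_in_series)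
    then show ?case using br by (simp add: der lie_poly_in_series ideal_add ideal_br_left ideal_br_right)
  qed (auto simp: letters clin_zero[OF F] clin_add[OF F] clin_scale[OF F] intro: ideal_add ideal_qscale)
  then show ?thesis
    using f F ideal_image unfolding lie_series_def by blast
qed

end

lemma closed_ideal_zero: "closed_ideal {0}"
proof -
  have "f = 0" if f: "f \<in> deg_closure {0}" for f :: "'a series"
  proof (rule series_eqI)
    fix w :: "'a list"
    obtain g where "g \<in> {0}" "vanish (Suc (length w)) (f - g)" using f by (rule deg_closureD)
    then show "wcoeff f w = wcoeff 0 w" by (auto simp: vanish_def)
  qed
  then show ?thesis by (auto simp: closed_ideal_def)
qed

definition quot :: "'a series set \<Rightarrow> 'a series set" where
  "quot R = deg_closure (lie_ideal R)"

lemma lie_cong_iff: "lie_cong R f g \<longleftrightarrow> f - g \<in> quot R"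
  by (simp add: lie_cong_def quot_def)

lemma quot_rel: "r \<in> R \<Longrightarrow> r \<in> quot R"
  unfolding quot_def using deg_closure_subset lie_ideal.rel by blast

lemma closed_ideal_quot: "closed_ideal (quot R)"
proof -
  have br: "br f g \<in> quot R" if f: "f \<in> lie_series" and g: "g \<in> quot R" for f g
    unfolding quot_def
  proof (rule deg_closure_image[of "\<lambda>f. br f g", OF _ f[unfolded lie_series_def]])
    fix h :: "'a series" assume h: "h \<in> lie_poly"
    show "br h g \<in> deg_closure (lie_ideal R)"
      by (rule deg_closure_image[of "br h", OF _ g[unfolded quot_def]])
        (auto intro: subsetD[OF deg_closure_subset] lie_ideal.br h)
  qed auto
  have "qscale c f \<in> quot R" if "f \<in> quot R" for c f
    unfolding quot_def
    by (rule deg_closure_image[of "qscale c", OF _ that[unfolded quot_def]])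
      (auto intro: subsetD[OF deg_closure_subset] lie_ideal.scale)
  then show ?thesis
    using br by (auto simp: closed_ideal_def quot_def deg_closure_idem
        intro!: deg_closure_add lie_ideal.zero lie_ideal.add deg_closure_zero)
qed

lemma (in closed_lie_ideal) quot_substitute:
  assumes \<sigma>: "\<And>a. \<sigma> a \<in> lie_series" and rels: "\<And>r. r \<in> R \<Longrightarrow> substitute \<sigma> r \<in> I"
    and f: "f \<in> quot R"
  shows "substitute \<sigma> f \<in> I"
proof -
  have nc: "nc \<sigma>" by (intro nc_lie \<sigma>)
  have "substitute \<sigma> f \<in> I" if "f \<in> lie_ideal R" for f
    using that by induction
      (auto simp: rels nc substitute_br substitute_add substitute_qscale \<sigma> lie_poly_in_series
        intro: ideal_add ideal_qscale ideal_br_right)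
  then show ?thesis
    using f ideal_image[OF clin_substitute] unfolding quot_def by blast
qed

lemma (in closed_lie_ideal) quot_deriv:
  assumes \<delta>: "\<And>a. \<delta> a \<in> lie_series" and R: "\<And>r. r \<in> R \<Longrightarrow> r \<in> I \<and> deriv \<delta> r \<in> I"
    and f: "f \<in> quot R"
  shows "deriv \<delta> f \<in> I"
proof -
  have nc: "nc \<delta>" by (intro nc_lie \<delta>)
  have "f \<in> I \<and> deriv \<delta> f \<in> I" if "f \<in> lie_ideal R" for f
    using that
  proof induction
    case (br f g)
    then have "f \<in> lie_series" "deriv \<delta> f \<in> lie_series" using \<delta> by (simp_all add: lie_poly_in_series)
    then show ?case using br by (simp add: nc deriv_br ideal_add ideal_br_right)
  qed (simp_all add: R der_add der_qscale ideal_add ideal_qscale)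
  then show ?thesis
    using f ideal_image[OF clin_der] unfolding quot_def by blast
qed

lemma (in closed_lie_ideal) substitute_cong:
  assumes "\<And>a. \<sigma> a \<in> lie_series" "\<And>a. \<tau> a \<in> lie_series" "\<And>a. \<sigma> a - \<tau> a \<in> I" "f \<in> lie_series"
  shows "substitute \<sigma> f - substitute \<tau> f \<in> I"
proof -
  have nc: "nc \<sigma>" "nc \<tau>" by (intro nc_lie assms(1,2))+
  show ?thesis
    by (rule twisted_derivation_in_ideal[of "\<lambda>f. substitute \<sigma> f - substitute \<tau> f" "substitute \<sigma>" "substitute \<tau>"])
      (use assms nc in \<open>auto simp: substitute_br br_diff_left br_diff_right intro: lie_hom_substitute\<close>)
qed

text \<open>The defect of the conjugation formula is itself a derivation along
  \<open>substitute \<sigma>\<close>, so its values on the letters decide.\<close>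

lemma (in closed_lie_ideal) intertwine:
  assumes "\<And>x. \<sigma> x \<in> lie_series" "\<And>x. \<delta> x \<in> lie_series" "\<And>x. \<delta>' x \<in> lie_series" "a \<in> lie_series"
    and "\<And>x. substitute \<sigma> (\<delta> x) - (deriv \<delta>' (\<sigma> x) + br a (\<sigma> x)) \<in> I"
    and "f \<in> lie_series"
  shows "substitute \<sigma> (deriv \<delta> f) - (deriv \<delta>' (substitute \<sigma> f) + br a (substitute \<sigma> f)) \<in> I"
proof -
  have nc: "nc \<sigma>" "nc \<delta>" "nc \<delta>'" by (intro nc_lie assms(1-3))+
  let ?S = "substitute \<sigma>"
  let ?F = "\<lambda>f. ?S (deriv \<delta> f) - (deriv \<delta>' (?S f) + br a (?S f))"
  show ?thesis
  proof (rule twisted_derivation_in_ideal[of ?F ?S ?S f])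
    show "?F (br f g) = br (?F f) (?S g) + br (?S f) (?F g)" for f g
      unfolding deriv_br[OF nc(2)] deriv_br[OF nc(3)] substitute_add substitute_br[OF nc(1)]
      by (simp add: br_def algebra_simps)
    show "clin ?F" by (intro clin_minusI clin_plus clin_substituteI clin_derI clin_br clin_id)
    show "?F (letter x) \<in> I" for x using assms(5)[of x] nc by simp
    show "lie_hom ?S" "lie_hom ?S" by (intro lie_hom_substitute assms(1))+
  qed (rule assms(6))
qed

lemma lie_series_br_linear: "f \<in> lie_series \<Longrightarrow> g \<in> lie_series \<Longrightarrow> wcoeff (br f g) [a] = 0"
  using vanish_br[of 1 f 1 g] vanishD[of 2 "br f g" "[a]"]
  by (simp add: vanish_1_iff lie_series_Nil numeral_2_eq_2)

text \<open>Brackets do not see central elements, so adding elements that commute with everything in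
  sight alters a Lie series only through its part of degree one.\<close>

lemma (in closed_lie_ideal) central_shift_linear:
  fixes f :: "'b::finite series"
  assumes \<sigma>: "\<And>a. \<sigma> a \<in> lie_series" and z: "\<And>a. z a \<in> lie_series"
    and comm: "\<And>a b. br (z a) (\<sigma> b) \<in> I" "\<And>a b. br (z a) (z b) \<in> I" and f: "f \<in> lie_series"
  shows "substitute (\<lambda>a. \<sigma> a + z a) f - substitute \<sigma> f - (\<Sum>a\<in>UNIV. qscale (wcoeff f [a]) (z a)) \<in> I"
proof -
  have nc: "nc \<sigma>" "nc z" by (intro nc_lie \<sigma> z)+
  let ?S = "substitute (\<lambda>a. \<sigma> a + z a)" and ?T = "substitute \<sigma>"
  let ?z = "\<lambda>f. \<Sum>a\<in>UNIV. qscale (wcoeff f [a]) (z a)"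
  have central: "br (z a) (?S g) \<in> I" "br (z a) (?T g) \<in> I" if "g \<in> lie_series" for a g
  proof -
    have *: "br (z a) (substitute \<tau> g) \<in> I"
      if "\<And>b. \<tau> b \<in> lie_series" "\<And>b. br (z a) (\<tau> b) \<in> I" for \<tau>
    proof (rule twisted_derivation_in_ideal[of "\<lambda>g. br (z a) (substitute \<tau> g)" "substitute \<tau>" "substitute \<tau>"])
      have "nc \<tau>" by (intro nc_lie that(1))
      then show "br (z a) (substitute \<tau> (br f g)) =
          br (br (z a) (substitute \<tau> f)) (substitute \<tau> g) + br (substitute \<tau> f) (br (z a) (substitute \<tau> g))"
        "br (z a) (substitute \<tau> (letter b)) \<in> I" for f g b
        using that by (simp_all add: substitute_br br_jacobi[of "z a" "substitute \<tau> f"])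
    qed (intro clin_br clin_substitute lie_hom_substitute that(1) \<open>g \<in> lie_series\<close>)+
    show "br (z a) (?S g) \<in> I" "br (z a) (?T g) \<in> I"
      using \<sigma> z comm by (auto intro!: * simp: br_add_right ideal_add)
  qed
  have zl: "?z g \<in> lie_series" for g using z by auto
  have cz: "br (?z g) (?S h) \<in> I" "br (?z g) (?T h) \<in> I" if "h \<in> lie_series" for g h
    using central[OF that] by (auto simp: br_sum_left br_qscale intro!: ideal_sum ideal_qscale)
  have clin_z: "clin ?z"
  proof (rule clinI)
    fix n
    have "vanish n (?z f)" if "vanish 2 f" for f
      using that by (simp add: vanish_def numeral_2_eq_2)
    then show "\<exists>m. \<forall>f. vanish m f \<longrightarrow> vanish n (?z f)" by blast
  qed (simp_all add: series.scale_left_distrib sum.distrib series.scale_sum_right)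
  let ?G = "\<lambda>f. ?S f - ?T f - ?z f"
  have G: "clin ?G" using clin_z by (intro clin_minusI clin_substitute)
  have "?G f \<in> I" if "f \<in> lie_poly" for f
    using that
  proof induction
    case (letter b)
    have "?z (letter b) = (\<Sum>a\<in>UNIV. if a = b then z b else 0)"
      by (rule sum.cong) auto
    then show ?case using nc by simp
  next
    case (br f g)
    then have lie: "f \<in> lie_series" "g \<in> lie_series" by (auto intro: lie_poly_in_series)
    have "?z (br f g) = 0" by (simp add: lie lie_series_br_linear)
    then have "?G (br f g) = br (?S f - ?T f) (?S g) + br (?T f) (?S g - ?T g)"
      using nc by (simp add: substitute_br br_diff_left br_diff_right)
    \<comment> \<open>The two summands with \<open>?z\<close> are brackets with central elements,
      hence in the ideal; up to these \<open>?G\<close> is a twisted derivation.\<close>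
    also have "\<dots> = br (?G f) (?S g) + br (?z f) (?S g) + br (?T f) (?G g) - br (?z g) (?T f)"
      by (simp add: br_def algebra_simps)
    also have "\<dots> \<in> I"
    proof -
      have "?S g \<in> lie_series" "?T f \<in> lie_series" using \<sigma> z lie by simp_all
      then show ?thesis
        by (intro ideal_add ideal_diff cz ideal_br_left[OF _ br.IH(1)] ideal_br_right[OF _ br.IH(2)] lie)
    qed
    finally show ?case .
  qed (auto simp only: clin_zero[OF G] clin_add[OF G] clin_scale[OF G] ideal_zero ideal_add ideal_qscale)
  then show ?thesis
    using f ideal_image[OF G] unfolding lie_series_def by blast
qed

lemma (in closed_lie_ideal) central_shift:
  fixes f :: "'b::finite series"
  assumes "\<And>a. \<sigma> a \<in> lie_series" "\<And>a. z a \<in> lie_series"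
    and "\<And>a b. br (z a) (\<sigma> b) \<in> I" "\<And>a b. br (z a) (z b) \<in> I" "f \<in> lie_series"
    and "\<And>a. wcoeff f [a] = 0"
  shows "substitute (\<lambda>a. \<sigma> a + z a) f - substitute \<sigma> f \<in> I"
  using central_shift_linear[of \<sigma> z f] assms by simp

section \<open>The Ihara bracket\<close>

text \<open>If conjugation by \<open>P\<close> changes the derivations \<open>D\<^sub>1\<close>, \<open>D\<^sub>2\<close> by the inner derivations \<open>ad a\<close>, \<open>ad b\<close>,
  then it changes \<open>[D\<^sub>1, D\<^sub>2]\<close> by \<open>ad c\<close>.  When \<open>P\<close> is cyclic and the sums of the orbits of \<open>a\<close> and \<open>b\<close> vanish,
  so does that of \<open>c\<close>; this shows at once that antisymmetry, hexagon and pentagon equations are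
  preserved by the bracket.\<close>

lemma (in closed_lie_ideal) cocycle_sum:
  assumes P: "lie_hom P" "\<And>f. f \<in> I \<Longrightarrow> P f \<in> I"
    and D: "clin D1" "clin D2" "\<And>f. f \<in> lie_series \<Longrightarrow> D1 f \<in> lie_series"
      "\<And>f. f \<in> lie_series \<Longrightarrow> D2 f \<in> lie_series"
    and conj: "\<And>f. f \<in> lie_series \<Longrightarrow> P (D1 f) - (D1 (P f) + br a (P f)) \<in> I"
      "\<And>f. f \<in> lie_series \<Longrightarrow> P (D2 f) - (D2 (P f) + br b (P f)) \<in> I"
    and ab: "a \<in> lie_series" "b \<in> lie_series"
  defines "c \<equiv> br a b + D1 b - D2 a"
  shows "(\<Sum>k<n. (P ^^ k) c) - (D1 (\<Sum>k<n. (P ^^ k) b) - D2 (\<Sum>k<n. (P ^^ k) a)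
      + br (\<Sum>k<n. (P ^^ k) a) (\<Sum>k<n. (P ^^ k) b)) \<in> I"
proof (induction n)
  case 0
  then show ?case by (simp add: clin_zero[OF D(1)] clin_zero[OF D(2)])
next
  case (Suc n)
  have cP: "clin P" using P(1) by (simp add: lie_hom_def)
  have lieP: "(P ^^ k) f \<in> lie_series" if "f \<in> lie_series" for k f
    using that P(1) by (induction k) (auto simp: lie_hom_def)
  have shift: "(\<Sum>k<Suc n. (P ^^ k) f) = f + P (\<Sum>k<n. (P ^^ k) f)" for f
    unfolding sum.lessThan_Suc_shift clin_sum[OF cP] by simp
  let ?A = "\<Sum>k<n. (P ^^ k) a" and ?B = "\<Sum>k<n. (P ^^ k) b" and ?C = "\<Sum>k<n. (P ^^ k) c"
  have lie: "?A \<in> lie_series" "?B \<in> lie_series" using lieP ab by auto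
  have "P (?C - (D1 ?B - D2 ?A + br ?A ?B)) \<in> I"
    by (rule P(2)[OF Suc])
  moreover have "P (br ?A ?B) = br (P ?A) (P ?B)" using P(1) by (simp add: lie_hom_def)
  ultimately have 1: "P ?C - (P (D1 ?B) - P (D2 ?A) + br (P ?A) (P ?B)) \<in> I"
    by (simp only: clin_diff[OF cP] clin_add[OF cP])
  have "(c + P ?C) - (D1 (b + P ?B) - D2 (a + P ?A) + br (a + P ?A) (b + P ?B)) =
     (P ?C - (P (D1 ?B) - P (D2 ?A) + br (P ?A) (P ?B))) +
     (P (D1 ?B) - (D1 (P ?B) + br a (P ?B))) - (P (D2 ?A) - (D2 (P ?A) + br b (P ?A)))"
    unfolding c_def clin_add[OF D(1)] clin_add[OF D(2)] by (simp add: br_def algebra_simps)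
  also have "\<dots> \<in> I"
    by (intro ideal_add ideal_diff 1 conj lie)
  finally show ?case unfolding shift .
qed

lemma ev_letters [simp]:
  "wcoeff a [] = 0 \<Longrightarrow> wcoeff b [] = 0 \<Longrightarrow> nc (case_ab a b)"
  by (auto split: ab.splits)

lemma ev_lie [simp, intro]:
  "a \<in> lie_series \<Longrightarrow> b \<in> lie_series \<Longrightarrow> \<psi> \<in> lie_series \<Longrightarrow> ev \<psi> a b \<in> lie_series"
  unfolding ev_def by (rule lie_substitute) (auto split: ab.splits)

lemma substitute_ev:
  assumes "nc \<sigma>" "wcoeff a [] = 0" "wcoeff b [] = 0"
  shows "substitute \<sigma> (ev \<psi> a b) = ev \<psi> (substitute \<sigma> a) (substitute \<sigma> b)"
proof -
  have "(\<lambda>x. substitute \<sigma> (case_ab a b x)) = case_ab (substitute \<sigma> a) (substitute \<sigma> b)"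
    by (auto split: ab.splits)
  then show ?thesis
    unfolding ev_def using assms by (subst substitute_substitute) auto
qed

lemma (in closed_lie_ideal) ev_cong:
  assumes "a \<in> lie_series" "a' \<in> lie_series" "b \<in> lie_series" "b' \<in> lie_series" "\<psi> \<in> lie_series"
    "a - a' \<in> I" "b - b' \<in> I"
  shows "ev \<psi> a b - ev \<psi> a' b' \<in> I"
  unfolding ev_def using assms by (intro substitute_cong) (auto split: ab.splits)

lemma (in closed_lie_ideal) ev_central_shift:
  assumes lie: "a \<in> lie_series" "b \<in> lie_series" "y \<in> lie_series" "z \<in> lie_series" "\<psi> \<in> lie_series"
    and lin: "\<And>l. wcoeff \<psi> [l] = 0"
    and comm: "br y a \<in> I" "br y b \<in> I" "br z a \<in> I" "br z b \<in> I" "br y z \<in> I"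
  shows "ev \<psi> (a + y) (b + z) - ev \<psi> a b \<in> I"
proof -
  have "br z y \<in> I" using ideal_minus[OF comm(5)] by (simp add: br_swap[of z y])
  then have "br (case_ab y z l) (case_ab a b m) \<in> I" "br (case_ab y z l) (case_ab y z m) \<in> I" for l m
    using comm by (auto split: ab.splits)
  moreover have "case_ab (a + y) (b + z) = (\<lambda>l. case_ab a b l + case_ab y z l)"
    by (auto split: ab.splits)
  ultimately show ?thesis
    unfolding ev_def using lie lin by (auto intro!: central_shift split: ab.splits)
qed

lemma (in closed_lie_ideal) br_ev:
  assumes "a \<in> lie_series" "b \<in> lie_series" "z \<in> lie_series" "\<psi> \<in> lie_series" "br z a \<in> I" "br z b \<in> I"
  shows "br z (ev \<psi> a b) \<in> I"
  unfolding ev_def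
proof (rule twisted_derivation_in_ideal[of "\<lambda>f. br z (substitute (case_ab a b) f)"
      "substitute (case_ab a b)" "substitute (case_ab a b)"])
  have nc: "nc (case_ab a b)" using assms by (simp add: lie_series_Nil)
  then show "br z (substitute (case_ab a b) (br f g)) =
     br (br z (substitute (case_ab a b) f)) (substitute (case_ab a b) g) +
     br (substitute (case_ab a b) f) (br z (substitute (case_ab a b) g))" for f g
    by (simp add: substitute_br br_jacobi[of z "substitute (case_ab a b) f"])
  show "br z (substitute (case_ab a b) (letter l)) \<in> I" for l
    using nc assms by (auto split: ab.splits)
  show "lie_hom (substitute (case_ab a b))" "lie_hom (substitute (case_ab a b))"
    using assms by (auto intro!: lie_hom_substitute split: ab.splits)
qed (use assms in auto)

section \<open>Ihara derivations, antisymmetry and the hexagon equations\<close>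

abbreviation lA :: "ab series" where "lA \<equiv> letter LA"
abbreviation lB :: "ab series" where "lB \<equiv> letter LB"
abbreviation lC :: "ab series" where "lC \<equiv> - lA - lB"

lemma ihara_nc [simp]: "nc (case_ab 0 (br lB \<psi>))"
  by (auto simp: br_def split: ab.splits)

lemma clin_ihara_der [intro!]: "clin (ihara_der \<psi>)"
  unfolding ihara_der_def by (rule clin_der)

lemma ihara_der_letters [simp]: "ihara_der \<psi> lA = 0" "ihara_der \<psi> lB = br lB \<psi>"
  by (simp_all add: ihara_der_def)

lemma ihara_der_mult: "ihara_der \<psi> (f * g) = ihara_der \<psi> f * g + f * ihara_der \<psi> g"
  by (simp add: ihara_der_def deriv_mult)

lemma ihara_der_br: "ihara_der \<psi> (br f g) = br (ihara_der \<psi> f) g + br f (ihara_der \<psi> g)"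
  by (simp add: ihara_der_def deriv_br)

lemmas ihara_der_arg = clin_add[OF clin_ihara_der] clin_diff[OF clin_ihara_der]
  clin_minus[OF clin_ihara_der] clin_scale[OF clin_ihara_der] clin_zero[OF clin_ihara_der]

lemma ihara_der_ext:
  assumes "clin F" "\<And>f g. F (f * g) = F f * g + f * F g" "F lA = 0" "F lB = br lB \<psi>"
  shows "F f = ihara_der \<psi> f"
proof (rule derivation_ext[where F = F and G = "ihara_der \<psi>" and S = "\<lambda>f. f"])
  show "F (letter l) = ihara_der \<psi> (letter l)" for l
    using assms(3,4) by (cases l) auto
qed (use assms(1,2) in \<open>auto simp: ihara_der_mult\<close>)

lemma ihara_der_add: "ihara_der (\<psi> + \<phi>) f = ihara_der \<psi> f + ihara_der \<phi> f"
  by (rule ihara_der_ext[symmetric])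
    (auto simp: ihara_der_mult br_add_right algebra_simps)

lemma ihara_der_qscale: "ihara_der (qscale c \<psi>) f = qscale c (ihara_der \<psi> f)"
  by (rule ihara_der_ext[symmetric])
    (auto simp: ihara_der_mult br_qscale qscale_add qscale_mult_left qscale_mult_right)

text \<open>Both sides are derivations that kill A, and the Ihara bracket is made so that they agree
  at B. The Jacobi identity of the bracket follows from this.\<close>

lemma ihara_der_commutator:
  "ihara_der (ihara_bracket \<psi> \<phi>) f = ihara_der \<psi> (ihara_der \<phi> f) - ihara_der \<phi> (ihara_der \<psi> f)"
proof (rule ihara_der_ext[symmetric])
  show "clin (\<lambda>f. ihara_der \<psi> (ihara_der \<phi> f) - ihara_der \<phi> (ihara_der \<psi> f))"
    by (intro clin_minusI clin_comp[OF clin_ihara_der] clin_ihara_der)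
qed (simp_all add: ihara_der_mult ihara_der_br ihara_der_arg ihara_bracket_def br_def algebra_simps)

lemma ihara_der_lie [simp, intro]: "\<psi> \<in> lie_series \<Longrightarrow> f \<in> lie_series \<Longrightarrow> ihara_der \<psi> f \<in> lie_series"
  unfolding ihara_der_def by (rule lie_deriv) (auto split: ab.splits)

lemma ihara_bracket_lie [simp, intro]:
  "\<psi> \<in> lie_series \<Longrightarrow> \<phi> \<in> lie_series \<Longrightarrow> ihara_bracket \<psi> \<phi> \<in> lie_series"
  by (simp add: ihara_bracket_def)

lemma ihara_bracket_add_left: "ihara_bracket (\<psi> + \<psi>') \<phi> = ihara_bracket \<psi> \<phi> + ihara_bracket \<psi>' \<phi>"
  and ihara_bracket_add_right: "ihara_bracket \<phi> (\<psi> + \<psi>') = ihara_bracket \<phi> \<psi> + ihara_bracket \<phi> \<psi>'"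
  and ihara_bracket_scale_left: "ihara_bracket (qscale c \<psi>) \<phi> = qscale c (ihara_bracket \<psi> \<phi>)"
  and ihara_bracket_scale_right: "ihara_bracket \<phi> (qscale c \<psi>) = qscale c (ihara_bracket \<phi> \<psi>)"
  and ihara_bracket_self: "ihara_bracket \<psi> \<psi> = 0"
  by (simp_all add: ihara_bracket_def ihara_der_arg ihara_der_add ihara_der_qscale br_add_left br_add_right
      br_qscale qscale_add qscale_diff algebra_simps)

lemma ihara_jacobi:
  "ihara_bracket f (ihara_bracket g h) + ihara_bracket g (ihara_bracket h f) +
    ihara_bracket h (ihara_bracket f g) = 0"
proof -
  have eq: "ihara_bracket f (ihara_bracket g h) = br f (br g h + ihara_der g h - ihara_der h g)
      + ihara_der f (br g h + ihara_der g h - ihara_der h g)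
      - (ihara_der g (ihara_der h f) - ihara_der h (ihara_der g f))" for f g h
    using ihara_der_commutator[of g h f] by (simp add: ihara_bracket_def)
  show ?thesis
    unfolding eq ihara_der_arg ihara_der_br by (simp add: br_def algebra_simps)
qed

text \<open>The first two equations say that orbit sums vanish, for the exchange of A and B and for
  the rotation A, B, C. The third is of another kind: as \<open>ihara_der \<psi>\<close> sends C to
  -[B, \<psi>], it says that this derivation commutes with the substitution fixing A and sending B
  to C.\<close>

definition hexagons :: "ab series \<Rightarrow> bool" where
  "hexagons \<psi> \<longleftrightarrow> \<psi> = - ev \<psi> lB lA \<and> \<psi> + ev \<psi> lB lC + ev \<psi> lC lA = 0 \<and> br lB \<psi> + br lC (ev \<psi> lA lC) = 0"

text \<open>With the ideal {0}, statements about congruences become equalities of series.\<close>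

interpretation zero: closed_lie_ideal "{0}"
  by unfold_locales (rule closed_ideal_zero)

lemma ihara_conjugate:
  assumes "\<psi> \<in> lie_series" "a \<in> lie_series" "p \<in> lie_series" "q \<in> lie_series"
    and "ihara_der \<psi> p + br a p = 0" "substitute (case_ab p q) (br lB \<psi>) = ihara_der \<psi> q + br a q"
    and "f \<in> lie_series"
  shows "substitute (case_ab p q) (ihara_der \<psi> f) - (ihara_der \<psi> (substitute (case_ab p q) f) +
    br a (substitute (case_ab p q) f)) \<in> {0}"
  unfolding ihara_der_def
proof (rule zero.intertwine)
  show "substitute (case_ab p q) (case_ab 0 (br lB \<psi>) x) -
      (deriv (case_ab 0 (br lB \<psi>)) (case_ab p q x) + br a (case_ab p q x)) \<in> {0}" for x
    using assms(5,6) by (cases x) (auto simp: ihara_der_def)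
qed (use assms in \<open>auto split: ab.splits\<close>)

lemma hexagons_ihara:
  assumes h1: "hexagons \<psi>" and h2: "hexagons \<phi>" and lie: "\<psi> \<in> lie_series" "\<phi> \<in> lie_series"
  shows "hexagons (ihara_bracket \<psi> \<phi>)"
proof -
  let ?\<chi> = "ihara_bracket \<psi> \<phi>"
  define \<theta> where "\<theta> = substitute (case_ab lB lA)"
  define \<rho> where "\<rho> = substitute (case_ab lB lC)"
  define \<tau> where "\<tau> = substitute (case_ab lA lC)"
  have hom: "lie_hom \<theta>" "lie_hom \<rho>" "lie_hom \<tau>"
    unfolding \<theta>_def \<rho>_def \<tau>_def by (auto intro!: lie_hom_substitute split: ab.splits)
  have \<theta>: "\<theta> f = ev f lB lA" and \<rho>1: "\<rho> f = ev f lB lC" and \<tau>: "\<tau> f = ev f lA lC" for f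
    by (simp_all add: \<theta>_def \<rho>_def \<tau>_def ev_def)
  have "substitute (case_ab lB lC) (ev f lB lC) = ev f lC lA" for f
    by (subst substitute_ev) (simp_all add: substitute_diff substitute_minus)
  then have \<rho>: "\<rho> f = ev f lB lC" "\<rho> (\<rho> f) = ev f lC lA" for f
    unfolding \<rho>1 by (simp_all add: ev_def)
  have c\<theta>: "\<theta> (ihara_der \<omega> f) - (ihara_der \<omega> (\<theta> f) + br \<omega> (\<theta> f)) \<in> {0}"
    and c\<rho>: "\<rho> (ihara_der \<omega> f) - (ihara_der \<omega> (\<rho> f) + br \<omega> (\<rho> f)) \<in> {0}"
    and c\<tau>: "\<tau> (ihara_der \<omega> f) - (ihara_der \<omega> (\<tau> f) + br 0 (\<tau> f)) \<in> {0}"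
    if h: "hexagons \<omega>" and \<omega>: "\<omega> \<in> lie_series" and f: "f \<in> lie_series" for \<omega> f
  proof -
    have antisym: "ev \<omega> lB lA = - \<omega>" using h unfolding hexagons_def by (metis minus_minus)
    have c: "br lB \<omega> + br lC (\<tau> \<omega>) = 0" using h unfolding hexagons_def by (simp add: \<tau>)
    show "\<theta> (ihara_der \<omega> f) - (ihara_der \<omega> (\<theta> f) + br \<omega> (\<theta> f)) \<in> {0}"
      unfolding \<theta>_def
    proof (rule ihara_conjugate)
      have "substitute (case_ab lB lA) (br lB \<omega>) = br lA (ev \<omega> lB lA)"
        by (simp add: substitute_br ev_def)
      then show "substitute (case_ab lB lA) (br lB \<omega>) = ihara_der \<omega> lA + br \<omega> lA"
        unfolding antisym by (simp add: br_def)
    qed (use \<omega> f in \<open>simp_all add: br_def\<close>)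
    \<comment> \<open>Rotating the third equation and using antisymmetry gives [C, \<rho> \<omega>]
      = [A, \<omega>], which is also the value at C of the derivation changed by ad
      \<omega>.\<close>
    have "\<rho> (br lB \<omega> + br lC (\<tau> \<omega>)) = br lC (\<rho> \<omega>) + br lA (ev \<omega> lB lA)"
      unfolding \<tau> by (simp add: \<rho>_def substitute_br substitute_add substitute_diff substitute_minus substitute_ev)
    then have "br lC (\<rho> \<omega>) - br lA \<omega> = 0"
      unfolding c antisym by (simp add: \<rho>_def br_minus_right)
    then have \<rho>\<omega>: "br lC (substitute (case_ab lB lC) \<omega>) = br lA \<omega>" by (simp add: \<rho>_def)
    show "\<rho> (ihara_der \<omega> f) - (ihara_der \<omega> (\<rho> f) + br \<omega> (\<rho> f)) \<in> {0}"
      unfolding \<rho>_def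
    proof (rule ihara_conjugate)
      have "substitute (case_ab lB lC) (br lB \<omega>) = br lA \<omega>"
        by (simp add: substitute_br \<rho>\<omega>)
      then show "substitute (case_ab lB lC) (br lB \<omega>) = ihara_der \<omega> lC + br \<omega> lC"
        by (simp add: ihara_der_arg br_def algebra_simps)
    qed (use \<omega> f in \<open>simp_all add: br_def\<close>)
    show "\<tau> (ihara_der \<omega> f) - (ihara_der \<omega> (\<tau> f) + br 0 (\<tau> f)) \<in> {0}"
      unfolding \<tau>_def
    proof (rule ihara_conjugate)
      have "substitute (case_ab lA lC) (br lB \<omega>) = br lC (\<tau> \<omega>)"
        by (simp add: substitute_br \<tau>_def)
      also have "\<dots> = - br lB \<omega>" using c by (simp add: add_eq_0_iff2)
      finally show "substitute (case_ab lA lC) (br lB \<omega>) = ihara_der \<omega> lC + br 0 lC"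
        by (simp add: ihara_der_arg)
    qed (use \<omega> f in simp_all)
  qed
  have sum2: "(\<Sum>k<2. (P ^^ k) f) = f + P f" and sum3: "(\<Sum>k<3. (P ^^ k) f) = f + P f + P (P f)"
    for P :: "ab series \<Rightarrow> ab series" and f
    by (simp_all add: numeral_2_eq_2 numeral_3_eq_3)
  have h: "\<psi> + \<theta> \<psi> = 0" "\<phi> + \<theta> \<phi> = 0" "\<psi> + \<rho> \<psi> + \<rho> (\<rho> \<psi>) = 0" "\<phi> + \<rho> \<phi> + \<rho> (\<rho> \<phi>) = 0"
    using h1 h2 unfolding hexagons_def \<theta> \<rho>(2) unfolding \<rho>(1)
    by (metis add.left_inverse)+
  have clinP: "clin \<theta>" "clin \<rho>" "clin \<tau>" using hom by (simp_all add: lie_hom_def)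
  have "?\<chi> + \<theta> ?\<chi> \<in> {0}"
    using zero.cocycle_sum[OF hom(1) _ _ _ _ _ c\<theta>[OF h1 lie(1)] c\<theta>[OF h2 lie(2)] lie, of 2] lie
    by (auto simp: sum2 h clinP clin_zero ihara_der_arg ihara_bracket_def[symmetric])
  moreover have "?\<chi> + \<rho> ?\<chi> + \<rho> (\<rho> ?\<chi>) \<in> {0}"
    using zero.cocycle_sum[OF hom(2) _ _ _ _ _ c\<rho>[OF h1 lie(1)] c\<rho>[OF h2 lie(2)] lie, of 3] lie
    by (auto simp: sum3 h clinP clin_zero ihara_der_arg ihara_bracket_def[symmetric])
  \<comment> \<open>Commuting with \<tau> passes from two derivations to their commutator;
    evaluating at B recovers the equation.\<close>
  moreover have "br lB ?\<chi> + br lC (\<tau> ?\<chi>) = 0"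
  proof -
    have \<tau>D: "\<tau> (ihara_der \<omega> f) = ihara_der \<omega> (\<tau> f)" if "hexagons \<omega>" "\<omega> \<in> lie_series" "f \<in> lie_series" for \<omega> f
      using c\<tau>[OF that] by simp
    have "br lC (\<tau> ?\<chi>) = \<tau> (ihara_der ?\<chi> lB)"
      using hom(3) by (simp add: lie_hom_def) (simp add: \<tau>_def)
    also have "\<dots> = ihara_der ?\<chi> (\<tau> lB)"
      using lie h1 h2 by (simp only: ihara_der_commutator clin_diff[OF clinP(3)]) (simp add: \<tau>D del: ihara_der_letters)
    also have "\<dots> = - br lB ?\<chi>"
      by (simp add: \<tau>_def ihara_der_arg)
    finally show ?thesis by simp
  qed
  ultimately show ?thesis
    unfolding hexagons_def \<theta> \<rho>(2) \<tau> unfolding \<rho>(1) by (simp add: add_eq_0_iff2)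
qed

section \<open>The pentagon equation\<close>

text \<open>The hexagon equations require a + b + c = 0. Here the sum is an element z commuting with
  a and b; since \<psi> has no linear part, moving z into an argument has no effect modulo the
  ideal.\<close>

lemma (in closed_lie_ideal) hexagon_shifted:
  assumes "hexagons \<psi>" "\<psi> \<in> lie_series" "\<And>l. wcoeff \<psi> [l] = 0"
    and lie: "a \<in> lie_series" "b \<in> lie_series" "z \<in> lie_series"
    and comm: "br z a \<in> I" "br z b \<in> I"
  shows "br b (ev \<psi> a b) + br (z - a - b) (ev \<psi> a (z - a - b)) \<in> I"
    and "ev \<psi> a b + ev \<psi> b (z - a - b) + ev \<psi> (z - a - b) a \<in> I"
proof -
  let ?c = "- a - b"
  have nc: "wcoeff a [] = 0" "wcoeff b [] = 0" "nc (case_ab a b)" using lie by (simp_all add: lie_series_Nil)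
  have c: "br z ?c \<in> I"
    using ideal_diff[OF ideal_minus[OF comm(1)] comm(2)] by (simp add: br_diff_right br_minus_right)
  have z: "z - a - b = ?c + z" by simp
  have letters: "substitute (case_ab a b) lA = a" "substitute (case_ab a b) lB = b"
    using nc by simp_all
  have "substitute (case_ab a b) (br lB \<psi> + br lC (ev \<psi> lA lC)) = br b (ev \<psi> a b) + br ?c (ev \<psi> a ?c)"
    using nc by (simp add: substitute_add substitute_br substitute_diff substitute_minus substitute_ev letters)
      (simp add: ev_def)
  then have *: "br b (ev \<psi> a b) + br ?c (ev \<psi> a ?c) = 0"
    using assms(1) by (simp add: hexagons_def)
  have shift: "ev \<psi> (a + 0) (?c + z) - ev \<psi> a ?c \<in> I" "ev \<psi> (b + 0) (?c + z) - ev \<psi> b ?c \<in> I"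
      "ev \<psi> (?c + z) (a + 0) - ev \<psi> ?c a \<in> I"
    by (intro ev_central_shift; use assms c in simp)+
  have "br b (ev \<psi> a b) + br (?c + z) (ev \<psi> a (?c + z)) =
      (br b (ev \<psi> a b) + br ?c (ev \<psi> a ?c)) + br ?c (ev \<psi> a (?c + z) - ev \<psi> a ?c) + br z (ev \<psi> a (?c + z))"
    by (simp add: br_def algebra_simps)
  also have "\<dots> \<in> I"
  proof -
    have "br z (ev \<psi> a (?c + z)) \<in> I"
      by (rule br_ev) (use assms c in \<open>simp_all add: br_add_right\<close>)
    moreover have "br ?c (ev \<psi> a (?c + z) - ev \<psi> a ?c) \<in> I"
      by (rule ideal_br_right) (use lie shift(1) in simp_all)
    ultimately show ?thesis unfolding * by (simp add: ideal_add)
  qed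
  finally show "br b (ev \<psi> a b) + br (z - a - b) (ev \<psi> a (z - a - b)) \<in> I" by (simp only: z)
  have "substitute (case_ab a b) (\<psi> + ev \<psi> lB lC + ev \<psi> lC lA) = ev \<psi> a b + ev \<psi> b ?c + ev \<psi> ?c a"
    using nc by (simp add: substitute_add substitute_diff substitute_minus substitute_ev letters)
      (simp add: ev_def)
  then have "ev \<psi> a b + ev \<psi> b ?c + ev \<psi> ?c a = 0"
    using assms(1) by (simp add: hexagons_def)
  then have "ev \<psi> a b + ev \<psi> b (?c + z) + ev \<psi> (?c + z) a =
      (ev \<psi> (b + 0) (?c + z) - ev \<psi> b ?c) + (ev \<psi> (?c + z) (a + 0) - ev \<psi> ?c a)"
    by (simp add: algebra_simps)
  then show "ev \<psi> a b + ev \<psi> b (z - a - b) + ev \<psi> (z - a - b) a \<in> I"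
    unfolding z using ideal_add[OF shift(2,3)] by (simp only: add_0_right)
qed

lemma ev_antisym:
  assumes "hexagons \<psi>" "a \<in> lie_series" "b \<in> lie_series"
  shows "ev \<psi> b a = - ev \<psi> a b"
proof -
  have nc: "nc (case_ab a b)" using assms by (simp add: lie_series_Nil)
  have "substitute (case_ab a b) \<psi> = substitute (case_ab a b) (- ev \<psi> lB lA)"
    using assms(1) unfolding hexagons_def by metis
  then show ?thesis using nc
    by (simp add: substitute_minus substitute_ev) (simp add: ev_def)
qed

lemma ev_antisym_letter:
  "hexagons \<psi> \<Longrightarrow> ev \<psi> (letter x) (letter y) = - ev \<psi> (letter y) (letter x)"
  by (rule ev_antisym) simp_all

text \<open>Modulo the ideal, \<delta> acts on a, b as \<open>ihara_der \<psi>\<close> acts on A, B,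
  so evaluation at a, b intertwines the two derivations.\<close>

lemma (in closed_lie_ideal) deriv_ev:
  assumes lie: "a \<in> lie_series" "b \<in> lie_series" "\<psi> \<in> lie_series" "\<phi> \<in> lie_series" "\<And>x. \<delta> x \<in> lie_series"
    and D: "deriv \<delta> a \<in> I" "deriv \<delta> b - br b (ev \<psi> a b) \<in> I"
  shows "deriv \<delta> (ev \<phi> a b) - ev (ihara_der \<psi> \<phi>) a b \<in> I"
proof -
  let ?S = "substitute (case_ab a b)"
  have nc: "nc (case_ab a b)" "nc \<delta>" using lie by (auto simp: lie_series_Nil)
  show ?thesis unfolding ev_def
  proof (rule twisted_derivation_in_ideal[of "\<lambda>f. deriv \<delta> (?S f) - ?S (ihara_der \<psi> f)" ?S ?S])
    show "clin (\<lambda>f. deriv \<delta> (?S f) - ?S (ihara_der \<psi> f))"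
      by (intro clin_minusI clin_derI clin_substituteI clin_ihara_der clin_id)
    show "deriv \<delta> (?S (br f g)) - ?S (ihara_der \<psi> (br f g)) =
      br (deriv \<delta> (?S f) - ?S (ihara_der \<psi> f)) (?S g) + br (?S f) (deriv \<delta> (?S g) - ?S (ihara_der \<psi> g))" for f g
      by (simp only: substitute_br[OF nc(1)] deriv_br[OF nc(2)] ihara_der_br substitute_add
          br_diff_left br_diff_right) simp
    show "deriv \<delta> (?S (letter l)) - ?S (ihara_der \<psi> (letter l)) \<in> I" for l
      using D nc by (cases l) (auto simp: substitute_br ev_def)
    show "lie_hom ?S" "lie_hom ?S" using lie by (auto intro!: lie_hom_substitute split: ab.splits)
  qed (rule lie)
qed

subsection \<open>The five-cycle presentation\<close>

datatype cyc5 = Y1 | Y2 | Y3 | Y4 | Y5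

lemma UNIV_cyc5: "(UNIV :: cyc5 set) = {Y1, Y2, Y3, Y4, Y5}"
  by (auto intro: cyc5.exhaust)

instance cyc5 :: finite
  by standard (simp add: UNIV_cyc5)

abbreviation y1 where "y1 \<equiv> letter Y1"
abbreviation y2 where "y2 \<equiv> letter Y2"
abbreviation y3 where "y3 \<equiv> letter Y3"
abbreviation y4 where "y4 \<equiv> letter Y4"
abbreviation y5 where "y5 \<equiv> letter Y5"

text \<open>The letters are the elements \<open>t\<^sub>1\<^sub>2, t\<^sub>2\<^sub>3, t\<^sub>3\<^sub>4, t\<^sub>4\<^sub>5, t\<^sub>5\<^sub>1\<close> of the Lie algebra of the sphere braid group on five
  strands, which is \<open>\<tt>\<^sub>4\<close> modulo its centre.\<close>

definition cyc5_rel :: "cyc5 series" where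
  "cyc5_rel = br y1 y2 + br y2 y3 + br y3 y4 + br y4 y5 + br y5 y1"

definition cyc5_rels :: "cyc5 series set" where
  "cyc5_rels = {br y1 y3, br y3 y5, br y5 y2, br y2 y4, br y4 y1, cyc5_rel}"

interpretation p5: closed_lie_ideal "quot cyc5_rels"
  by unfold_locales (rule closed_ideal_quot)

lemma p5_br [simp]:
  "br y1 y3 \<in> quot cyc5_rels" "br y3 y5 \<in> quot cyc5_rels" "br y5 y2 \<in> quot cyc5_rels"
  "br y2 y4 \<in> quot cyc5_rels" "br y4 y1 \<in> quot cyc5_rels" "cyc5_rel \<in> quot cyc5_rels"
  by (simp_all add: quot_rel cyc5_rels_def)

lemma p5_br' [simp]:
  "br y3 y1 \<in> quot cyc5_rels" "br y5 y3 \<in> quot cyc5_rels" "br y2 y5 \<in> quot cyc5_rels"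
  "br y4 y2 \<in> quot cyc5_rels" "br y1 y4 \<in> quot cyc5_rels"
  using p5_br[THEN p5.ideal_minus] by (simp_all flip: br_swap)

lemma cyc5_rels_cases:
  "r \<in> cyc5_rels \<Longrightarrow>
    (r = br y1 y3 \<Longrightarrow> P) \<Longrightarrow> (r = br y3 y5 \<Longrightarrow> P) \<Longrightarrow> (r = br y5 y2 \<Longrightarrow> P) \<Longrightarrow>
    (r = br y2 y4 \<Longrightarrow> P) \<Longrightarrow> (r = br y4 y1 \<Longrightarrow> P) \<Longrightarrow> (r = cyc5_rel \<Longrightarrow> P) \<Longrightarrow> P"
  by (auto simp: cyc5_rels_def)

definition cyc5_pentagon :: "ab series \<Rightarrow> cyc5 series" where
  "cyc5_pentagon \<psi> = ev \<psi> y1 y2 + ev \<psi> y2 y3 + ev \<psi> y3 y4 + ev \<psi> y4 y5 + ev \<psi> y5 y1"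

text \<open>A rotation by two steps. It links the commuting pairs into the single chain y1, y3, y5,
  y2, y4, so all five commutation relations follow from the one for y1 and y3.\<close>

primrec rot5 :: "cyc5 \<Rightarrow> cyc5 series" where
  "rot5 Y1 = y3" | "rot5 Y2 = y4" | "rot5 Y3 = y5" | "rot5 Y4 = y1" | "rot5 Y5 = y2"

text \<open>In terms of five points on the sphere, \<open>swap5\<close> exchanges the points 1 and 2.\<close>

primrec swap5 :: "cyc5 \<Rightarrow> cyc5 series" where
  "swap5 Y1 = y1" | "swap5 Y2 = y4 - y1 - y2" | "swap5 Y3 = y3" | "swap5 Y4 = y4" | "swap5 Y5 = y3 - y1 - y5"

text \<open>It kills the commuting pair y1, y3 and restricts to the Ihara derivation of \<psi> on
  each of the pairs y1, y5 and y3, y4; at y2 the contributions of both neighbours add up.\<close>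

primrec pent_der :: "ab series \<Rightarrow> cyc5 \<Rightarrow> cyc5 series" where
  "pent_der \<psi> Y1 = 0"
| "pent_der \<psi> Y2 = br y2 (ev \<psi> y1 y2 + ev \<psi> y3 y4)"
| "pent_der \<psi> Y3 = 0"
| "pent_der \<psi> Y4 = br y4 (ev \<psi> y3 y4)"
| "pent_der \<psi> Y5 = br y5 (ev \<psi> y1 y5)"

lemma rot5_lie [simp]: "rot5 x \<in> lie_series"
  and swap5_lie [simp]: "swap5 x \<in> lie_series"
  and pent_der_lie [simp]: "\<psi> \<in> lie_series \<Longrightarrow> pent_der \<psi> x \<in> lie_series"
  by (cases x; simp)+

lemma rot5_nc [simp]: "nc rot5" and swap5_nc [simp]: "nc swap5"
  by (intro nc_lie rot5_lie swap5_lie)+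

lemma pent_der_nc [simp]: "\<psi> \<in> lie_series \<Longrightarrow> nc (pent_der \<psi>)"
  by (intro nc_lie pent_der_lie)

lemma rot5_ideal: "f \<in> quot cyc5_rels \<Longrightarrow> substitute rot5 f \<in> quot cyc5_rels"
proof (rule p5.quot_substitute[of rot5 cyc5_rels])
  fix r assume "r \<in> cyc5_rels"
  moreover have "substitute rot5 cyc5_rel = cyc5_rel"
    by (simp add: cyc5_rel_def substitute_add substitute_br)
  ultimately show "substitute rot5 r \<in> quot cyc5_rels"
    by (elim cyc5_rels_cases) (simp_all add: substitute_br)
qed simp_all

text \<open>The first bracket on the right is [t_13, t_25], the image of [t_23, t_15] under the
  exchange of points 1 and 2. The five-term relation is thus a commutation relation in
  disguise.\<close>

lemma swap5_cyc5_rel: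
  "cyc5_rel = - br (y4 - y1 - y2) (y3 - y1 - y5) - br y4 y1 - br y1 y3 - br y5 y2"
  by (simp add: cyc5_rel_def br_def algebra_simps)

lemma swap5_ideal: "f \<in> quot cyc5_rels \<Longrightarrow> substitute swap5 f \<in> quot cyc5_rels"
proof (rule p5.quot_substitute[of swap5 cyc5_rels])
  fix r assume r: "r \<in> cyc5_rels"
  have 1: "br (y3 - y1 - y5) (y4 - y1 - y2) = cyc5_rel + br y4 y1 + br y1 y3 + br y5 y2"
    by (simp add: cyc5_rel_def br_def algebra_simps)
  have 2: "substitute swap5 cyc5_rel = - cyc5_rel + br y3 y1 + br y3 y1 + br y1 y4 + br y1 y4"
    by (simp add: cyc5_rel_def substitute_add substitute_br) (simp add: br_def algebra_simps)
  have 3: "br (y3 - y1 - y5) (y4 - y1 - y2) \<in> quot cyc5_rels" "substitute swap5 cyc5_rel \<in> quot cyc5_rels"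
    unfolding 1 2 by (intro p5.ideal_add p5.ideal_minus p5_br p5_br')+
  show "substitute swap5 r \<in> quot cyc5_rels"
    using r
  proof (elim cyc5_rels_cases)
    assume "r = br y5 y2"
    then show ?thesis using 3(1) by (simp add: substitute_br)
  next
    assume "r = cyc5_rel"
    then show ?thesis using 3(2) by simp
  qed (simp_all add: substitute_br br_diff_left br_diff_right p5.ideal_diff p5.ideal_minus)
qed simp_all

section \<open>The derivation of the five-point sphere Lie algebra attached to \<psi>\<close>

locale pent5 =
  fixes \<psi>
  assumes lie: "\<psi> \<in> lie_series" and lin: "\<And>l. wcoeff \<psi> [l] = 0" and hex: "hexagons \<psi>"
    and pent: "cyc5_pentagon \<psi> \<in> quot cyc5_rels"
begin

lemma rot5_conjugate:
  assumes "f \<in> lie_series"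
  shows "substitute rot5 (deriv (pent_der \<psi>) f) - (deriv (pent_der \<psi>) (substitute rot5 f) +
    br (ev \<psi> y1 y5) (substitute rot5 f)) \<in> quot cyc5_rels"
proof (rule p5.intertwine)
  fix x
  note anti = ev_antisym_letter[OF hex]
  have "br y3 (ev \<psi> y1 y5) \<in> quot cyc5_rels" "br y2 (ev \<psi> y4 y5) \<in> quot cyc5_rels"
    by (auto intro!: p5.br_ev simp: lie)
  \<comment> \<open>The case \<open>Y5\<close> needs the pentagon equation: of its five terms, ad y2
    kills the one in y4 and y5, and the others match the value of \<open>pent_der\<close> at
    \<open>Y2\<close>.\<close>
  moreover have "br y2 (cyc5_pentagon \<psi>) \<in> quot cyc5_rels" using pent by (intro p5.ideal_br_right) auto
  moreover have "br y2 (ev \<psi> y3 y2) - (br y2 (ev \<psi> y1 y2 + ev \<psi> y3 y4) + br (ev \<psi> y1 y5) y2) =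
      br y2 (ev \<psi> y4 y5) - br y2 (cyc5_pentagon \<psi>)"
    unfolding cyc5_pentagon_def anti[of Y3 Y2] anti[of Y5 Y1] by (simp add: br_def algebra_simps)
  ultimately show "substitute rot5 (pent_der \<psi> x) - (deriv (pent_der \<psi>) (rot5 x) + br (ev \<psi> y1 y5) (rot5 x))
      \<in> quot cyc5_rels"
    using lie anti[of Y5 Y1]
    by (cases x) (simp_all add: substitute_br substitute_add substitute_ev br_minus_right br_add_right
        br_swap[of "ev \<psi> y1 y5"] p5.ideal_diff)
qed (use assms lie in auto)

text \<open>Points 1 and 2 enter through the shifted hexagon equation, with y4 commuting with y1, y2
  and y3 commuting with y1, y5.\<close>

lemma deriv_swap5:
  assumes "x \<in> {Y2, Y5}"
  shows "deriv (pent_der \<psi>) (swap5 x) - substitute swap5 (pent_der \<psi> x) \<in> quot cyc5_rels"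
proof -
  have "br y1 (ev \<psi> y3 y4) \<in> quot cyc5_rels"
    by (auto intro!: p5.br_ev simp: lie)
  moreover have "br y2 (ev \<psi> y1 y2) + br (y4 - y1 - y2) (ev \<psi> y1 (y4 - y1 - y2)) \<in> quot cyc5_rels"
    "br y5 (ev \<psi> y1 y5) + br (y3 - y1 - y5) (ev \<psi> y1 (y3 - y1 - y5)) \<in> quot cyc5_rels"
    by (rule p5.hexagon_shifted; simp add: hex lie lin)+
  moreover have "deriv (pent_der \<psi>) (swap5 Y2) - substitute swap5 (pent_der \<psi> Y2) = br y1 (ev \<psi> y3 y4) -
      (br y2 (ev \<psi> y1 y2) + br (y4 - y1 - y2) (ev \<psi> y1 (y4 - y1 - y2)))"
    by (simp add: lie der_diff substitute_br substitute_add substitute_ev) (simp add: br_def algebra_simps)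
  moreover have "deriv (pent_der \<psi>) (swap5 Y5) - substitute swap5 (pent_der \<psi> Y5) =
      - (br y5 (ev \<psi> y1 y5) + br (y3 - y1 - y5) (ev \<psi> y1 (y3 - y1 - y5)))"
    by (simp add: lie der_diff substitute_br substitute_add substitute_ev)
  ultimately show ?thesis
    using assms p5.ideal_diff p5.ideal_minus by fastforce
qed

lemma pent_der_ideal:
  assumes "f \<in> quot cyc5_rels"
  shows "deriv (pent_der \<psi>) f \<in> quot cyc5_rels"
proof -
  let ?D = "deriv (pent_der \<psi>)" and ?I = "quot cyc5_rels"
  have rot: "?D (substitute rot5 r) \<in> ?I" if "r \<in> lie_series" "r \<in> ?I" "?D r \<in> ?I" for r
  proof -
    have "?D (substitute rot5 r) = substitute rot5 (?D r) - br (ev \<psi> y1 y5) (substitute rot5 r) -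
      (substitute rot5 (?D r) - (?D (substitute rot5 r) + br (ev \<psi> y1 y5) (substitute rot5 r)))"
      by simp
    also have "\<dots> \<in> ?I"
      using that by (intro p5.ideal_diff p5.ideal_br_right rot5_ideal rot5_conjugate) (simp_all add: lie)
    finally show ?thesis .
  qed
  \<comment> \<open>The derivation kills both letters; the rotation then reaches the other four
    commutators.\<close>
  have 1: "?D (br y1 y3) \<in> ?I" by (simp add: deriv_br lie)
  have 2: "?D (br y3 y5) \<in> ?I" using rot[OF _ _ 1] by (simp add: substitute_br)
  have 3: "?D (br y5 y2) \<in> ?I" using rot[OF _ _ 2] by (simp add: substitute_br)
  have 4: "?D (br y2 y4) \<in> ?I" using rot[OF _ _ 3] by (simp add: substitute_br)
  have 5: "?D (br y4 y1) \<in> ?I" using rot[OF _ _ 4] by (simp add: substitute_br)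
  \<comment> \<open>The relation \<open>cyc5_rel\<close> is fixed by the rotation and lies outside
    that orbit, so the exchange of two points is used instead.\<close>
  let ?b = "br (swap5 Y2) (swap5 Y5)" and ?S = "substitute swap5"
  have "?D ?b = br (?D (swap5 Y2)) (swap5 Y5) + br (swap5 Y2) (?D (swap5 Y5))"
    by (rule deriv_br) (simp add: lie)
  also have "\<dots> = - ?S (?D (br y5 y2)) + br (?D (swap5 Y2) - ?S (pent_der \<psi> Y2)) (swap5 Y5) +
      br (swap5 Y2) (?D (swap5 Y5) - ?S (pent_der \<psi> Y5))"
    by (simp only: deriv_br[OF pent_der_nc[OF lie]] der_letter[OF nc_letter pent_der_nc[OF lie]]
        substitute_add substitute_br[OF swap5_nc] substitute_letter[OF swap5_nc])
      (simp add: br_def algebra_simps)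
  also have "\<dots> \<in> ?I"
    by (intro p5.ideal_add p5.ideal_minus swap5_ideal 3 p5.ideal_br_left p5.ideal_br_right deriv_swap5)
      simp_all
  finally have b: "?D ?b \<in> ?I" .
  have "?D cyc5_rel = - ?D ?b - ?D (br y4 y1) - ?D (br y1 y3) - ?D (br y5 y2)"
    unfolding swap5_cyc5_rel by (simp only: der_diff der_minus swap5.simps)
  also have "\<dots> \<in> ?I" by (intro p5.ideal_diff p5.ideal_minus b 1 3 5)
  finally have 6: "?D cyc5_rel \<in> ?I" .
  show ?thesis
    by (rule p5.quot_deriv[OF _ _ assms])
      (use 1 2 3 4 5 6 lie in \<open>auto elim: cyc5_rels_cases\<close>)
qed

end

lemma cyc5_pentagon_ihara:
  assumes "pent5 \<psi>" "pent5 \<phi>"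
  shows "cyc5_pentagon (ihara_bracket \<psi> \<phi>) \<in> quot cyc5_rels"
proof -
  interpret psi: pent5 \<psi> by fact
  interpret phi: pent5 \<phi> by fact
  let ?I = "quot cyc5_rels" and ?D1 = "deriv (pent_der \<psi>)" and ?D2 = "deriv (pent_der \<phi>)"
  let ?P = "substitute rot5" and ?\<chi> = "ihara_bracket \<psi> \<phi>"
  let ?a = "ev \<psi> y1 y5" and ?b = "ev \<phi> y1 y5" and ?c = "ev ?\<chi> y1 y5"
  have hom: "lie_hom ?P" by (rule lie_hom_substitute) simp
  have sum5: "(\<Sum>k<5. (?P ^^ k) (ev \<omega> y1 y5)) = - cyc5_pentagon \<omega>" if "hexagons \<omega>" for \<omega>
  proof -
    note anti = ev_antisym_letter[OF that]
    have "(\<Sum>k<5. (?P ^^ k) (ev \<omega> y1 y5)) = ev \<omega> y1 y5 + ev \<omega> y3 y2 + ev \<omega> y5 y4 + ev \<omega> y2 y1 + ev \<omega> y4 y3"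
      by (simp add: eval_nat_numeral substitute_ev)
    then show ?thesis
      unfolding anti[of Y3 Y2] anti[of Y1 Y5] anti[of Y5 Y4] anti[of Y2 Y1] anti[of Y4 Y3]
        cyc5_pentagon_def by simp
  qed
  let ?A = "\<Sum>k<5. (?P ^^ k) ?a" and ?B = "\<Sum>k<5. (?P ^^ k) ?b"
  let ?d = "br ?a ?b + ?D1 ?b - ?D2 ?a"
  have lieAB: "?a \<in> lie_series" "?b \<in> lie_series" by (simp_all add: psi.lie phi.lie)
  have AB: "?A \<in> ?I" "?B \<in> ?I"
    using psi.pent phi.pent by (simp_all only: sum5 psi.hex phi.hex p5.ideal_minus)
  have "?A \<in> lie_series" 
    unfolding sum5[OF psi.hex] cyc5_pentagon_def by (simp add: psi.lie)
  then have "?D1 ?B - ?D2 ?A + br ?A ?B \<in> ?I"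
    using AB by (intro p5.ideal_add p5.ideal_diff psi.pent_der_ideal phi.pent_der_ideal p5.ideal_br_right)
  moreover have "(\<Sum>k<5. (?P ^^ k) ?d) - (?D1 ?B - ?D2 ?A + br ?A ?B) \<in> ?I"
    by (rule p5.cocycle_sum[OF hom]) (use lieAB psi.lie phi.lie in
      \<open>auto intro: rot5_ideal psi.rot5_conjugate phi.rot5_conjugate\<close>)
  ultimately have d: "(\<Sum>k<5. (?P ^^ k) ?d) \<in> ?I" using p5.ideal_cong by blast
  \<comment> \<open>On y1 and y5 the derivations act as Ihara derivations, which identifies the
    abstract cocycle \<open>?d\<close> with the Ihara bracket evaluated at y1, y5.\<close>
  have cd: "?c - ?d \<in> ?I"
  proof -
    have "?D1 ?b - ev (ihara_der \<psi> \<phi>) y1 y5 \<in> ?I" "?D2 ?a - ev (ihara_der \<phi> \<psi>) y1 y5 \<in> ?I"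
      by (rule p5.deriv_ev; simp add: psi.lie phi.lie)+
    from p5.ideal_diff[OF this(2,1)] show ?thesis
      by (simp add: ihara_bracket_def ev_def substitute_add substitute_diff substitute_br algebra_simps)
  qed
  have P: "(?P ^^ k) f \<in> ?I" if "f \<in> ?I" for k f
    using that by (induction k) (auto intro: rot5_ideal)
  have "(?P ^^ k) (f - g) = (?P ^^ k) f - (?P ^^ k) g" for k f g
    by (induction k) (simp_all add: substitute_diff)
  then have "(\<Sum>k<5. (?P ^^ k) ?c) = (\<Sum>k<5. (?P ^^ k) (?c - ?d)) + (\<Sum>k<5. (?P ^^ k) ?d)"
    by (simp add: sum_subtractf)
  also have "\<dots> \<in> ?I" by (intro p5.ideal_add[OF _ d] p5.ideal_sum P cd)
  finally show ?thesis
    using p5.ideal_minus 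
    by (subst (asm) sum5) (use hexagons_ihara psi.hex phi.hex psi.lie phi.lie in fastforce)+
qed

subsection \<open>Comparison with \<open>\<tt>\<^sub>4\<close>\<close>

lemma finite_dk_gen: "finite (UNIV :: 'i::finite dk_gen set)"
proof -
  have "(UNIV :: 'i dk_gen set) = (\<lambda>(i, j). DK i j) ` UNIV"
    by (auto simp: image_iff) (metis dk_gen.exhaust)
  then show ?thesis by (metis finite_class.finite_UNIV finite_imageI)
qed

instance dk_gen :: (finite) finite
  by standard (rule finite_dk_gen)

interpretation t4: closed_lie_ideal "quot (dk_rels :: 4 dk_gen series set)"
  by unfold_locales (rule closed_ideal_quot)

lemma wcoeff_substitute_single:
  assumes "nc \<sigma>"
  shows "wcoeff (substitute \<sigma> f) [x] = (\<Sum>l\<in>UNIV. wcoeff f [l] * wcoeff (\<sigma> l) [x])"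
proof -
  have words: "{w :: 'a list. length w \<le> length [x] + 0} = insert [] (range (\<lambda>l. [l]))"
  proof (intro equalityI subsetI)
    fix w :: "'a list" assume "w \<in> {w. length w \<le> length [x] + 0}"
    then show "w \<in> insert [] (range (\<lambda>l. [l]))" by (cases w) auto
  qed auto
  have "wcoeff (substitute \<sigma> f) [x] =
      (\<Sum>w\<in>insert [] (range (\<lambda>l. [l])). wcoeff f w * wcoeff (prod_list (map \<sigma> w)) [x])"
    unfolding substitute_def wsum_eq_wsumd wcoeff_wsumd words ..
  also have "\<dots> = (\<Sum>w\<in>range (\<lambda>l. [l]). wcoeff f w * wcoeff (prod_list (map \<sigma> w)) [x])"
    by (subst sum.insert) auto
  also have "\<dots> = (\<Sum>l\<in>UNIV. wcoeff f [l] * wcoeff (\<sigma> l) [x])"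
    by (subst sum.reindex) (auto simp: inj_def)
  finally show ?thesis .
qed

lemma UNIV_ab: "(UNIV :: ab set) = {LA, LB}"
  by (auto intro: ab.exhaust)

lemma wcoeff_ev_single:
  assumes "wcoeff a [] = 0" "wcoeff b [] = 0"
  shows "wcoeff (ev \<psi> a b) [x] = wcoeff \<psi> [LA] * wcoeff a [x] + wcoeff \<psi> [LB] * wcoeff b [x]"
  unfolding ev_def using assms by (subst wcoeff_substitute_single) (auto simp: UNIV_ab)

text \<open>In degree one the relations consist only of the diagonal generators and the symmetry of
  t_ij; this sum of two coefficients vanishes on both.\<close>

lemma dk_degree_one:
  fixes i j :: "'i::finite"
  assumes f: "f \<in> quot dk_rels" and ij: "i \<noteq> j"
  shows "wcoeff f [DK i j] + wcoeff f [DK j i] = 0"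
proof -
  have deg1: "wcoeff (br f g) [x] = 0" if "wcoeff f [] = 0" "wcoeff g [] = 0" for f g :: "'i dk_gen series" and x
    using that by (simp add: br_def wcoeff_mult)
  have "wcoeff g [] = 0 \<and> wcoeff g [DK i j] + wcoeff g [DK j i] = 0" if "g \<in> lie_ideal dk_rels" for g
    using that
  proof induction
    case (rel r)
    then show ?case
      unfolding dk_rels_def using ij by (auto simp: deg1) (auto simp: br_def)
  next
    case (add f g)
    then show ?case by (simp add: algebra_simps)
  next
    case (scale f c)
    then show ?case by (simp flip: distrib_left)
  next
    case (br f g)
    then show ?case by (simp add: deg1 lie_poly_Nil) (simp add: br_def)
  qed auto
  moreover obtain g where "g \<in> lie_ideal dk_rels" "vanish 2 (f - g)"
    using f unfolding quot_def by (rule deg_closureD)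
  ultimately show ?thesis by (simp add: vanish_def)
qed

definition dk_pentagon :: "ab series \<Rightarrow> 4 dk_gen series" where
  "dk_pentagon \<psi> = ev \<psi> (dk 1 2) (dk 2 3 + dk 2 4) + ev \<psi> (dk 1 3 + dk 2 3) (dk 3 4) -
     (ev \<psi> (dk 2 3) (dk 3 4) + ev \<psi> (dk 1 2 + dk 1 3) (dk 2 4 + dk 3 4) + ev \<psi> (dk 1 2) (dk 2 3))"

lemma grt1_iff: "\<psi> \<in> grt1 \<longleftrightarrow> \<psi> \<in> lie_series \<and> hexagons \<psi> \<and> dk_pentagon \<psi> \<in> quot dk_rels"
  by (auto simp: grt1_def hexagons_def dk_pentagon_def lie_cong_iff Let_def)

text \<open>In the linear part of the pentagon, t_12 and t_34 occur with minus the coefficients of A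
  and B.\<close>

lemma grt1_linear:
  assumes "\<psi> \<in> grt1"
  shows "wcoeff \<psi> [l] = 0"
proof -
  have P: "dk_pentagon \<psi> \<in> quot dk_rels" using assms by (simp add: grt1_iff)
  have "wcoeff \<psi> [LA] = 0" "wcoeff \<psi> [LB] = 0"
    using dk_degree_one[OF P, of 1 2] dk_degree_one[OF P, of 3 4]
    by (simp_all add: dk_pentagon_def wcoeff_ev_single)
  then show ?thesis by (cases l) auto
qed

definition lin5 :: "rat \<Rightarrow> rat \<Rightarrow> rat \<Rightarrow> rat \<Rightarrow> rat \<Rightarrow> cyc5 series" where
  "lin5 a b c d e = qscale a y1 + qscale b y2 + qscale c y3 + qscale d y4 + qscale e y5"

lemma lin5_add: "lin5 a b c d e + lin5 a' b' c' d' e' = lin5 (a + a') (b + b') (c + c') (d + d') (e + e')"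
  by (simp add: lin5_def series.scale_left_distrib algebra_simps)

lemma lin5_lie [simp]: "lin5 a b c d e \<in> lie_series"
  by (simp add: lin5_def)

text \<open>Non-adjacent letters commute, so only the coefficients on the five cyclically adjacent
  pairs matter; if they have a common value s, they add up to s times
  \<open>cyc5_rel\<close>.\<close>

lemma br_lin5:
  assumes "a * b' - b * a' = s" "b * c' - c * b' = s" "c * d' - d * c' = s" "d * e' - e * d' = s" "e * a' - a * e' = s"
  shows "br (lin5 a b c d e) (lin5 a' b' c' d' e') \<in> quot cyc5_rels"
proof -
  have q: "qscale u (br f g) - qscale v (br f g) = qscale (u - v) (br f g)" for u v and f g :: "cyc5 series"
    by (simp add: series.scale_left_diff_distrib)
  have "br (lin5 a b c d e) (lin5 a' b' c' d' e') = qscale s cyc5_rel +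
     (qscale (a * c' - c * a') (br y1 y3) + qscale (c * e' - e * c') (br y3 y5) +
      qscale (e * b' - b * e') (br y5 y2) + qscale (b * d' - d * b') (br y2 y4) +
      qscale (d * a' - a * d') (br y4 y1))"
  proof (rule series_eqI)
    fix w
    have *: "wcoeff (br y2 y1) w = - wcoeff (br y1 y2) w" "wcoeff (br y3 y2) w = - wcoeff (br y2 y3) w"
      "wcoeff (br y4 y3) w = - wcoeff (br y3 y4) w" "wcoeff (br y5 y4) w = - wcoeff (br y4 y5) w"
      "wcoeff (br y1 y5) w = - wcoeff (br y5 y1) w" "wcoeff (br y3 y1) w = - wcoeff (br y1 y3) w"
      "wcoeff (br y5 y3) w = - wcoeff (br y3 y5) w" "wcoeff (br y2 y5) w = - wcoeff (br y5 y2) w"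
      "wcoeff (br y4 y2) w = - wcoeff (br y2 y4) w" "wcoeff (br y1 y4) w = - wcoeff (br y4 y1) w"
      by (simp_all add: br_def)
    have "qscale s cyc5_rel = qscale (a * b' - b * a') (br y1 y2) + qscale (b * c' - c * b') (br y2 y3) +
        qscale (c * d' - d * c') (br y3 y4) + qscale (d * e' - e * d') (br y4 y5) +
        qscale (e * a' - a * e') (br y5 y1)"
      unfolding assms by (simp add: cyc5_rel_def qscale_add)
    then show "wcoeff (br (lin5 a b c d e) (lin5 a' b' c' d' e')) w = wcoeff (qscale s cyc5_rel +
     (qscale (a * c' - c * a') (br y1 y3) + qscale (c * e' - e * c') (br y3 y5) +
      qscale (e * b' - b * e') (br y5 y2) + qscale (b * d' - d * b') (br y2 y4) +
      qscale (d * a' - a * d') (br y4 y1))) w"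
      by (simp add: lin5_def br_add_left br_add_right br_qscale *) (simp add: algebra_simps)
  qed
  also have "\<dots> \<in> quot cyc5_rels"
    by (intro p5.ideal_add p5.ideal_qscale p5_br)
  finally show ?thesis .
qed

text \<open>The images of \<open>t\<^sub>i\<^sub>j\<close>, \<open>i < j\<close>, solved from \<open>t\<^sub>i\<^sub>j + t\<^sub>i\<^sub>k + t\<^sub>j\<^sub>k = t\<^sub>l\<^sub>5\<close>.\<close>

definition dk5_upper :: "4 \<Rightarrow> 4 \<Rightarrow> cyc5 series" where
  "dk5_upper i j = (if (i, j) = (1, 2) then lin5 1 0 0 0 0 else if (i, j) = (2, 3) then lin5 0 1 0 0 0
     else if (i, j) = (3, 4) then lin5 0 0 1 0 0 else if (i, j) = (1, 3) then lin5 (-1) (-1) 0 1 0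
     else if (i, j) = (2, 4) then lin5 0 (-1) (-1) 0 1 else if (i, j) = (1, 4) then lin5 0 1 0 (-1) (-1)
     else 0)"

primrec dk5 :: "4 dk_gen \<Rightarrow> cyc5 series" where
  "dk5 (DK i j) = dk5_upper i j + dk5_upper j i"

lemma dk5_lie [simp]: "dk5 x \<in> lie_series"
  by (cases x) (simp add: dk5_upper_def)

lemma dk5_nc [simp]: "nc dk5"
  by (intro nc_lie dk5_lie)

lemma dk5_simps [simp]:
  "dk5 (DK 1 2) = lin5 1 0 0 0 0" "dk5 (DK 2 1) = lin5 1 0 0 0 0"
  "dk5 (DK 2 3) = lin5 0 1 0 0 0" "dk5 (DK 3 2) = lin5 0 1 0 0 0"
  "dk5 (DK 3 4) = lin5 0 0 1 0 0" "dk5 (DK 4 3) = lin5 0 0 1 0 0"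
  "dk5 (DK 1 3) = lin5 (-1) (-1) 0 1 0" "dk5 (DK 3 1) = lin5 (-1) (-1) 0 1 0"
  "dk5 (DK 2 4) = lin5 0 (-1) (-1) 0 1" "dk5 (DK 4 2) = lin5 0 (-1) (-1) 0 1"
  "dk5 (DK 1 4) = lin5 0 1 0 (-1) (-1)" "dk5 (DK 4 1) = lin5 0 1 0 (-1) (-1)"
  by (simp_all add: dk5_upper_def)

lemma dk5_ideal: "f \<in> quot dk_rels \<Longrightarrow> substitute dk5 f \<in> quot cyc5_rels"
proof (rule p5.quot_substitute[of dk5 dk_rels])
  fix r :: "4 dk_gen series" assume "r \<in> dk_rels"
  then consider i where "r = dk i i" | i j where "r = dk i j - dk j i" "i \<noteq> j"
    | i j k l where "r = br (dk i j) (dk k l)" "distinct [i, j, k, l]"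
    | i j k where "r = br (dk i j) (dk i k + dk j k)" "distinct [i, j, k]"
    unfolding dk_rels_def by blast
  then show "substitute dk5 r \<in> quot cyc5_rels"
  proof cases
    case 1
    then show ?thesis using exhaust_4[of i] by (auto simp: dk5_upper_def)
  next
    case 2
    then show ?thesis by (simp add: substitute_diff add.commute)
  next
    case 3
    have "br (dk5 (DK i j)) (dk5 (DK k l)) \<in> quot cyc5_rels"
      using 3(2) exhaust_4[of i] exhaust_4[of j] exhaust_4[of k] exhaust_4[of l]
      by (elim disjE) (simp_all del: dk5.simps, (rule br_lin5; simp)+)
    then show ?thesis using 3 by (simp add: substitute_br del: dk5.simps)
  next
    case 4
    have "br (dk5 (DK i j)) (dk5 (DK i k) + dk5 (DK j k)) \<in> quot cyc5_rels"
      using 4(2) exhaust_4[of i] exhaust_4[of j] exhaust_4[of k]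
      by (elim disjE) (simp_all add: lin5_add del: dk5.simps, (rule br_lin5; simp)+)
    then show ?thesis using 4 by (simp add: substitute_br substitute_add del: dk5.simps)
  qed
qed simp_all

text \<open>A splitting of the quotient map by the centre: t_45 and t_51 lift to the full sums over
  the strands 1, 2, 3 and 2, 3, 4.\<close>

primrec cyc5_dk :: "cyc5 \<Rightarrow> 4 dk_gen series" where
  "cyc5_dk Y1 = dk 1 2" | "cyc5_dk Y2 = dk 2 3" | "cyc5_dk Y3 = dk 3 4"
| "cyc5_dk Y4 = dk 1 2 + dk 1 3 + dk 2 3" | "cyc5_dk Y5 = dk 2 3 + dk 2 4 + dk 3 4"

lemma cyc5_dk_lie [simp]: "cyc5_dk x \<in> lie_series"
  by (cases x) simp_all

lemma cyc5_dk_nc [simp]: "nc cyc5_dk"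
  by (intro nc_lie cyc5_dk_lie)

lemma t4_sym: "dk i j - dk j i \<in> quot (dk_rels :: 4 dk_gen series set)" if "i \<noteq> j"
  by (rule quot_rel) (use that in \<open>auto simp: dk_rels_def\<close>)

lemma t4_disjoint: "br (dk i j) (dk k l) \<in> quot (dk_rels :: 4 dk_gen series set)" if "distinct [i, j, k, l]"
  by (rule quot_rel) (use that in \<open>unfold dk_rels_def, blast\<close>)

lemma t4_triple: "br (dk i j) (dk i k + dk j k) \<in> quot (dk_rels :: 4 dk_gen series set)" if "distinct [i, j, k]"
  by (rule quot_rel) (use that in \<open>unfold dk_rels_def, blast\<close>)

lemma t4_br:
  "br (dk 1 2) (dk 3 4) \<in> quot (dk_rels :: 4 dk_gen series set)"
  "br (dk 3 4) (dk 1 2) \<in> quot (dk_rels :: 4 dk_gen series set)"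
  "br (dk 1 3) (dk 2 4) \<in> quot (dk_rels :: 4 dk_gen series set)"
  "br (dk 3 4) (dk 2 3 + dk 2 4) \<in> quot (dk_rels :: 4 dk_gen series set)"
  "br (dk 2 3) (dk 2 4 + dk 3 4) \<in> quot (dk_rels :: 4 dk_gen series set)"
  "br (dk 2 3) (dk 1 2 + dk 1 3) \<in> quot (dk_rels :: 4 dk_gen series set)"
  "br (dk 1 2) (dk 1 3 + dk 2 3) \<in> quot (dk_rels :: 4 dk_gen series set)"
proof -
  let ?I = "quot (dk_rels :: 4 dk_gen series set)"
  have "br (dk 3 4) (dk 2 3 + dk 2 4) - br (dk 3 4) (dk 3 2 + dk 4 2) \<in> ?I"
    by (intro t4.ideal_br_cong t4.ideal_add_cong t4_sym t4.ideal_refl) simp_all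
  then show "br (dk 3 4) (dk 2 3 + dk 2 4) \<in> ?I" by (rule t4.ideal_cong) (simp add: t4_triple)
  have "br (dk 2 3) (dk 1 2 + dk 1 3) - br (dk 2 3) (dk 2 1 + dk 3 1) \<in> ?I"
    by (intro t4.ideal_br_cong t4.ideal_add_cong t4_sym t4.ideal_refl) simp_all
  then show "br (dk 2 3) (dk 1 2 + dk 1 3) \<in> ?I" by (rule t4.ideal_cong) (simp add: t4_triple)
qed (simp_all add: t4_disjoint t4_triple)

lemma cyc5_dk_ideal: "f \<in> quot cyc5_rels \<Longrightarrow> substitute cyc5_dk f \<in> quot dk_rels"
proof (rule t4.quot_substitute[of cyc5_dk cyc5_rels])
  fix r assume r: "r \<in> cyc5_rels"
  let ?I = "quot (dk_rels :: 4 dk_gen series set)"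
  let ?S = "substitute cyc5_dk"
  have 1: "?S (br y3 y5) = br (dk 3 4) (dk 2 3 + dk 2 4)"
    "?S (br y5 y2) = - br (dk 2 3) (dk 2 4 + dk 3 4)"
    "?S (br y2 y4) = br (dk 2 3) (dk 1 2 + dk 1 3)"
    "?S (br y4 y1) = - br (dk 1 2) (dk 1 3 + dk 2 3)"
    by (simp_all add: substitute_br) (simp_all add: br_def algebra_simps)
  have 2: "?S cyc5_rel = br (dk 2 3) (dk 2 4 + dk 3 4) - br (dk 2 3) (dk 1 2 + dk 1 3) +
      br (dk 1 3) (dk 2 4) - br (dk 1 2) (dk 3 4)"
    by (simp add: cyc5_rel_def substitute_add substitute_br) (simp add: br_def algebra_simps)
  have "?S cyc5_rel \<in> ?I"
    unfolding 2 by (intro t4.ideal_add t4.ideal_diff t4_br)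
  then show "?S r \<in> ?I"
    using r by (elim cyc5_rels_cases) (simp_all add: 1 t4_br t4.ideal_minus, simp add: substitute_br t4_br)
qed simp_all

lemma lin5_letters:
  "lin5 1 0 0 0 0 = y1" "lin5 0 1 0 0 0 = y2" "lin5 0 0 1 0 0 = y3"
  by (simp_all add: lin5_def)

text \<open>Each comparison map turns one equation into the other up to adding to the arguments
  terms that commute with both of them, which a series without linear part does not notice.\<close>

lemma pentagon_iff:
  assumes lie: "\<psi> \<in> lie_series" and lin: "\<And>l. wcoeff \<psi> [l] = 0" and hex: "hexagons \<psi>"
  shows "dk_pentagon \<psi> \<in> quot dk_rels \<longleftrightarrow> cyc5_pentagon \<psi> \<in> quot cyc5_rels"
proof
  let ?I = "quot cyc5_rels" and ?J = "quot (dk_rels :: 4 dk_gen series set)"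
  note anti = ev_antisym_letter[OF hex]
  have antiJ: "ev \<psi> a b = - ev \<psi> b a" if "a \<in> lie_series" "b \<in> lie_series" for a b :: "4 dk_gen series"
    using ev_antisym[OF hex] that by blast
  {
    assume "dk_pentagon \<psi> \<in> ?J"
    then have "substitute dk5 (dk_pentagon \<psi>) \<in> ?I" by (rule dk5_ideal)
    moreover have "substitute dk5 (dk_pentagon \<psi>) = ev \<psi> (y1 + 0) (y5 + - y3) + ev \<psi> (y4 + - y1) (y3 + 0) -
       (ev \<psi> y2 y3 + ev \<psi> (y4 + - y2) (y5 + - y2) + ev \<psi> y1 y2)" (is "_ = ?S")
      by (simp add: dk_pentagon_def substitute_add substitute_diff substitute_ev lin5_add lin5_letters
          del: dk5.simps) (simp add: lin5_def series.scale_minus_left)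
    ultimately have S: "?S \<in> ?I" by (simp only:)
    have "ev \<psi> (y1 + 0) (y5 + - y3) - ev \<psi> y1 y5 \<in> ?I" "ev \<psi> (y4 + - y1) (y3 + 0) - ev \<psi> y4 y3 \<in> ?I"
      "ev \<psi> (y4 + - y2) (y5 + - y2) - ev \<psi> y4 y5 \<in> ?I"
      by (rule p5.ev_central_shift; simp add: lie lin br_minus_left br_minus_right p5.ideal_minus)+
    note p5.ideal_diff[OF p5.ideal_add[OF p5.ideal_add[OF p5.ideal_minus[OF S] this(1)] this(2)] this(3)]
    also have "- ?S + (ev \<psi> (y1 + 0) (y5 + - y3) - ev \<psi> y1 y5) + (ev \<psi> (y4 + - y1) (y3 + 0) - ev \<psi> y4 y3) -
       (ev \<psi> (y4 + - y2) (y5 + - y2) - ev \<psi> y4 y5) = cyc5_pentagon \<psi>"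
      unfolding cyc5_pentagon_def anti[of Y1 Y5] anti[of Y4 Y3] by (simp add: algebra_simps)
    finally show "cyc5_pentagon \<psi> \<in> ?I" .
  }
  {
    assume "cyc5_pentagon \<psi> \<in> ?I"
    then have "substitute cyc5_dk (cyc5_pentagon \<psi>) \<in> ?J" by (rule cyc5_dk_ideal)
    moreover have "substitute cyc5_dk (cyc5_pentagon \<psi>) =
       ev \<psi> (dk 1 2) (dk 2 3) + ev \<psi> (dk 2 3) (dk 3 4) - ev \<psi> ((dk 1 3 + dk 2 3) + dk 1 2) (dk 3 4 + 0) +
       ev \<psi> ((dk 1 2 + dk 1 3) + dk 2 3) ((dk 2 4 + dk 3 4) + dk 2 3) -
       ev \<psi> (dk 1 2 + 0) ((dk 2 3 + dk 2 4) + dk 3 4)" (is "_ = ?S")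
      using antiJ[of "dk 3 4" "dk 1 2 + (dk 1 3 + dk 2 3)"] antiJ[of "dk 2 3 + (dk 2 4 + dk 3 4)" "dk 1 2"]
      by (simp add: cyc5_pentagon_def substitute_add substitute_ev add_ac)
    ultimately have S: "?S \<in> ?J" by (simp only:)
    have "ev \<psi> ((dk 1 3 + dk 2 3) + dk 1 2) (dk 3 4 + 0) - ev \<psi> (dk 1 3 + dk 2 3) (dk 3 4) \<in> ?J" (is "?s1 \<in> _")
       "ev \<psi> ((dk 1 2 + dk 1 3) + dk 2 3) ((dk 2 4 + dk 3 4) + dk 2 3) -
         ev \<psi> (dk 1 2 + dk 1 3) (dk 2 4 + dk 3 4) \<in> ?J" (is "?s2 \<in> _")
       "ev \<psi> (dk 1 2 + 0) ((dk 2 3 + dk 2 4) + dk 3 4) - ev \<psi> (dk 1 2) (dk 2 3 + dk 2 4) \<in> ?J" (is "?s3 \<in> _")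
      by (rule t4.ev_central_shift; simp add: lie lin t4_br)+
    note t4.ideal_diff[OF t4.ideal_add[OF t4.ideal_diff[OF t4.ideal_minus[OF S] this(1)] this(2)] this(3)]
    also have "- ?S - ?s1 + ?s2 - ?s3 = dk_pentagon \<psi>"
      by (simp add: dk_pentagon_def algebra_simps)
    finally show "dk_pentagon \<psi> \<in> ?J" .
  }
qed

lemma pent5_if_grt1: "\<psi> \<in> grt1 \<Longrightarrow> pent5 \<psi>"
  using grt1_linear[of \<psi>] pentagon_iff[of \<psi>] by unfold_locales (auto simp: grt1_iff)

lemma grt1_ihara:
  assumes "\<psi> \<in> grt1" "\<phi> \<in> grt1"
  shows "ihara_bracket \<psi> \<phi> \<in> grt1"
proof -
  have lie: "\<psi> \<in> lie_series" "\<phi> \<in> lie_series" using assms by (simp_all add: grt1_iff)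
  have "wcoeff (ihara_der \<alpha> \<beta>) [l] = 0" if "\<beta> \<in> grt1" for \<alpha> \<beta> l
  proof -
    have "vanish 2 \<beta>"
      using that grt1_linear[OF that] lie_series_Nil[of \<beta>]
      by (auto simp: vanish_def grt1_iff less_2_cases_iff length_Suc_conv)
    then show ?thesis
      unfolding ihara_der_def by (intro vanishD[OF vanish_der]) auto
  qed
  then have "wcoeff (ihara_bracket \<psi> \<phi>) [l] = 0" for l
    using lie_series_br_linear[OF lie] assms by (simp add: ihara_bracket_def)
  moreover have "hexagons (ihara_bracket \<psi> \<phi>)"
    using assms lie by (intro hexagons_ihara) (simp_all add: grt1_iff)
  moreover have "cyc5_pentagon (ihara_bracket \<psi> \<phi>) \<in> quot cyc5_rels"
    by (intro cyc5_pentagon_ihara pent5_if_grt1 assms)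
  ultimately show ?thesis
    using pentagon_iff lie by (simp add: grt1_iff)
qed

lemma ev_add: "ev (\<psi> + \<phi>) c d = ev \<psi> c d + ev \<phi> c d"
  and ev_qscale: "ev (qscale t \<psi>) c d = qscale t (ev \<psi> c d)"
  by (simp_all add: ev_def substitute_add substitute_qscale)

lemma grt1_zero: "0 \<in> grt1"
  by (simp add: grt1_iff hexagons_def dk_pentagon_def ev_def)

lemma grt1_add: "\<psi> \<in> grt1 \<Longrightarrow> \<phi> \<in> grt1 \<Longrightarrow> \<psi> + \<phi> \<in> grt1"
proof -
  assume a: "\<psi> \<in> grt1" "\<phi> \<in> grt1"
  have "dk_pentagon (\<psi> + \<phi>) = dk_pentagon \<psi> + dk_pentagon \<phi>"
    by (simp add: dk_pentagon_def ev_add)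
  moreover have "hexagons (\<psi> + \<phi>)"
    using a unfolding grt1_iff hexagons_def ev_add br_add_right
    by (smt (verit) add.assoc add.commute add.left_commute add_0 minus_add_distrib)
  ultimately show ?thesis using a by (simp add: grt1_iff t4.ideal_add)
qed

lemma grt1_qscale: "\<psi> \<in> grt1 \<Longrightarrow> qscale c \<psi> \<in> grt1"
proof -
  assume a: "\<psi> \<in> grt1"
  have "dk_pentagon (qscale c \<psi>) = qscale c (dk_pentagon \<psi>)"
    by (simp add: dk_pentagon_def ev_qscale qscale_add qscale_diff)
  moreover have "hexagons (qscale c \<psi>)"
    using a unfolding grt1_iff hexagons_def ev_qscale br_qscale qscale_add[symmetric]
    by (metis series.scale_minus_right series.scale_zero_right)
  ultimately show ?thesis using a by (simp add: grt1_iff t4.ideal_qscale)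
qed

section \<open>The elliptic Lie algebra\<close>

lemma UNIV_sgn: "(UNIV :: sgn set) = {SPlus, SMinus}"
  by (auto intro: sgn.exhaust)

lemma finite_ell_gen: "finite (UNIV :: 'i::finite ell_gen set)"
proof -
  have "(UNIV :: 'i ell_gen set) = (\<lambda>(s, i). GX s i) ` UNIV \<union> (\<lambda>(i, j). GT i j) ` UNIV"
    by (auto simp: image_iff) (metis ell_gen.exhaust)
  then show ?thesis by (metis finite_class.finite_UNIV finite_imageI finite_UnI)
qed

instance ell_gen :: (finite) finite
  by standard (rule finite_ell_gen)

abbreviation I3 :: "3 ell_gen series set" where
  "I3 \<equiv> quot ell_rels"

interpretation t13: closed_lie_ideal I3
  by unfold_locales (rule closed_ideal_quot)

lemma ell_relsI:
  shows "gt i i \<in> (ell_rels :: 3 ell_gen series set)"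
    and "i \<noteq> j \<Longrightarrow> gt i j - gt j i \<in> (ell_rels :: 3 ell_gen series set)"
    and "(\<Sum>i\<in>UNIV. gx s i) \<in> (ell_rels :: 3 ell_gen series set)"
    and "i \<noteq> j \<Longrightarrow> br (gx s i) (gx s j) \<in> (ell_rels :: 3 ell_gen series set)"
    and "i \<noteq> j \<Longrightarrow> br (gx SPlus i) (gx SMinus j) - gt i j \<in> (ell_rels :: 3 ell_gen series set)"
    and "br (gx SPlus i) (gx SMinus i) + (\<Sum>j\<in>UNIV - {i}. gt i j) \<in> (ell_rels :: 3 ell_gen series set)"
    and "distinct [i, j, k] \<Longrightarrow> br (gx s i) (gt j k) \<in> (ell_rels :: 3 ell_gen series set)"
    and "i \<noteq> j \<Longrightarrow> br (gx s i + gx s j) (gt i j) \<in> (ell_rels :: 3 ell_gen series set)"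
    and "distinct [i, j, k] \<Longrightarrow> br (gt i j) (gt i k + gt j k) \<in> (ell_rels :: 3 ell_gen series set)"
proof -
  show "gt i i \<in> (ell_rels :: 3 ell_gen series set)"
    unfolding ell_rels_def by (rule UnI1, rule UnI1, rule UnI1, rule UnI1, rule UnI1, rule UnI1, rule UnI1, rule UnI1, rule UnI1) blast
  show "gt i j - gt j i \<in> (ell_rels :: 3 ell_gen series set)" if "i \<noteq> j"
    unfolding ell_rels_def by (rule UnI1, rule UnI1, rule UnI1, rule UnI1, rule UnI1, rule UnI1, rule UnI1, rule UnI1, rule UnI2) (use that in blast)
  show "(\<Sum>i\<in>UNIV. gx s i) \<in> (ell_rels :: 3 ell_gen series set)"
    unfolding ell_rels_def by (rule UnI1, rule UnI1, rule UnI1, rule UnI1, rule UnI1, rule UnI1, rule UnI1, rule UnI2) blast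
  show "br (gx s i) (gx s j) \<in> (ell_rels :: 3 ell_gen series set)" if "i \<noteq> j"
    unfolding ell_rels_def by (rule UnI1, rule UnI1, rule UnI1, rule UnI1, rule UnI1, rule UnI1, rule UnI2) (use that in blast)
  show "br (gx SPlus i) (gx SMinus j) - gt i j \<in> (ell_rels :: 3 ell_gen series set)" if "i \<noteq> j"
    unfolding ell_rels_def by (rule UnI1, rule UnI1, rule UnI1, rule UnI1, rule UnI1, rule UnI2) (use that in blast)
  show "br (gx SPlus i) (gx SMinus i) + (\<Sum>j\<in>UNIV - {i}. gt i j) \<in> (ell_rels :: 3 ell_gen series set)"
    unfolding ell_rels_def by (rule UnI1, rule UnI1, rule UnI1, rule UnI1, rule UnI2) blast
  show "br (gx s i) (gt j k) \<in> (ell_rels :: 3 ell_gen series set)" if "distinct [i, j, k]"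
    unfolding ell_rels_def by (rule UnI1, rule UnI1, rule UnI1, rule UnI2) (use that in blast)
  show "br (gx s i + gx s j) (gt i j) \<in> (ell_rels :: 3 ell_gen series set)" if "i \<noteq> j"
    unfolding ell_rels_def by (rule UnI1, rule UnI1, rule UnI2) (use that in blast)
  show "br (gt i j) (gt i k + gt j k) \<in> (ell_rels :: 3 ell_gen series set)" if "distinct [i, j, k]"
    unfolding ell_rels_def by (rule UnI1, rule UnI2) (use that in blast)
qed

lemmas t_refl = quot_rel[OF ell_relsI(1)] and t_sym = quot_rel[OF ell_relsI(2)] and x_sum = quot_rel[OF ell_relsI(3)]
  and x_x = quot_rel[OF ell_relsI(4)] and x_x' = quot_rel[OF ell_relsI(5)] and x_t = quot_rel[OF ell_relsI(7)]
  and t_t = quot_rel[OF ell_relsI(9)]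

lemma ell_rels_cases:
  assumes "r \<in> (ell_rels :: 3 ell_gen series set)"
  obtains i where "r = gt i i"
  | i j where "i \<noteq> j" "r = gt i j - gt j i"
  | s where "r = (\<Sum>i\<in>UNIV. gx s i)"
  | s i j where "i \<noteq> j" "r = br (gx s i) (gx s j)"
  | i j where "i \<noteq> j" "r = br (gx SPlus i) (gx SMinus j) - gt i j"
  | i where "r = br (gx SPlus i) (gx SMinus i) + (\<Sum>j\<in>UNIV - {i}. gt i j)"
  | s i j k where "distinct [i, j, k]" "r = br (gx s i) (gt j k)"
  | s i j where "i \<noteq> j" "r = br (gx s i + gx s j) (gt i j)"
  | i j k where "distinct [i, j, k]" "r = br (gt i j) (gt i k + gt j k)"
proof -
  have nd: "\<not> distinct [i, j, k, l]" for i j k l :: 3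
    using exhaust_3[of i] exhaust_3[of j] exhaust_3[of k] exhaust_3[of l] by auto
  then show ?thesis
    using assms unfolding ell_rels_def Un_iff mem_Collect_eq
    by (elim disjE exE conjE) ((rule that(1), assumption) | (rule that(2), assumption, assumption) | (rule that(3), assumption) | (rule that(4), assumption, assumption) | (rule that(5), assumption, assumption) | (rule that(6), assumption) | (rule that(7), assumption, assumption) | (rule that(8), assumption, assumption) | (rule that(9), assumption, assumption) | (use nd in blast))+
qed

section \<open>Permutations of the three strands\<close>

primrec relabel :: "(3 \<Rightarrow> 3) \<Rightarrow> 3 ell_gen \<Rightarrow> 3 ell_gen series" where
  "relabel \<pi> (GX s i) = gx s (\<pi> i)"
| "relabel \<pi> (GT i j) = gt (\<pi> i) (\<pi> j)"

lemma relabel_lie [simp]: "relabel \<pi> x \<in> lie_series"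
  by (cases x) simp_all

lemma relabel_nc [simp]: "nc (relabel \<pi>)"
  by (intro nc_lie relabel_lie)

lemma relabel_ideal:
  assumes "bij \<pi>" "f \<in> I3"
  shows "substitute (relabel \<pi>) f \<in> I3"
proof (rule t13.quot_substitute[OF _ _ assms(2)])
  have inj: "\<pi> i = \<pi> j \<longleftrightarrow> i = j" for i j using assms(1) by (simp add: bij_def inj_eq)
  fix r :: "3 ell_gen series" assume "r \<in> ell_rels"
  then have "substitute (relabel \<pi>) r \<in> ell_rels"
  proof (cases rule: ell_rels_cases)
    case (3 s)
    have "(\<Sum>i\<in>UNIV. gx s (\<pi> i)) = (\<Sum>i\<in>UNIV. gx s i)"
      using assms(1) by (rule sum.reindex_bij_betw)
    then have "substitute (relabel \<pi>) r = (\<Sum>i\<in>UNIV. gx s i)"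
      using 3 by (simp add: substitute_sum)
    then show ?thesis by (simp only: ell_relsI)
  next
    case (6 i)
    have "bij_betw \<pi> (UNIV - {i}) (UNIV - {\<pi> i})"
      using assms(1) by (intro bij_betw_DiffI) (auto simp: bij_betw_def)
    then have "(\<Sum>j\<in>UNIV - {i}. gt (\<pi> i) (\<pi> j)) = (\<Sum>j\<in>UNIV - {\<pi> i}. gt (\<pi> i) j)"
      by (rule sum.reindex_bij_betw)
    then have "substitute (relabel \<pi>) r =
        br (gx SPlus (\<pi> i)) (gx SMinus (\<pi> i)) + (\<Sum>j\<in>UNIV - {\<pi> i}. gt (\<pi> i) j)"
      using 6 by (simp add: substitute_sum substitute_add substitute_br)
    then show ?thesis by (simp only: ell_relsI)
  qed (simp_all add: substitute_diff substitute_add substitute_br inj ell_relsI)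
  then show "substitute (relabel \<pi>) r \<in> I3" by (rule quot_rel)
qed simp

definition cyc3 :: "3 \<Rightarrow> 3" where
  "cyc3 i = (if i = 1 then 2 else if i = 2 then 3 else 1)"

definition swap12 :: "3 \<Rightarrow> 3" where
  "swap12 i = (if i = 1 then 2 else if i = 2 then 1 else i)"

lemma cyc3_simps [simp]: "cyc3 1 = 2" "cyc3 2 = 3" "cyc3 3 = 1"
  and swap12_simps [simp]: "swap12 1 = 2" "swap12 2 = 1" "swap12 3 = 3"
  by (simp_all add: cyc3_def swap12_def)

lemma bij_cyc3: "bij cyc3" and bij_swap12: "bij swap12"
proof -
  have "inj cyc3" "inj swap12"
    unfolding inj_def using exhaust_3 by (metis cyc3_simps num1_eq1 swap12_simps)+
  then show "bij cyc3" "bij swap12"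
    by (simp_all add: bij_def finite_UNIV_inj_surj)
qed

definition x_der :: "ab series \<Rightarrow> (sgn \<Rightarrow> sgn series) \<Rightarrow> sgn \<Rightarrow> 3 \<Rightarrow> 3 ell_gen series" where
  "x_der \<psi> u s i = (if i = 1 then ell_xi \<psi> u s else if i = 2 then ell_eta \<psi> u s else ins 3 (u s))"

lemma x_der_simps [simp]:
  "x_der \<psi> u s 1 = ell_xi \<psi> u s" "x_der \<psi> u s 2 = ell_eta \<psi> u s" "x_der \<psi> u s 3 = ins 3 (u s)"
  by (simp_all add: x_der_def)

text \<open>The derivation of \<open>\<tt>\<^bsub>1,3\<^esub>\<close> attached to \<open>(\<psi>, u)\<close>: the defining relations of \<open>\<gg>\<rr>\<tt>\<^sub>1\<^sup>e\<^sup>l\<^sup>l\<close> say that it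
  respects the relations of \<open>\<tt>\<^bsub>1,3\<^esub>\<close>.\<close>

primrec ell_der :: "ab series \<Rightarrow> (sgn \<Rightarrow> sgn series) \<Rightarrow> 3 ell_gen \<Rightarrow> 3 ell_gen series" where
  "ell_der \<psi> u (GX s i) = x_der \<psi> u s i"
| "ell_der \<psi> u (GT i j) = (if i = j then 0 else
     br (x_der \<psi> u SPlus i) (gx SMinus j) + br (gx SPlus i) (x_der \<psi> u SMinus j))"

lemma ins_lie [simp, intro]: "f \<in> lie_series \<Longrightarrow> ins i f \<in> lie_series"
  by (simp add: ins_def)

lemma psi3_lie [simp, intro]: "\<psi> \<in> lie_series \<Longrightarrow> psi3 \<psi> i j k \<in> lie_series"
  by (simp add: psi3_def)

lemma ell_xi_lie [simp]: "\<psi> \<in> lie_series \<Longrightarrow> u s \<in> lie_series \<Longrightarrow> ell_xi \<psi> u s \<in> lie_series"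
  and ell_eta_lie [simp]: "\<psi> \<in> lie_series \<Longrightarrow> u s \<in> lie_series \<Longrightarrow> ell_eta \<psi> u s \<in> lie_series"
  by (simp_all add: ell_xi_def ell_eta_def)

lemma relabel_ins: "substitute (relabel \<pi>) (ins i f) = ins (\<pi> i) f"
  unfolding ins_def by (subst substitute_substitute) simp_all

lemma relabel_psi3: "substitute (relabel \<pi>) (psi3 \<psi> i j k) = psi3 \<psi> (\<pi> i) (\<pi> j) (\<pi> k)"
  unfolding psi3_def by (subst substitute_ev) simp_all

lemma relabel_xi_swap: "substitute (relabel swap12) (ell_xi \<psi> u s) = ell_eta \<psi> u s"
  and relabel_eta_swap: "substitute (relabel swap12) (ell_eta \<psi> u s) = ell_xi \<psi> u s"
  by (simp_all add: ell_xi_def ell_eta_def substitute_diff substitute_br relabel_ins relabel_psi3)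

lemma (in closed_lie_ideal) br_substitute:
  assumes "\<And>l. \<sigma> l \<in> lie_series" "z \<in> lie_series" "f \<in> lie_series" "\<And>l. br z (\<sigma> l) \<in> I"
  shows "br z (substitute \<sigma> f) \<in> I"
proof (rule twisted_derivation_in_ideal[of "\<lambda>f. br z (substitute \<sigma> f)" "substitute \<sigma>" "substitute \<sigma>"])
  have nc: "nc \<sigma>" by (intro nc_lie assms)
  then show "br z (substitute \<sigma> (br f g)) =
     br (br z (substitute \<sigma> f)) (substitute \<sigma> g) + br (substitute \<sigma> f) (br z (substitute \<sigma> g))"
    "br z (substitute \<sigma> (letter l)) \<in> I" for f g l
    using assms(4) by (simp_all add: substitute_br br_jacobi[of z "substitute \<sigma> f"])
qed (use assms in \<open>auto intro!: lie_hom_substitute\<close>)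

lemma deriv_substitute:
  fixes \<sigma> :: "'a::finite \<Rightarrow> 'b::finite series"
  assumes "nc \<sigma>" "nc \<delta>" "nc u" "\<And>l. deriv \<delta> (\<sigma> l) + br a (\<sigma> l) = substitute \<sigma> (u l)"
  shows "deriv \<delta> (substitute \<sigma> f) + br a (substitute \<sigma> f) = substitute \<sigma> (deriv u f)"
proof (rule derivation_ext[where F = "\<lambda>f. deriv \<delta> (substitute \<sigma> f) + br a (substitute \<sigma> f)"
      and G = "\<lambda>f. substitute \<sigma> (deriv u f)" and S = "substitute \<sigma>"])
  show "clin (\<lambda>f. deriv \<delta> (substitute \<sigma> f) + br a (substitute \<sigma> f))" "clin (\<lambda>f. substitute \<sigma> (deriv u f))"
    by (intro clin_plus clin_derI clin_br clin_substituteI clin_id)+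
qed (use assms in \<open>simp_all add: substitute_mult substitute_add deriv_mult br_def algebra_simps\<close>)

section \<open>The derivation of the three-strand elliptic Lie algebra attached to an elliptic
  element\<close>

locale ell =
  fixes \<psi> u
  assumes grt1_ell: "(\<psi>, u) \<in> grt1_ell"
begin

abbreviation "D \<equiv> deriv (ell_der \<psi> u)"
abbreviation "\<alpha> \<equiv> psi3 \<psi> 1 2 3"

lemma grt1: "\<psi> \<in> grt1" and u_lie [simp, intro]: "u s \<in> lie_series"
  and sum_rel: "ell_xi \<psi> u s + ell_eta \<psi> u s + ins 3 (u s) \<in> I3"
  and x_rel: "br (ell_xi \<psi> u s) (gx s 3) + br (gx s 1) (ins 3 (u s)) \<in> I3"
  and t_rel: "br (ell_xi \<psi> u SPlus) (gx SMinus 2) + br (gx SPlus 1) (ell_eta \<psi> u SMinus) \<in> I3"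
  using grt1_ell by (auto simp: grt1_ell_def lie_cong_iff)

lemma psi_lie [simp, intro]: "\<psi> \<in> lie_series" and hex: "hexagons \<psi>"
  using grt1 by (simp_all add: grt1_iff)

lemma psi_linear [simp]: "wcoeff \<psi> [l] = 0"
  by (rule grt1_linear[OF grt1])

lemma x_der_lie [simp]: "x_der \<psi> u s i \<in> lie_series"
  by (simp add: x_der_def)

lemma ell_der_lie [simp]: "ell_der \<psi> u x \<in> lie_series"
  by (cases x) simp_all

lemma ell_der_nc [simp]: "nc (ell_der \<psi> u)"
  by (intro nc_lie ell_der_lie)

lemma D_lie [simp]: "f \<in> lie_series \<Longrightarrow> D f \<in> lie_series"
  by simp

lemma D_letter: "D (letter x) = ell_der \<psi> u x"
  by (rule der_letter) simp_all

lemma D_br: "D (br f g) = br (D f) g + br f (D g)"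
  by (rule deriv_br) simp

text \<open>Checking the x_i suffices: the value at t_ij is defined by the Leibniz rule for
  [x_i^+, x_j^-], so the defect there comes from defects at the x_i and from this relation.\<close>

lemma relabel_conjugate:
  assumes "bij \<pi>" "a \<in> lie_series"
    and x: "\<And>s i. substitute (relabel \<pi>) (x_der \<psi> u s i) - (x_der \<psi> u s (\<pi> i) + br a (gx s (\<pi> i))) \<in> I3"
    and f: "f \<in> lie_series"
  shows "substitute (relabel \<pi>) (D f) - (D (substitute (relabel \<pi>) f) + br a (substitute (relabel \<pi>) f)) \<in> I3"
proof (rule t13.intertwine)
  let ?P = "substitute (relabel \<pi>)"
  fix y
  show "?P (ell_der \<psi> u y) - (D (relabel \<pi> y) + br a (relabel \<pi> y)) \<in> I3"
  proof (cases y)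
    case (GX s i)
    then show ?thesis using x by (simp add: D_letter)
  next
    case (GT i j)
    show ?thesis
    proof (cases "i = j")
      case True
      have "br a (gt (\<pi> j) (\<pi> j)) \<in> I3" by (intro t13.ideal_br_right t_refl assms)
      then show ?thesis using GT True by (simp add: D_letter t13.ideal_minus)
    next
      case False
      then have ij: "\<pi> i \<noteq> \<pi> j" using assms(1) by (simp add: bij_def inj_eq)
      let ?E = "\<lambda>s i. ?P (x_der \<psi> u s i) - (x_der \<psi> u s (\<pi> i) + br a (gx s (\<pi> i)))"
      have "?P (ell_der \<psi> u y) - (D (relabel \<pi> y) + br a (relabel \<pi> y)) =
        br (?E SPlus i) (gx SMinus (\<pi> j)) + br (gx SPlus (\<pi> i)) (?E SMinus j) +
        br a (br (gx SPlus (\<pi> i)) (gx SMinus (\<pi> j)) - gt (\<pi> i) (\<pi> j))"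
        using GT False ij by (simp add: D_letter substitute_add substitute_br)
          (simp add: br_def algebra_simps)
      also have "\<dots> \<in> I3"
        by (intro t13.ideal_add t13.ideal_br_left t13.ideal_br_right x x_x' assms ij) simp_all
      finally show ?thesis .
    qed
  qed
qed (use assms in simp_all)

lemma t_commute: "br (gt 1 2 + gt 2 3 + gt 3 1) (gt 1 2) \<in> I3" "br (gt 1 2 + gt 2 3 + gt 3 1) (gt 2 3) \<in> I3"
proof -
  have "br (gt 1 2 + gt 2 3 + gt 3 1) (gt 1 2) = - br (gt 1 2) (gt 1 3 + gt 2 3) - br (gt 1 2) (gt 3 1 - gt 1 3)"
    by (simp add: br_def algebra_simps)
  also have "\<dots> \<in> I3" by (intro t13.ideal_diff t13.ideal_minus t_t t13.ideal_br_right t_sym) simp_all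
  finally show "br (gt 1 2 + gt 2 3 + gt 3 1) (gt 1 2) \<in> I3" .
  have "br (gt 1 2 + gt 2 3 + gt 3 1) (gt 2 3) = - br (gt 2 3) (gt 2 1 + gt 3 1) - br (gt 2 3) (gt 1 2 - gt 2 1)"
    by (simp add: br_def algebra_simps)
  also have "\<dots> \<in> I3" by (intro t13.ideal_diff t13.ideal_minus t_t t13.ideal_br_right t_sym) simp_all
  finally show "br (gt 1 2 + gt 2 3 + gt 3 1) (gt 2 3) \<in> I3" .
qed

text \<open>Passing from strand 1 to strand 2 is the hexagon equation, whose arguments t_12, t_23,
  t_31 add up to an element commuting with them. From 2 to 3 antisymmetry is enough, and from 3 to 1
  the correction term in \<open>ell_xi\<close> is the inner derivation itself.\<close>

lemma cyc3_conjugate: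
  assumes "f \<in> lie_series"
  shows "substitute (relabel cyc3) (D f) - (D (substitute (relabel cyc3) f) + br \<alpha> (substitute (relabel cyc3) f)) \<in> I3"
proof (rule relabel_conjugate[OF bij_cyc3 _ _ assms])
  fix s i
  let ?P = "substitute (relabel cyc3)"
  have hexagon: "ev \<psi> (gt 1 2) (gt 2 3) + ev \<psi> (gt 2 3) (gt 3 1) + ev \<psi> (gt 3 1) (gt 1 2) \<in> I3"
    using t13.hexagon_shifted(2)[of \<psi> "gt 1 2" "gt 2 3" "gt 1 2 + gt 2 3 + gt 3 1"] hex t_commute by simp
  have c1: "ev \<psi> (gt 2 1) (gt 1 3) - ev \<psi> (gt 1 2) (gt 3 1) \<in> I3"
    "ev \<psi> (gt 3 2) (gt 2 1) - ev \<psi> (gt 2 3) (gt 1 2) \<in> I3"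
    by (intro t13.ev_cong; simp add: t_sym)+
  have 1: "?P (x_der \<psi> u s 1) - (x_der \<psi> u s 2 + br \<alpha> (gx s 2)) =
     br ((ev \<psi> (gt 2 1) (gt 1 3) - ev \<psi> (gt 1 2) (gt 3 1)) -
       (ev \<psi> (gt 1 2) (gt 2 3) + ev \<psi> (gt 2 3) (gt 3 1) + ev \<psi> (gt 3 1) (gt 1 2))) (gx s 2)"
    using ev_antisym_letter[OF hex, of "GT 1 2 :: 3 ell_gen" "GT 3 1"]
    by (simp add: ell_xi_def ell_eta_def substitute_diff substitute_br relabel_ins relabel_psi3)
      (simp add: psi3_def br_def algebra_simps)
  have 2: "?P (x_der \<psi> u s 2) - (x_der \<psi> u s 3 + br \<alpha> (gx s 3)) =
     - br (ev \<psi> (gt 3 2) (gt 2 1) - ev \<psi> (gt 2 3) (gt 1 2)) (gx s 3)"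
    using ev_antisym_letter[OF hex, of "GT 2 3 :: 3 ell_gen" "GT 1 2"]
    by (simp add: ell_eta_def substitute_diff substitute_br relabel_ins relabel_psi3)
      (simp add: psi3_def br_def algebra_simps)
  have 3: "?P (x_der \<psi> u s 3) - (x_der \<psi> u s 1 + br \<alpha> (gx s 1)) = 0"
    by (simp add: ell_xi_def relabel_ins)
  have "?P (x_der \<psi> u s 1) - (x_der \<psi> u s 2 + br \<alpha> (gx s 2)) \<in> I3"
    "?P (x_der \<psi> u s 2) - (x_der \<psi> u s 3 + br \<alpha> (gx s 3)) \<in> I3"
    unfolding 1 2 by (intro t13.ideal_br_left t13.ideal_minus t13.ideal_diff c1 hexagon lie_series_letter)+
  then show "?P (x_der \<psi> u s i) - (x_der \<psi> u s (cyc3 i) + br \<alpha> (gx s (cyc3 i))) \<in> I3"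
    using exhaust_3[of i] 3 by auto
qed auto

lemma swap12_conjugate:
  assumes "f \<in> lie_series"
  shows "substitute (relabel swap12) (D f) - D (substitute (relabel swap12) f) \<in> I3"
proof -
  have "substitute (relabel swap12) (x_der \<psi> u s i) - (x_der \<psi> u s (swap12 i) + br 0 (gx s (swap12 i))) \<in> I3" for s i
    using exhaust_3[of i] by (auto simp: relabel_xi_swap relabel_eta_swap relabel_ins)
  then show ?thesis
    using relabel_conjugate[OF bij_swap12, of 0 f] assms by simp
qed

text \<open>Stability under sums, brackets with Lie series and rotation lets some relations be
  deduced from others together with their derivatives.\<close>

definition good :: "3 ell_gen series \<Rightarrow> bool" where
  "good r \<longleftrightarrow> r \<in> lie_series \<and> r \<in> I3 \<and> D r \<in> I3"

lemma good_add: "good r \<Longrightarrow> good r' \<Longrightarrow> good (r + r')"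
  and good_minus: "good r \<Longrightarrow> good (- r)"
  and good_diff: "good r \<Longrightarrow> good r' \<Longrightarrow> good (r - r')"
  by (auto simp: good_def der_add der_minus der_diff intro: t13.ideal_add t13.ideal_minus t13.ideal_diff)

lemma good_sum: "(\<And>x. x \<in> A \<Longrightarrow> good (f x)) \<Longrightarrow> good (sum f A)"
proof (induction A rule: infinite_finite_induct)
  case (insert x F)
  then show ?case by (simp add: good_add)
qed (simp_all add: good_def)

lemma good_br: "f \<in> lie_series \<Longrightarrow> good r \<Longrightarrow> good (br f r)" "f \<in> lie_series \<Longrightarrow> good r \<Longrightarrow> good (br r f)"
proof -
  assume "f \<in> lie_series" "good r"
  then show *: "good (br f r)"
    unfolding good_def D_br by (intro conjI t13.ideal_add t13.ideal_br_right) auto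
  show "good (br r f)" using good_minus[OF *] by (simp flip: br_swap)
qed

lemma good_cyc3: assumes "good r" shows "good (substitute (relabel cyc3) r)"
proof -
  let ?P = "substitute (relabel cyc3)"
  have "D (?P r) = ?P (D r) - br \<alpha> (?P r) - (?P (D r) - (D (?P r) + br \<alpha> (?P r)))"
    by simp
  also have "\<dots> \<in> I3"
    using assms unfolding good_def
    by (intro t13.ideal_diff t13.ideal_br_right cyc3_conjugate relabel_ideal bij_cyc3) auto
  finally show ?thesis
    using assms relabel_ideal[OF bij_cyc3] by (simp add: good_def)
qed

text \<open>The last defining equation of \<open>grt1_ell\<close> is the statement for t_12;
  exchange and rotation of strands transport it. The value at t_23 makes \<open>D\<close> an Ihara
  derivation on the pair t_12, t_23.\<close>

lemma D_t12: "D (gt 1 2) \<in> I3" and D_t21: "D (gt 2 1) \<in> I3" and D_t23: "D (gt 2 3) - br (gt 2 3) \<alpha> \<in> I3"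
proof -
  show 1: "D (gt 1 2) \<in> I3" using t_rel by (simp add: D_letter)
  have "substitute (relabel swap12) (D (gt 1 2)) - D (gt 2 1) \<in> I3"
    using swap12_conjugate[of "gt 1 2"] by simp
  from t13.ideal_diff[OF relabel_ideal[OF bij_swap12 1] this] show "D (gt 2 1) \<in> I3" by (simp add: add.commute)
  have "substitute (relabel cyc3) (D (gt 1 2)) - (D (gt 2 3) + br \<alpha> (gt 2 3)) \<in> I3"
    using cyc3_conjugate[of "gt 1 2"] by simp
  note t13.ideal_diff[OF relabel_ideal[OF bij_cyc3 1] this]
  also have "substitute (relabel cyc3) (D (gt 1 2)) -
      (substitute (relabel cyc3) (D (gt 1 2)) - (D (gt 2 3) + br \<alpha> (gt 2 3))) = D (gt 2 3) - br (gt 2 3) \<alpha>"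
    by (simp add: br_def)
  finally show "D (gt 2 3) - br (gt 2 3) \<alpha> \<in> I3" .
qed

text \<open>The three defining equations handle one representative each of the sum, the commutation
  and the t_12 relations. The relation [x_i^+, x_j^-] = t_ij holds by construction of
  \<open>ell_der\<close>, and the others are consequences by symmetry or by the Jacobi
  identity.\<close>

lemma D_ideal:
  assumes "f \<in> I3"
  shows "D f \<in> I3"
proof -
  have sum: "good (\<Sum>i\<in>UNIV. gx s i)" for s
    using sum_rel[of s] x_sum[of s] by (simp add: good_def sum_3 der_add D_letter)
  have sym: "good (gt i j - gt j i)" if "i \<noteq> j" for i j
  proof -
    have 1: "good (gt 1 2 - gt 2 1)"
      using D_t12 D_t21 t_sym by (simp add: good_def der_diff t13.ideal_diff)
    have 2: "good (gt 2 3 - gt 3 2)" using good_cyc3[OF 1] by (simp add: substitute_diff)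
    have 3: "good (gt 3 1 - gt 1 3)" using good_cyc3[OF 2] by (simp add: substitute_diff)
    show ?thesis
      using that exhaust_3[of i] exhaust_3[of j] 1 2 3 1[THEN good_minus] 2[THEN good_minus] 3[THEN good_minus]
      by auto
  qed
  have xx: "good (br (gx s i) (gx s j))" if "i \<noteq> j" for s i j
  proof -
    have 1: "good (br (gx s 1) (gx s 3))"
      using x_rel[of s] x_x by (simp add: good_def D_br D_letter)
    have 2: "good (br (gx s 2) (gx s 1))" using good_cyc3[OF 1] by (simp add: substitute_br)
    have 3: "good (br (gx s 3) (gx s 2))" using good_cyc3[OF 2] by (simp add: substitute_br)
    show ?thesis
      using that exhaust_3[of i] exhaust_3[of j] 1 2 3 1[THEN good_minus] 2[THEN good_minus] 3[THEN good_minus]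
      by (auto simp flip: br_swap)
  qed
  have xx': "good (br (gx SPlus i) (gx SMinus j) - gt i j)" if "i \<noteq> j" for i j
    using that x_x'[OF that] by (simp add: good_def der_diff D_br D_letter)
  have t: "gt i j \<in> lie_series" for i j :: 3 by simp
  have xt: "good (br (gx s i) (gt j k))" if "distinct [i, j, k]" for s i j k
  proof -
    have "br (gt j k) (ins 3 (u s)) \<in> I3" if "{j, k} = {1, 2}" for j k
      unfolding ins_def
    proof (rule t13.br_substitute)
      show "br (gt j k) (gx l 3) \<in> I3" for l
        using that x_t[THEN t13.ideal_minus, of 3 j k l] by (auto simp: doubleton_eq_iff simp flip: br_swap)
    qed auto
    from this[THEN t13.ideal_minus] have u: "br (ins 3 (u s)) (gt j k) \<in> I3" if "{j, k} = {1, 2}" for j k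
      using that by (simp flip: br_swap)
    have "good (br (gx s 3) (gt j k))" if jk: "{j, k} = {1, 2}" and D: "D (gt j k) \<in> I3" for j k
    proof -
      have "br (gx s 3) (gt j k) \<in> I3"
        using jk by (intro x_t) (auto simp: doubleton_eq_iff)
      moreover have "D (br (gx s 3) (gt j k)) \<in> I3"
        unfolding D_br using t13.ideal_add[OF u[OF jk] t13.ideal_br_right[OF _ D, of "gx s 3"]]
        by (simp add: D_letter)
      ultimately show ?thesis by (simp add: good_def)
    qed
    then have 1: "good (br (gx s 3) (gt 1 2))" "good (br (gx s 3) (gt 2 1))"
      using D_t12 D_t21 by (simp_all only: insert_commute)
    have 2: "good (br (gx s 1) (gt 2 3))" "good (br (gx s 1) (gt 3 2))"
      using good_cyc3[OF 1(1)] good_cyc3[OF 1(2)] by (simp_all add: substitute_br)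
    have 3: "good (br (gx s 2) (gt 3 1))" "good (br (gx s 2) (gt 1 3))"
      using good_cyc3[OF 2(1)] good_cyc3[OF 2(2)] by (simp_all add: substitute_br)
    show ?thesis
      using that exhaust_3[of i] exhaust_3[of j] exhaust_3[of k] 1 2 3 by auto
  qed
  have all: "UNIV = {i, j, k}" if "distinct [i, j, k]" for i j k :: 3
    using that by (intro card_subset_eq[symmetric]) auto
  have third: "\<exists>k. distinct [i, j, k]" if "i \<noteq> j" for i j :: 3
  proof -
    have "card {i, j} \<noteq> card (UNIV :: 3 set)" using that by simp
    then have "{i, j} \<noteq> UNIV" by metis
    then show ?thesis using that by auto
  qed
  have xpx: "good (br (gx s i + gx s j) (gt i j))" if "i \<noteq> j" for s i j
  proof -
    obtain k where d: "distinct [i, j, k]" using third[OF \<open>i \<noteq> j\<close>] by blast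
    note k = d all[OF d]
    \<comment> \<open>On three strands x_i + x_j is -x_k modulo the sum relation, and x_k commutes
      with t_ij.\<close>
    have "br (gx s i + gx s j) (gt i j) = br (\<Sum>i\<in>UNIV. gx s i) (gt i j) - br (gx s k) (gt i j)"
      unfolding k(2) using k(1) by (simp add: br_def algebra_simps)
    moreover have "good (br (gx s k) (gt i j))" using d by (intro xt) auto
    moreover have "good (br (\<Sum>i\<in>UNIV. gx s i) (gt i j))" by (intro good_br(2) sum t)
    ultimately show ?thesis by (simp only: good_diff)
  qed
  have xix: "good (br (gx SPlus i) (gx SMinus i) + (\<Sum>j\<in>UNIV - {i}. gt i j))" for i
  proof -
    have "br (gx SPlus i) (gx SMinus i) + (\<Sum>j\<in>UNIV - {i}. gt i j) = br (gx SPlus i) (\<Sum>j\<in>UNIV. gx SMinus j) -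
        (\<Sum>j\<in>UNIV - {i}. br (gx SPlus i) (gx SMinus j) - gt i j)"
      by (simp add: sum.remove[of UNIV i] br_add_right br_sum_right sum_subtractf)
    moreover have "good (\<Sum>j\<in>UNIV - {i}. br (gx SPlus i) (gx SMinus j) - gt i j)"
      by (intro good_sum xx') auto
    moreover have "good (br (gx SPlus i) (\<Sum>j\<in>UNIV. gx SMinus j))"
      by (intro good_br(1) sum) simp
    ultimately show ?thesis by (simp only: good_diff)
  qed
  have tt: "good (br (gt i j) (gt i k + gt j k))" if d: "distinct [i, j, k]" for i j k
  proof -
    have "UNIV - {k} = {i, j}" unfolding all[OF d] using d by auto
    then have k: "(\<Sum>l\<in>UNIV - {k}. gt k l) = gt k i + gt k j" using d by simp
    \<comment> \<open>Modulo relations t_ik + t_jk is -[x_k^+, x_k^-], and both x_k commute with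
      t_ij; the Jacobi identity supplies the rest.\<close>
    have eq: "br (gt i j) (gt i k + gt j k) =
       br (gt i j) ((gt i k - gt k i) + (gt j k - gt k j) + (br (gx SPlus k) (gx SMinus k) + (gt k i + gt k j)))
       + br (br (gx SPlus k) (gt i j)) (gx SMinus k) + br (gx SPlus k) (br (gx SMinus k) (gt i j))"
      by (simp add: br_def algebra_simps)
    have x: "good (br (gx s k) (gt i j))" for s using d by (intro xt) auto
    have K: "good (br (gx SPlus k) (gx SMinus k) + (gt k i + gt k j))" using xix[of k] by (simp only: k)
    have ik: "i \<noteq> k" "j \<noteq> k" using d by auto
    show ?thesis
      unfolding eq by (rule good_add[OF good_add[OF good_br(1)[OF t good_add[OF good_add[OF sym[OF ik(1)] sym[OF ik(2)]] K]]
        good_br(2)[OF _ x]] good_br(1)[OF _ x]]) simp_all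
  qed
  show ?thesis
  proof (rule t13.quot_deriv[OF _ _ assms])
    fix r :: "3 ell_gen series" assume "r \<in> ell_rels"
    then have "good r"
    proof (cases rule: ell_rels_cases)
      case (1 i)
      then show ?thesis by (simp add: good_def D_letter t_refl)
    qed (simp_all add: sum sym xx xx' xt xpx xix tt)
    then show "r \<in> I3 \<and> D r \<in> I3" by (simp add: good_def)
  qed simp
qed

lemma D_ins3: "D (ins 3 f) = ins 3 (deriv u f)"
  using deriv_substitute[of "\<lambda>s. gx s 3" "ell_der \<psi> u" u 0 f]
  by (simp add: ins_def D_letter lie_series_Nil)

text \<open>The correction term in \<open>ell_xi\<close> is cancelled by ad \<alpha>, so on the
  first strand it is \<open>D\<close> plus this inner derivation that restricts to u.\<close>

lemma D_ins1: "D (ins 1 f) + br \<alpha> (ins 1 f) = ins 1 (deriv u f)"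
  using deriv_substitute[of "\<lambda>s. gx s 1" "ell_der \<psi> u" u \<alpha> f]
  by (simp add: ins_def D_letter lie_series_Nil ell_xi_def)

lemma D_psi3:
  assumes "\<phi> \<in> lie_series"
  shows "D (psi3 \<phi> 1 2 3) - psi3 (ihara_der \<psi> \<phi>) 1 2 3 \<in> I3"
  unfolding psi3_def by (rule t13.deriv_ev) (use assms D_t12 D_t23 in \<open>simp_all add: psi3_def\<close>)

end

text \<open>The commutator \<open>E\<close> of the two derivations preserves the ideal and, modulo
  it, takes on the x_i the values prescribed by the bracket. The defining equations say no more than
  that certain relations are sent into the ideal.\<close>

lemma ell_bracket_closed:
  assumes "(\<psi>, u) \<in> grt1_ell" "(\<phi>, v) \<in> grt1_ell"
  shows "ell_bracket (\<psi>, u) (\<phi>, v) \<in> grt1_ell"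
proof -
  interpret psi: ell \<psi> u by unfold_locales fact
  interpret phi: ell \<phi> v by unfold_locales fact
  let ?\<chi> = "ihara_bracket \<psi> \<phi>" and ?w = "\<lambda>s. deriv u (v s) - deriv v (u s)"
  define E where "E = (\<lambda>f. psi.D (phi.D f) - phi.D (psi.D f))"
  have E_ideal: "E f \<in> I3" if "f \<in> I3" for f
    unfolding E_def using that by (intro t13.ideal_diff psi.D_ideal phi.D_ideal)
  have E_br: "E (br f g) = br (E f) g + br f (E g)" for f g
    unfolding E_def psi.D_br phi.D_br der_add by (simp add: br_def algebra_simps)
  have E_add: "E (f + g) = E f + E g" and E_diff: "E (f - g) = E f - E g" for f g
    by (simp_all add: E_def der_add der_diff)
  have E_lie: "E f \<in> lie_series" if "f \<in> lie_series" for f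
    using that by (simp add: E_def)
  have E3: "E (gx s 3) = ins 3 (?w s)" for s
    unfolding E_def psi.D_letter phi.D_letter by (simp add: psi.D_ins3 phi.D_ins3) (simp add: ins_def substitute_diff)
  have E1: "E (gx s 1) - ell_xi ?\<chi> ?w s \<in> I3" for s
  proof -
    have "E (gx s 1) - ell_xi ?\<chi> ?w s =
        - br ((psi.D phi.\<alpha> - psi3 (ihara_der \<psi> \<phi>) 1 2 3) - (phi.D psi.\<alpha> - psi3 (ihara_der \<phi> \<psi>) 1 2 3)) (gx s 1)"
    proof -
      have 1: "psi.D (gx s 1) = ins 1 (u s) - br psi.\<alpha> (gx s 1)" "phi.D (gx s 1) = ins 1 (v s) - br phi.\<alpha> (gx s 1)"
        by (simp_all add: psi.D_letter phi.D_letter ell_xi_def)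
      have 2: "psi.D (ins 1 (v s)) = ins 1 (deriv u (v s)) - br psi.\<alpha> (ins 1 (v s))"
        "phi.D (ins 1 (u s)) = ins 1 (deriv v (u s)) - br phi.\<alpha> (ins 1 (u s))"
        by (simp_all flip: psi.D_ins1 phi.D_ins1)
      have 3: "psi3 ?\<chi> 1 2 3 = br psi.\<alpha> phi.\<alpha> + psi3 (ihara_der \<psi> \<phi>) 1 2 3 - psi3 (ihara_der \<phi> \<psi>) 1 2 3"
        by (simp add: psi3_def ihara_bracket_def ev_def substitute_add substitute_diff substitute_br)
      have 4: "ins 1 (?w s) = ins 1 (deriv u (v s)) - ins 1 (deriv v (u s))"
        by (simp add: ins_def substitute_diff)
      show ?thesis
        unfolding E_def ell_xi_def 1 der_diff psi.D_br phi.D_br 2 3 4 by (simp add: 1 br_def algebra_simps)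
    qed
    also have "\<dots> \<in> I3"
      by (intro t13.ideal_minus t13.ideal_br_left t13.ideal_diff psi.D_psi3 phi.D_psi3) simp_all
    finally show ?thesis .
  qed
  \<comment> \<open>The exchange of strands 1 and 2 commutes with both derivations modulo the ideal
    and carries the result from the first strand to the second.\<close>
  have E2: "E (gx s 2) - ell_eta ?\<chi> ?w s \<in> I3" for s
  proof -
    let ?P = "substitute (relabel swap12)"
    have 1: "psi.D (phi.D (gx s 2)) - ?P (psi.D (phi.D (gx s 1))) \<in> I3"
    proof (rule t13.ideal_trans)
      have "phi.D (?P (gx s 1)) - ?P (phi.D (gx s 1)) \<in> I3"
        by (rule t13.ideal_sym, rule phi.swap12_conjugate) simp
      from psi.D_ideal[OF this] show "psi.D (phi.D (gx s 2)) - psi.D (?P (phi.D (gx s 1))) \<in> I3"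
        by (simp add: der_diff)
      show "psi.D (?P (phi.D (gx s 1))) - ?P (psi.D (phi.D (gx s 1))) \<in> I3"
        by (rule t13.ideal_sym, rule psi.swap12_conjugate) simp
    qed
    have 2: "phi.D (psi.D (gx s 2)) - ?P (phi.D (psi.D (gx s 1))) \<in> I3"
    proof (rule t13.ideal_trans)
      have "psi.D (?P (gx s 1)) - ?P (psi.D (gx s 1)) \<in> I3"
        by (rule t13.ideal_sym, rule psi.swap12_conjugate) simp
      from phi.D_ideal[OF this] show "phi.D (psi.D (gx s 2)) - phi.D (?P (psi.D (gx s 1))) \<in> I3"
        by (simp add: der_diff)
      show "phi.D (?P (psi.D (gx s 1))) - ?P (phi.D (psi.D (gx s 1))) \<in> I3"
        by (rule t13.ideal_sym, rule phi.swap12_conjugate) simp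
    qed
    have "E (gx s 2) - ?P (E (gx s 1)) \<in> I3"
      using t13.ideal_diff_cong[OF 1 2] by (simp add: E_def substitute_diff)
    moreover have "?P (E (gx s 1)) - ell_eta ?\<chi> ?w s \<in> I3"
      using relabel_ideal[OF bij_swap12 E1[of s]] by (simp add: substitute_diff relabel_xi_swap)
    ultimately show ?thesis by (rule t13.ideal_trans)
  qed
  have lie: "ell_xi ?\<chi> ?w s \<in> lie_series" "ell_eta ?\<chi> ?w s \<in> lie_series" "ins 3 (?w s) \<in> lie_series" for s
    by simp_all
  have "ell_xi ?\<chi> ?w s + ell_eta ?\<chi> ?w s + ins 3 (?w s) \<in> I3" for s
  proof (rule t13.ideal_cong)
    show "ell_xi ?\<chi> ?w s + ell_eta ?\<chi> ?w s + ins 3 (?w s) - (E (gx s 1) + E (gx s 2) + E (gx s 3)) \<in> I3"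
      unfolding E3 by (intro t13.ideal_add_cong t13.ideal_sym[OF E1] t13.ideal_sym[OF E2] t13.ideal_refl)
    show "E (gx s 1) + E (gx s 2) + E (gx s 3) \<in> I3"
      using E_ideal[OF x_sum[of s]] by (simp add: sum_3 E_add)
  qed
  moreover have "br (ell_xi ?\<chi> ?w s) (gx s 3) + br (gx s 1) (ins 3 (?w s)) \<in> I3" for s
  proof (rule t13.ideal_cong)
    show "br (ell_xi ?\<chi> ?w s) (gx s 3) + br (gx s 1) (ins 3 (?w s)) - (br (E (gx s 1)) (gx s 3) + br (gx s 1) (E (gx s 3))) \<in> I3"
      unfolding E3 by (intro t13.ideal_add_cong t13.ideal_br_cong t13.ideal_sym[OF E1] t13.ideal_refl lie) simp_all
    show "br (E (gx s 1)) (gx s 3) + br (gx s 1) (E (gx s 3)) \<in> I3"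
      using E_ideal[OF x_x[of 1 3 s]] by (simp add: E_br)
  qed
  moreover have "br (ell_xi ?\<chi> ?w SPlus) (gx SMinus 2) + br (gx SPlus 1) (ell_eta ?\<chi> ?w SMinus) \<in> I3"
  proof (rule t13.ideal_cong)
    show "br (ell_xi ?\<chi> ?w SPlus) (gx SMinus 2) + br (gx SPlus 1) (ell_eta ?\<chi> ?w SMinus) -
       (br (E (gx SPlus 1)) (gx SMinus 2) + br (gx SPlus 1) (E (gx SMinus 2))) \<in> I3"
      by (intro t13.ideal_add_cong t13.ideal_br_cong t13.ideal_sym[OF E1] t13.ideal_sym[OF E2] t13.ideal_refl lie E_lie) simp_all
    have "E (gt 1 2) \<in> I3"
      unfolding E_def by (intro t13.ideal_diff psi.D_ideal phi.D_ideal psi.D_t12 phi.D_t12)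
    from t13.ideal_add[OF E_ideal[OF x_x'[of 1 2]] this]
    show "br (E (gx SPlus 1)) (gx SMinus 2) + br (gx SPlus 1) (E (gx SMinus 2)) \<in> I3"
      by (simp add: E_diff E_br)
  qed
  moreover have "?\<chi> \<in> grt1" by (rule grt1_ihara[OF psi.grt1 phi.grt1])
  ultimately show ?thesis
    by (simp add: ell_bracket_def grt1_ell_def lie_cong_iff)
qed

section \<open>The elliptic Kashiwara--Vergne Lie algebra\<close>

lift_definition rquot :: "'a \<Rightarrow> 'a series \<Rightarrow> 'a series" is "\<lambda>i f w. f (w @ [i])" .

lemma wcoeff_rquot [simp]: "wcoeff (rquot i f) w = wcoeff f (w @ [i])"
  by (simp add: rquot.rep_eq)

lemma clin_rquot [intro!]: "clin (rquot i)"
proof (rule clinI)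
  show "\<exists>m. \<forall>f. vanish m f \<longrightarrow> vanish n (rquot i f)" for n
    by (rule exI[of _ "Suc n"]) (simp add: vanish_def)
qed (rule series_eqI, simp)+

lemmas rquot_arg = clin_add[OF clin_rquot] clin_diff[OF clin_rquot] clin_minus[OF clin_rquot]
  clin_scale[OF clin_rquot] clin_zero[OF clin_rquot] clin_sum[OF clin_rquot]

lemma rquot_mult: "rquot i (f * g) = f * rquot i g + qscale (wcoeff g []) (rquot i f)"
proof (rule series_eqI)
  fix w
  have "wcoeff (f * g) (w @ [i]) =
      (\<Sum>k\<le>length w. wcoeff f (take k (w @ [i])) * wcoeff g (drop k (w @ [i]))) + wcoeff f (w @ [i]) * wcoeff g []"
    by (simp add: wcoeff_mult)
  also have "(\<Sum>k\<le>length w. wcoeff f (take k (w @ [i])) * wcoeff g (drop k (w @ [i]))) = wcoeff (f * rquot i g) w"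
    unfolding wcoeff_mult by (rule sum.cong) auto
  finally show "wcoeff (rquot i (f * g)) w = wcoeff (f * rquot i g + qscale (wcoeff g []) (rquot i f)) w"
    by simp
qed

lemma rquot_letter: "rquot i (letter j) = (if i = j then 1 else 0)"
  by (rule series_eqI) simp

lemma series_right_decomp:
  fixes f :: "'a::finite series"
  shows "f = qscale (wcoeff f []) 1 + (\<Sum>i\<in>UNIV. rquot i f * letter i)"
proof (rule series_eqI)
  fix w :: "'a list"
  show "wcoeff f w = wcoeff (qscale (wcoeff f []) 1 + (\<Sum>i\<in>UNIV. rquot i f * letter i)) w"
    by (cases w rule: rev_cases) (simp_all add: wcoeff_sum wcoeff_mult_letter_snoc)
qed

lemma rquot_br:
  assumes "f \<in> lie_series" "g \<in> lie_series"
  shows "rquot i (br f g) = f * rquot i g - g * rquot i f"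
  using assms by (simp add: br_def rquot_arg rquot_mult lie_series_Nil)

text \<open>Chain rule: write f as a sum of products \<open>rquot j f * letter j\<close> and apply
  the Leibniz rule.\<close>

lemma rquot_deriv:
  assumes "nc \<delta>"
  shows "rquot k (deriv \<delta> f) = deriv \<delta> (rquot k f) + (\<Sum>j\<in>UNIV. rquot j f * rquot k (\<delta> j))"
proof -
  have "deriv \<delta> f = (\<Sum>j\<in>UNIV. deriv \<delta> (rquot j f) * letter j + rquot j f * \<delta> j)"
    using assms by (subst series_right_decomp[of f]) (simp add: der_add der_qscale der_sum deriv_mult)
  then show ?thesis
    using assms by (simp add: rquot_arg rquot_mult rquot_letter sum.distrib if_distrib[of "\<lambda>x. _ * x"] cong: if_cong)
qed

subsection \<open>The operators \<open>\<partial>\<^sub>i\<close>\<close>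

lemma ad_act_wsumd: "ad_act \<sigma> b y = wsumd 0 b (\<lambda>w. foldr (\<lambda>a. br (\<sigma> a)) w y)"
  by (simp add: ad_act_def wsum_eq_wsumd)

lemma foldr_br_linear:
  "foldr (\<lambda>a. br (\<sigma> a)) w (y + z) = foldr (\<lambda>a. br (\<sigma> a)) w y + foldr (\<lambda>a. br (\<sigma> a)) w z"
  "foldr (\<lambda>a. br (\<sigma> a)) w (qscale c y) = qscale c (foldr (\<lambda>a. br (\<sigma> a)) w y)"
  by (induction w) (simp_all add: br_add_right br_qscale)

lemma vanish_foldr_br: "nc \<sigma> \<Longrightarrow> vanish n y \<Longrightarrow> vanish (length w + n) (foldr (\<lambda>a. br (\<sigma> a)) w y)"
proof (induction w)
  case (Cons a w)
  then have "vanish (Suc 0 + (length w + n)) (br (\<sigma> a) (foldr (\<lambda>a. br (\<sigma> a)) w y))"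
    by (intro vanish_br) (simp_all add: vanish_1_iff)
  then show ?case by simp
qed simp

lemma clin_ad_act: "clin (\<lambda>b. ad_act \<sigma> b y)"
  unfolding ad_act_wsumd by (rule clin_wsumd)

lemma clin_ad_act_right:
  assumes "nc \<sigma>"
  shows "clin (ad_act \<sigma> b)"
proof (rule clinI)
  fix n
  have "vanish n (ad_act \<sigma> b y)" if "vanish n y" for y
  proof (rule vanishI)
    fix v :: "'b list" assume v: "length v < n"
    have "wcoeff (foldr (\<lambda>a. br (\<sigma> a)) w y) v = 0" for w
      using vanish_foldr_br[OF assms that, of w] v by (simp add: vanish_def)
    then show "wcoeff (ad_act \<sigma> b y) v = 0" by (simp add: ad_act_wsumd wcoeff_wsumd)
  qed
  then show "\<exists>m. \<forall>y. vanish m y \<longrightarrow> vanish n (ad_act \<sigma> b y)" by blast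
qed (auto intro!: series_eqI simp: ad_act_wsumd wcoeff_wsumd foldr_br_linear distrib_left sum.distrib
      sum_distrib_left mult.left_commute)

lemma ad_act_mon: "nc \<sigma> \<Longrightarrow> ad_act \<sigma> (mon w) y = foldr (\<lambda>a. br (\<sigma> a)) w y"
  unfolding ad_act_wsumd using vanish_foldr_br[of \<sigma> 0 y w] by (intro wsumd_mon) simp

lemma ad_act_mult:
  assumes "nc \<sigma>"
  shows "ad_act \<sigma> (f * g) y = ad_act \<sigma> f (ad_act \<sigma> g y)"
  by (rule bilinear_ext[of "\<lambda>f g. ad_act \<sigma> (f * g) y"])
    (use assms in \<open>auto simp: mon_mult ad_act_mon intro!: clin_comp[OF clin_ad_act] clin_ad_act
      clin_comp[OF clin_ad_act_right]\<close>)

lemmas ad_act_arg = clin_add[OF clin_ad_act] clin_diff[OF clin_ad_act] clin_scale[OF clin_ad_act]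
  clin_zero[OF clin_ad_act]

lemma ad_act_lie:
  assumes nc: "nc \<sigma>" and f: "f \<in> lie_series"
  shows "ad_act \<sigma> f y = br (substitute \<sigma> f) y"
proof -
  have poly: "ad_act \<sigma> f y = br (substitute \<sigma> f) y" if "f \<in> lie_poly" for f y
    using that
  proof (induction arbitrary: y)
    case (letter a)
    show ?case using ad_act_mon[OF nc, of "[a]"] nc by (simp add: mon_single)
  next
    case (br f g)
    have "ad_act \<sigma> (br f g) y = ad_act \<sigma> f (ad_act \<sigma> g y) - ad_act \<sigma> g (ad_act \<sigma> f y)"
      by (simp add: br_def ad_act_arg ad_act_mult[OF nc])
    then show ?case
      unfolding br.IH by (simp add: substitute_br[OF nc]) (simp add: br_def algebra_simps)
  qed (simp_all add: ad_act_arg substitute_add substitute_qscale br_add_left br_qscale)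
  have "ad_act \<sigma> f y - br (substitute \<sigma> f) y \<in> deg_closure {0}"
  proof (rule deg_closure_image[of "\<lambda>f. ad_act \<sigma> f y - br (substitute \<sigma> f) y"])
    show "clin (\<lambda>f. ad_act \<sigma> f y - br (substitute \<sigma> f) y)"
      by (intro clin_minusI clin_ad_act clin_br clin_substitute)
  qed (use f poly in \<open>auto simp: lie_series_def deg_closure_zero\<close>)
  then show ?thesis using closed_ideal_zero by (auto simp: closed_ideal_def)
qed

text \<open>When the iterated bracket of w with s is expanded, w s is the only word that ends in
  s.\<close>

lemma wcoeff_foldr_br_Some:
  "wcoeff (foldr (\<lambda>a. br (letter (Some a))) w (letter None)) (map Some v @ [None]) = (if w = v then 1 else 0)"
proof (induction w arbitrary: v)
  case (Cons a w)
  have "wcoeff (br (letter (Some a)) f) (map Some v @ [None]) = wcoeff (letter (Some a) * f) (map Some v @ [None])"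
    for f by (simp add: br_def wcoeff_mult_letter_snoc)
  then show ?case
    using Cons by (cases v) (auto simp: wcoeff_letter_mult)
qed simp

text \<open>Existence: on brackets the right quotient obeys f \<open>rquot i g\<close> - g
  \<open>rquot i f\<close>, the rule that a derivation into an adjoint action obeys. Uniqueness: the
  coefficients of words v s in the action on s return every coefficient of b.\<close>

lemma pd_eq_rquot:
  assumes "a \<in> lie_series"
  shows "pd i a = rquot i a"
  unfolding pd_def
proof (rule the_equality)
  let ?\<sigma> = "\<lambda>j. letter (Some j) :: sgn option series" and ?\<delta> = "\<lambda>j. if j = i then letter None else 0 :: sgn option series"
  let ?y = "letter None :: sgn option series"
  have nc: "nc ?\<sigma>" "nc ?\<delta>" by auto
  let ?F = "\<lambda>a. ad_act ?\<sigma> (rquot i a) ?y - der ?\<sigma> ?\<delta> a"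
  have "?F a \<in> {0}"
  proof (rule zero.twisted_derivation_in_ideal[of ?F "substitute ?\<sigma>" "substitute ?\<sigma>"])
    show "clin ?F" by (intro clin_minusI clin_comp[OF clin_ad_act] clin_rquot clin_der)
    show "lie_hom (substitute ?\<sigma>)" "lie_hom (substitute ?\<sigma>)" by (simp_all add: lie_hom_substitute)
    show "?F (br f g) = br (?F f) (substitute ?\<sigma> g) + br (substitute ?\<sigma> f) (?F g)"
      if fg: "f \<in> lie_series" "g \<in> lie_series" for f g
      unfolding rquot_br[OF fg] ad_act_arg ad_act_mult[OF nc(1)] ad_act_lie[OF nc(1) fg(1)]
        ad_act_lie[OF nc(1) fg(2)] der_br[OF nc] by (simp add: br_def algebra_simps)
    show "?F (letter l) \<in> {0}" for l
      using ad_act_mon[OF nc(1), of "[]" ?y] nc by (simp add: rquot_letter ad_act_arg)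
  qed (rule assms)
  then show "ad_act ?\<sigma> (rquot i a) ?y = der ?\<sigma> ?\<delta> a" by simp
  fix b
  assume b: "ad_act ?\<sigma> b ?y = der ?\<sigma> ?\<delta> a"
  have coeff: "wcoeff (ad_act ?\<sigma> b ?y) (map Some v @ [None]) = wcoeff b v" for b v
  proof -
    have "wcoeff (ad_act ?\<sigma> b ?y) (map Some v @ [None]) =
        (\<Sum>w | length w \<le> Suc (length v). if w = v then wcoeff b v else 0)"
      unfolding ad_act_wsumd wcoeff_wsumd by (rule sum.cong) (simp_all add: wcoeff_foldr_br_Some)
    also have "\<dots> = wcoeff b v" by (simp add: finite_words_le)
    finally show ?thesis .
  qed
  show "b = rquot i a"
    by (rule series_eqI) (metis coeff b \<open>ad_act ?\<sigma> (rquot i a) ?y = der ?\<sigma> ?\<delta> a\<close>)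
qed

subsection \<open>Cyclic words\<close>

definition comms :: "'a series set" where
  "comms = deg_closure (series.span {f * g - g * f |f g. True})"

lemma comms_span: "f \<in> series.span {f * g - g * f |f g. True} \<Longrightarrow> f \<in> comms"
  unfolding comms_def using deg_closure_subset by blast

lemma comms_comm: "f * g - g * f \<in> comms"
  by (intro comms_span series.span_base) auto

lemma comms_zero [simp]: "0 \<in> comms"
  by (intro comms_span series.span_zero)

lemma comms_add: "f \<in> comms \<Longrightarrow> g \<in> comms \<Longrightarrow> f + g \<in> comms"
  unfolding comms_def by (rule deg_closure_add) (auto intro: series.span_add)

lemma comms_image:
  fixes F :: "'a series \<Rightarrow> 'b series"
  assumes F: "clin F" and fg: "\<And>f g. F (f * g - g * f) \<in> comms" and a: "a \<in> comms"
  shows "F a \<in> comms"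
  unfolding comms_def
proof (rule deg_closure_image[OF F a[unfolded comms_def]])
  fix b :: "'a series" assume "b \<in> series.span {f * g - g * f |f g. True}"
  then show "F b \<in> deg_closure (series.span {f * g - g * f |f g. True})"
  proof (induction rule: series.span_induct_alt)
    case base
    then show ?case using comms_zero by (simp add: clin_zero[OF F] comms_def)
  next
    case (step c x y)
    have scale: "qscale c z \<in> comms" if "z \<in> comms" for z :: "'b series"
      unfolding comms_def by (rule deg_closure_image[of "qscale c", OF _ that[unfolded comms_def]])
        (auto intro: subsetD[OF deg_closure_subset] series.span_scale)
    have "F x \<in> comms" using step(1) fg by auto
    then show ?case
      using step(2) unfolding comms_def[symmetric] clin_add[OF F] clin_scale[OF F]
      by (intro comms_add scale)
  qed
qed

lemma comms_qscale: "f \<in> comms \<Longrightarrow> qscale c f \<in> comms"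
proof (rule comms_image[of "qscale c"])
  show "qscale c (f * g - g * f) \<in> comms" for f g :: "'a series"
    using comms_comm[of "qscale c f" g] by (simp add: qscale_diff qscale_mult_left qscale_mult_right)
qed auto

lemma comms_minus: "f \<in> comms \<Longrightarrow> - f \<in> comms"
  using comms_qscale[of f "-1"] by (simp add: qscale_minus_one)

lemma comms_diff: "f \<in> comms \<Longrightarrow> g \<in> comms \<Longrightarrow> f - g \<in> comms"
  using comms_add[of f "- g"] by (simp add: comms_minus)

lemma comms_sum: "(\<And>x. x \<in> A \<Longrightarrow> f x \<in> comms) \<Longrightarrow> sum f A \<in> comms"
  by (induction A rule: infinite_finite_induct) (auto intro: comms_add)

lemma comms_deriv: "nc \<delta> \<Longrightarrow> f \<in> comms \<Longrightarrow> deriv \<delta> f \<in> comms"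
proof (rule comms_image[OF clin_der])
  fix f g assume "nc \<delta>"
  then have "deriv \<delta> (f * g - g * f) = (deriv \<delta> f * g - g * deriv \<delta> f) + (f * deriv \<delta> g - deriv \<delta> g * f)"
    by (simp add: der_diff deriv_mult)
  then show "deriv \<delta> (f * g - g * f) \<in> comms" by (simp add: comms_add comms_comm)
qed

lemma cyc_eq_iff: "cyc a = cyc b \<longleftrightarrow> a - b \<in> comms"
proof
  assume "cyc a = cyc b"
  then have "a \<in> cyc b" by (metis (mono_tags, lifting) cyc_def comms_def comms_zero diff_self mem_Collect_eq)
  then show "a - b \<in> comms" by (simp add: cyc_def comms_def)
next
  assume ab: "a - b \<in> comms"
  have "c - a \<in> comms \<longleftrightarrow> c - b \<in> comms" for c
    using comms_add[OF _ ab, of "c - a"] comms_diff[OF _ ab, of "c - b"] by auto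
  then show "cyc a = cyc b" by (simp only: cyc_def comms_def[symmetric])
qed

subsection \<open>Power series in one series\<close>

lemma wcoeff_fps_eval: "wcoeff (fps_eval p f) v = (\<Sum>k\<le>length v. fps_nth p k * wcoeff (f ^ k) v)"
  by (simp add: fps_eval.rep_eq wcoeff_inverse)

lemma vanish_power: "wcoeff f [] = 0 \<Longrightarrow> vanish k (f ^ k)"
proof (induction k)
  case (Suc k)
  then have "vanish (Suc 0 + k) (f * f ^ k)" by (intro vanish_mult) (simp_all add: vanish_1_iff)
  then show ?case by simp
qed simp

lemma fps_eval_approx:
  assumes "wcoeff f [] = 0"
  shows "vanish n (fps_eval p f - (\<Sum>k<n. qscale (fps_nth p k) (f ^ k)))"
proof (rule vanishI)
  fix v :: "'a list" assume v: "length v < n"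
  have "(\<Sum>k<n. fps_nth p k * wcoeff (f ^ k) v) = (\<Sum>k\<le>length v. fps_nth p k * wcoeff (f ^ k) v)"
    by (rule sum.mono_neutral_right) (use v vanish_power[OF assms] in \<open>auto simp: vanish_def\<close>)
  then show "wcoeff (fps_eval p f - (\<Sum>k<n. qscale (fps_nth p k) (f ^ k))) v = 0"
    by (simp add: wcoeff_fps_eval wcoeff_sum)
qed

lemma vanish_all_0: "(\<And>n. vanish n f) \<Longrightarrow> f = 0"
  by (rule series_eqI) (metis lessI vanishD zero_series.rep_eq)

lemma fps_eval_add: "fps_eval (p + q) f = fps_eval p f + fps_eval q f"
  by (rule series_eqI) (simp add: wcoeff_fps_eval distrib_right sum.distrib)

lemma fps_eval_qscale: "fps_eval (fps_const c * p) f = qscale c (fps_eval p f)"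
  by (rule series_eqI) (simp add: wcoeff_fps_eval sum_distrib_left mult.assoc)

lemma fps_eval_zero: "fps_eval 0 f = 0"
  by (rule series_eqI) (simp add: wcoeff_fps_eval)

lemma deriv_fps_eval:
  assumes "nc \<delta>" "wcoeff f [] = 0" "deriv \<delta> f = 0"
  shows "deriv \<delta> (fps_eval p f) = 0"
proof (rule vanish_all_0)
  fix n
  have "deriv \<delta> (f ^ k) = 0" for k
    by (induction k) (simp_all add: assms deriv_mult)
  then have "deriv \<delta> (\<Sum>k<n. qscale (fps_nth p k) (f ^ k)) = 0"
    by (simp add: der_sum der_qscale)
  then show "vanish n (deriv \<delta> (fps_eval p f))"
    using vanish_der[OF fps_eval_approx[OF assms(2), of n p], of letter \<delta>] by (simp add: der_diff)
qed

subsection \<open>Derivations of the free Lie algebra\<close>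

abbreviation omega :: "sgn series" where
  "omega \<equiv> br (letter SPlus) (letter SMinus)"

lemma omega_Nil [simp]: "wcoeff omega [] = 0"
  by (simp add: br_def)

lemma deriv_add_field:
  assumes "nc \<delta>" "nc \<delta>'"
  shows "deriv (\<lambda>s. \<delta> s + \<delta>' s) f = deriv \<delta> f + deriv \<delta>' f"
  by (rule derivation_ext[where F = "deriv (\<lambda>s. \<delta> s + \<delta>' s)" and G = "\<lambda>f. deriv \<delta> f + deriv \<delta>' f" and S = "\<lambda>f. f"])
    (use assms in \<open>auto simp: deriv_mult algebra_simps\<close>)

lemma deriv_qscale_field:
  assumes "nc \<delta>"
  shows "deriv (\<lambda>s. qscale c (\<delta> s)) f = qscale c (deriv \<delta> f)"
  by (rule derivation_ext[where F = "deriv (\<lambda>s. qscale c (\<delta> s))" and G = "\<lambda>f. qscale c (deriv \<delta> f)" and S = "\<lambda>f. f"])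
    (use assms in \<open>auto simp: deriv_mult qscale_add qscale_mult_left qscale_mult_right\<close>)

lemma deriv_commutator:
  assumes "nc \<delta>" "nc \<delta>'"
  shows "deriv (\<lambda>s. deriv \<delta> (\<delta>' s) - deriv \<delta>' (\<delta> s)) f = deriv \<delta> (deriv \<delta>' f) - deriv \<delta>' (deriv \<delta> f)"
proof (rule derivation_ext[where F = "deriv (\<lambda>s. deriv \<delta> (\<delta>' s) - deriv \<delta>' (\<delta> s))"
      and G = "\<lambda>f. deriv \<delta> (deriv \<delta>' f) - deriv \<delta>' (deriv \<delta> f)" and S = "\<lambda>f. f"])
  show "clin (\<lambda>f. deriv \<delta> (deriv \<delta>' f) - deriv \<delta>' (deriv \<delta> f))"
    by (intro clin_minusI clin_derI clin_id)
qed (use assms in \<open>auto simp: deriv_mult der_add algebra_simps\<close>)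

lemma derivation_of_apply: "f \<in> lie_series \<Longrightarrow> derivation_of \<delta> f = deriv \<delta> f"
  by (simp add: derivation_of_def)

lemma derivation_of_Der_L:
  assumes "\<And>s. \<delta> s \<in> lie_series"
  shows "derivation_of \<delta> \<in> Der_L"
proof -
  have "nc \<delta>" by (intro nc_lie assms)
  moreover have out: "f \<notin> lie_series \<Longrightarrow> derivation_of \<delta> f = 0" for f by (simp add: derivation_of_def)
  moreover have "\<exists>m. \<forall>f\<in>lie_series. (\<forall>w. length w < m \<longrightarrow> wcoeff f w = 0) \<longrightarrow>
        (\<forall>w. length w < n \<longrightarrow> wcoeff (derivation_of \<delta> f) w = 0)" for n
    using vanish_der[of n _ letter \<delta>] by (intro exI[of _ n]) (auto simp: derivation_of_def vanish_def)
  ultimately show ?thesis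
    using assms unfolding Der_L_def
    by (simp add: derivation_of_apply deriv_br der_add der_qscale out)
qed

text \<open>The letters determine a derivation on Lie polynomials, and the continuity clause extends
  this to their closure.\<close>

lemma Der_L_eq_derivation_of:
  assumes u: "u \<in> Der_L"
  shows "\<And>s. u (letter s) \<in> lie_series" and "u = derivation_of (\<lambda>s. u (letter s))"
proof -
  let ?\<delta> = "\<lambda>s. u (letter s)"
  have lie: "u f \<in> lie_series" and u_add: "g \<in> lie_series \<Longrightarrow> u (f + g) = u f + u g"
    and u_scale: "u (qscale c f) = qscale c (u f)" and u_br: "g \<in> lie_series \<Longrightarrow> u (br f g) = br (u f) g + br f (u g)"
    if "f \<in> lie_series" for f g c
    using u that unfolding Der_L_def by auto
  have cont: "\<exists>m. \<forall>f\<in>lie_series. vanish m f \<longrightarrow> vanish n (u f)" for n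
    using u unfolding Der_L_def mem_Collect_eq vanish_def by (elim conjE) (erule spec)
  show \<delta>: "u (letter s) \<in> lie_series" for s by (simp add: lie)
  have nc: "nc ?\<delta>" by (intro nc_lie \<delta>)
  have poly: "u f = deriv ?\<delta> f" if "f \<in> lie_poly" for f
    using that
  proof induction
    case zero
    show ?case using u_scale[of 0 0] by simp
  next
    case (letter a)
    show ?case using nc by simp
  next
    case (add f g)
    then have "u (f + g) = u f + u g" by (intro u_add lie_poly_in_series)
    then show ?case using add.IH by (simp only: der_add)
  next
    case (scale f c)
    then have "u (qscale c f) = qscale c (u f)" by (intro u_scale lie_poly_in_series)
    then show ?case using scale.IH by (simp only: der_qscale)
  next
    case (br f g)
    then have "u (br f g) = br (u f) g + br f (u g)" by (intro u_br lie_poly_in_series)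
    then show ?case using br.IH by (simp only: deriv_br[OF nc])
  qed
  have main: "u f = deriv ?\<delta> f" if f: "f \<in> lie_series" for f
  proof -
    have "vanish n (u f - deriv ?\<delta> f)" for n
    proof -
      obtain m where m: "\<And>f. f \<in> lie_series \<Longrightarrow> vanish m f \<Longrightarrow> vanish n (u f)"
        using cont[of n] by blast
      obtain g where g: "g \<in> lie_poly" "vanish (max m n) (f - g)"
        using f unfolding lie_series_def by (rule deg_closureD)
      have gl: "g \<in> lie_series" using g(1) by (rule lie_poly_in_series)
      have "vanish n (u (f - g))" using g(2) f gl by (intro m) (auto intro: vanish_mono)
      moreover have "u (f - g) = u f - u g"
        using u_add[of f "qscale (-1) g"] u_scale[OF gl, of "-1"] f gl by (simp add: qscale_minus_one)
      moreover have "vanish n (deriv ?\<delta> (f - g))" using g(2) by (intro vanish_der) (auto intro: vanish_mono)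
      ultimately show ?thesis
        using vanish_diff[of n "u (f - g)" "deriv ?\<delta> (f - g)"] poly[OF g(1)] by (simp add: der_diff)
    qed
    then show ?thesis using vanish_all_0[of "u f - deriv ?\<delta> f"] by simp
  qed
  have out: "u f = 0" if "f \<notin> lie_series" for f using u that unfolding Der_L_def by auto
  show "u = derivation_of ?\<delta>"
  proof
    fix f show "u f = derivation_of ?\<delta> f"
    proof (cases "f \<in> lie_series")
      case True
      show ?thesis unfolding derivation_of_def if_P[OF True] by (rule main[OF True])
    next
      case False
      show ?thesis unfolding derivation_of_def if_not_P[OF False] by (rule out[OF False])
    qed
  qed
qed

section \<open>Divergence as a cocycle and the Lie algebra structure of \<open>krv11\<close>\<close>

definition div_rep :: "(sgn \<Rightarrow> sgn series) \<Rightarrow> sgn series" where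
  "div_rep \<delta> = (\<Sum>i\<in>UNIV. rquot i (\<delta> i))"

definition krv_fields :: "(sgn \<Rightarrow> sgn series) set" where
  "krv_fields = {\<delta>. (\<forall>s. \<delta> s \<in> lie_series) \<and> deriv \<delta> omega = 0 \<and> (\<exists>p. div_rep \<delta> - fps_eval p omega \<in> comms)}"

lemma krv_fields_nc: "\<delta> \<in> krv_fields \<Longrightarrow> nc \<delta>"
  unfolding krv_fields_def by (intro nc_lie) simp

lemma derivation_of_krv11:
  assumes "\<And>s. \<delta> s \<in> lie_series"
  shows "derivation_of \<delta> \<in> krv11 \<longleftrightarrow> \<delta> \<in> krv_fields"
proof -
  have nc: "nc \<delta>" by (intro nc_lie assms)
  have "divergence (derivation_of \<delta>) = cyc (div_rep \<delta>)"
    using assms nc by (simp add: divergence_def div_rep_def derivation_of_apply pd_eq_rquot)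
  then show ?thesis
    using assms derivation_of_Der_L[OF assms]
    by (simp add: krv11_def krv_fields_def cyc_eq_iff derivation_of_apply)
qed

lemma krv11_eq: "krv11 = derivation_of ` krv_fields"
proof
  show "krv11 \<subseteq> derivation_of ` krv_fields"
  proof
    fix u assume u: "u \<in> krv11"
    then have "u \<in> Der_L" by (simp add: krv11_def)
    note D = Der_L_eq_derivation_of[OF this]
    have "derivation_of (\<lambda>s. u (letter s)) \<in> krv11" using u by (simp only: D(2)[symmetric])
    then have "(\<lambda>s. u (letter s)) \<in> krv_fields" by (rule derivation_of_krv11[OF D(1), THEN iffD1])
    then have "derivation_of (\<lambda>s. u (letter s)) \<in> derivation_of ` krv_fields" by (rule imageI)
    then show "u \<in> derivation_of ` krv_fields" by (simp only: D(2)[symmetric])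
  qed
  show "derivation_of ` krv_fields \<subseteq> krv11"
    using derivation_of_krv11 by (force simp: krv_fields_def)
qed

text \<open>The chain rule for right quotients leaves quadratic cross terms, which pair up into
  commutators once the summation indices are exchanged.\<close>

lemma div_rep_commutator:
  assumes "nc \<delta>" "nc \<delta>'"
  shows "div_rep (\<lambda>s. deriv \<delta> (\<delta>' s) - deriv \<delta>' (\<delta> s)) - (deriv \<delta> (div_rep \<delta>') - deriv \<delta>' (div_rep \<delta>)) \<in> comms"
proof -
  have swap: "(\<Sum>i\<in>UNIV. \<Sum>j\<in>UNIV. rquot j (\<delta> i) * rquot i (\<delta>' j)) =
      (\<Sum>i\<in>UNIV. \<Sum>j\<in>UNIV. rquot i (\<delta> j) * rquot j (\<delta>' i))"
    by (rule sum.swap)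
  have "div_rep (\<lambda>s. deriv \<delta> (\<delta>' s) - deriv \<delta>' (\<delta> s)) - (deriv \<delta> (div_rep \<delta>') - deriv \<delta>' (div_rep \<delta>)) =
     (\<Sum>i\<in>UNIV. \<Sum>j\<in>UNIV. rquot j (\<delta>' i) * rquot i (\<delta> j)) - (\<Sum>i\<in>UNIV. \<Sum>j\<in>UNIV. rquot j (\<delta> i) * rquot i (\<delta>' j))"
    using assms by (simp add: div_rep_def rquot_arg rquot_deriv der_sum sum.distrib sum_subtractf)
  also have "\<dots> = (\<Sum>i\<in>UNIV. \<Sum>j\<in>UNIV. rquot j (\<delta>' i) * rquot i (\<delta> j) - rquot i (\<delta> j) * rquot j (\<delta>' i))"
    unfolding swap by (simp add: sum_subtractf)
  also have "\<dots> \<in> comms" by (intro comms_sum comms_comm)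
  finally show ?thesis .
qed

lemma krv_fields_zero: "(\<lambda>s. 0) \<in> krv_fields"
proof -
  have "deriv (\<lambda>s. 0) omega = 0" by (simp add: deriv_br)
  then show ?thesis
    by (auto simp: krv_fields_def div_rep_def rquot_arg intro!: exI[of _ 0] simp: fps_eval_zero)
qed

lemma krv_fields_add:
  assumes "\<delta> \<in> krv_fields" "\<delta>' \<in> krv_fields"
  shows "(\<lambda>s. \<delta> s + \<delta>' s) \<in> krv_fields"
proof -
  obtain p q where p: "div_rep \<delta> - fps_eval p omega \<in> comms" "div_rep \<delta>' - fps_eval q omega \<in> comms"
    using assms by (auto simp: krv_fields_def)
  have "div_rep (\<lambda>s. \<delta> s + \<delta>' s) - fps_eval (p + q) omega =
      (div_rep \<delta> - fps_eval p omega) + (div_rep \<delta>' - fps_eval q omega)"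
    by (simp add: div_rep_def rquot_arg sum.distrib fps_eval_add)
  then have "div_rep (\<lambda>s. \<delta> s + \<delta>' s) - fps_eval (p + q) omega \<in> comms"
    using p by (simp only: comms_add)
  then show ?thesis
    using assms deriv_add_field[OF krv_fields_nc krv_fields_nc, OF assms, of omega]
    by (auto simp: krv_fields_def)
qed

lemma krv_fields_qscale:
  assumes "\<delta> \<in> krv_fields"
  shows "(\<lambda>s. qscale c (\<delta> s)) \<in> krv_fields"
proof -
  obtain p where p: "div_rep \<delta> - fps_eval p omega \<in> comms"
    using assms by (auto simp: krv_fields_def)
  have "div_rep (\<lambda>s. qscale c (\<delta> s)) - fps_eval (fps_const c * p) omega = qscale c (div_rep \<delta> - fps_eval p omega)"
    by (simp add: div_rep_def rquot_arg fps_eval_qscale qscale_diff series.scale_sum_right)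
  then have "div_rep (\<lambda>s. qscale c (\<delta> s)) - fps_eval (fps_const c * p) omega \<in> comms"
    using p by (simp only: comms_qscale)
  then show ?thesis
    using assms deriv_qscale_field[OF krv_fields_nc, OF assms, of c omega]
    by (auto simp: krv_fields_def)
qed

text \<open>Each derivation kills every series in \<open>omega\<close>, so the cocycle property
  makes the divergence of a commutator zero as a cyclic word.\<close>

lemma krv_fields_commutator:
  assumes "\<delta> \<in> krv_fields" "\<delta>' \<in> krv_fields"
  shows "(\<lambda>s. deriv \<delta> (\<delta>' s) - deriv \<delta>' (\<delta> s)) \<in> krv_fields"
proof -
  note nc = krv_fields_nc[OF assms(1)] krv_fields_nc[OF assms(2)]
  have D: "deriv \<delta> (div_rep \<delta>') \<in> comms" if \<delta>: "\<delta> \<in> krv_fields" "\<delta>' \<in> krv_fields" for \<delta> \<delta>'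
  proof -
    have nc: "nc \<delta>" by (rule krv_fields_nc[OF \<delta>(1)])
    obtain p where p: "div_rep \<delta>' - fps_eval p omega \<in> comms" using \<delta> by (auto simp: krv_fields_def)
    have "deriv \<delta> (fps_eval p omega) = 0"
      using \<delta> nc by (intro deriv_fps_eval) (simp_all add: krv_fields_def)
    then show ?thesis using comms_deriv[OF nc p] by (simp add: der_diff)
  qed
  have "div_rep (\<lambda>s. deriv \<delta> (\<delta>' s) - deriv \<delta>' (\<delta> s)) - fps_eval 0 omega =
    (div_rep (\<lambda>s. deriv \<delta> (\<delta>' s) - deriv \<delta>' (\<delta> s)) - (deriv \<delta> (div_rep \<delta>') - deriv \<delta>' (div_rep \<delta>))) +
    (deriv \<delta> (div_rep \<delta>') - deriv \<delta>' (div_rep \<delta>))"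
    by (simp add: fps_eval_zero)
  also have "\<dots> \<in> comms"
    by (intro comms_add comms_diff div_rep_commutator nc D assms)
  finally have "div_rep (\<lambda>s. deriv \<delta> (\<delta>' s) - deriv \<delta>' (\<delta> s)) - fps_eval 0 omega \<in> comms" .
  moreover have "deriv (\<lambda>s. deriv \<delta> (\<delta>' s) - deriv \<delta>' (\<delta> s)) omega = 0"
    unfolding deriv_commutator[OF nc] using assms by (simp add: krv_fields_def)
  ultimately show ?thesis
    using assms by (auto simp: krv_fields_def)
qed

lemma derivation_of_add: "nc \<delta> \<Longrightarrow> nc \<delta>' \<Longrightarrow> derivation_of (\<lambda>s. \<delta> s + \<delta>' s) = derivation_of \<delta> + derivation_of \<delta>'"
  by (rule ext) (simp add: derivation_of_def deriv_add_field)

lemma derivation_of_scale: "nc \<delta> \<Longrightarrow> derivation_of (\<lambda>s. qscale c (\<delta> s)) = scale_Der c (derivation_of \<delta>)"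
  by (rule ext) (simp add: derivation_of_def deriv_qscale_field scale_Der_def)

lemma derivation_of_commutator:
  assumes "\<And>s. \<delta> s \<in> lie_series" "\<And>s. \<delta>' s \<in> lie_series"
  shows "derivation_of (\<lambda>s. deriv \<delta> (\<delta>' s) - deriv \<delta>' (\<delta> s)) = commutator (derivation_of \<delta>) (derivation_of \<delta>')"
  by (rule ext) (simp add: derivation_of_def commutator_def deriv_commutator assms nc_lie)

lemma vector_space_scale_Der: "vector_space scale_Der"
  by unfold_locales (simp_all add: scale_Der_def fun_eq_iff qscale_add series.scale_left_distrib)

lemma lie_algebra_krv11: "lie_algebra scale_Der krv11 commutator"
proof -
  interpret vector_space scale_Der by (rule vector_space_scale_Der)
  have lie: "\<delta> s \<in> lie_series" if "\<delta> \<in> krv_fields" for \<delta> s using that by (simp add: krv_fields_def)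
  have Der: "u f \<in> lie_series" "u (f + g) = u f + u g" "u (f - g) = u f - u g" "u (qscale c f) = qscale c (u f)"
    if "u \<in> krv11" "f \<in> lie_series" "g \<in> lie_series" for u f g c
    using that by (auto simp: krv11_eq derivation_of_apply der_add der_diff der_qscale lie)
  have out: "u f = 0" if "u \<in> krv11" "f \<notin> lie_series" for u f
    using that by (auto simp: krv11_eq derivation_of_def)
  have zero: "u 0 = 0" if "u \<in> krv11" for u
    using that by (auto simp: krv11_eq derivation_of_def)
  \<comment> \<open>Derivations are functions on all series that vanish outside the Lie series, so
    every identity is checked on both parts; outside, it needs \<open>u 0 = 0\<close>.\<close>
  have eqI: "F = G" if "\<And>f. f \<in> lie_series \<Longrightarrow> F f = G f" "\<And>f. f \<notin> lie_series \<Longrightarrow> F f = G f"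
    for F G :: "sgn series \<Rightarrow> sgn series" using that by blast
  have sub: "subspace krv11"
  proof (rule subspaceI)
    have "derivation_of (\<lambda>s. 0) = 0"
      using derivation_of_scale[of "\<lambda>s. 0" 0] by (simp add: scale_Der_def fun_eq_iff)
    then show "0 \<in> krv11" unfolding krv11_eq by (metis image_eqI krv_fields_zero)
    fix u v c
    assume "u \<in> krv11" "v \<in> krv11"
    then obtain \<delta> \<delta>' where \<delta>: "\<delta> \<in> krv_fields" "\<delta>' \<in> krv_fields" "u = derivation_of \<delta>" "v = derivation_of \<delta>'"
      by (auto simp: krv11_eq)
    show "u + v \<in> krv11"
      unfolding \<delta>(3,4) derivation_of_add[OF krv_fields_nc krv_fields_nc, OF \<delta>(1,2), symmetric] krv11_eq
      by (intro imageI krv_fields_add \<delta>)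
  next
    fix u c
    assume "u \<in> krv11"
    then obtain \<delta> where \<delta>: "\<delta> \<in> krv_fields" "u = derivation_of \<delta>" by (auto simp: krv11_eq)
    show "scale_Der c u \<in> krv11"
      unfolding \<delta>(2) derivation_of_scale[OF krv_fields_nc, OF \<delta>(1), symmetric] krv11_eq
      by (intro imageI krv_fields_qscale \<delta>)
  qed
  have closed: "commutator u v \<in> krv11" if "u \<in> krv11" "v \<in> krv11" for u v
  proof -
    from that obtain \<delta> \<delta>' where \<delta>: "\<delta> \<in> krv_fields" "\<delta>' \<in> krv_fields" "u = derivation_of \<delta>" "v = derivation_of \<delta>'"
      by (auto simp: krv11_eq)
    show ?thesis
      unfolding \<delta>(3,4) derivation_of_commutator[OF lie lie, OF \<delta>(1,2), symmetric] krv11_eq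
      by (intro imageI krv_fields_commutator \<delta>)
  qed
  show ?thesis
  proof unfold_locales
    fix x y z c assume x: "x \<in> krv11" and y: "y \<in> krv11"
    show "commutator (scale_Der c x) y = scale_Der c (commutator x y)"
      by (rule eqI) (simp_all add: commutator_def scale_Der_def x y Der out zero qscale_diff)
    show "commutator x (scale_Der c y) = scale_Der c (commutator x y)"
      by (rule eqI) (simp_all add: commutator_def scale_Der_def x y Der out zero qscale_diff)
    assume z: "z \<in> krv11"
    show "commutator (x + y) z = commutator x z + commutator y z"
      by (rule eqI) (simp_all add: commutator_def x y z Der out zero)
    show "commutator x (y + z) = commutator x y + commutator x z"
      by (rule eqI) (simp_all add: commutator_def x y z Der out zero)
    show "commutator x (commutator y z) + commutator y (commutator z x) + commutator z (commutator x y) = 0"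
      by (rule eqI) (simp_all add: commutator_def x y z Der out zero)
  qed (simp_all add: sub closed, simp add: commutator_def fun_eq_iff)
qed

section \<open>Derivations from elliptic Grothendieck--Teichmueller elements\<close>

subsection \<open>Forgetting the third strand\<close>

text \<open>With x_3 = 0 the sum relation forces x_2 = -x_1, hence t_12 = -[x_1^+, x_1^-], while all
  t_i3 vanish.\<close>

primrec forget3 :: "3 ell_gen \<Rightarrow> sgn series" where
  "forget3 (GX s i) = (if i = 1 then letter s else if i = 2 then - letter s else 0)"
| "forget3 (GT i j) = (if i = j \<or> i = 3 \<or> j = 3 then 0 else - omega)"

lemma forget3_lie [simp]: "forget3 x \<in> lie_series"
  by (cases x) simp_all

lemma forget3_nc [simp]: "nc forget3"
  by (intro nc_lie forget3_lie)

lemma sum_minus_3: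
  fixes f :: "3 \<Rightarrow> 'a::ab_group_add"
  shows "(\<Sum>j\<in>UNIV - {i}. f j) = f 1 + f 2 + f 3 - f i"
  by (simp add: sum_diff1 sum_3)

lemma forget3_ideal:
  assumes "f \<in> I3"
  shows "substitute forget3 f = 0"
proof -
  have "substitute forget3 f \<in> {0}"
  proof (rule zero.quot_substitute[OF _ _ assms])
    fix r :: "3 ell_gen series" assume "r \<in> ell_rels"
    then have "substitute forget3 r = 0"
    proof (cases rule: ell_rels_cases)
      case (3 s)
      then show ?thesis by (simp add: sum_3 substitute_add)
    next
      case (4 s i j)
      then show ?thesis using exhaust_3[of i] exhaust_3[of j]
        by (auto simp: substitute_br br_minus_left br_minus_right)
    next
      case (5 i j)
      then show ?thesis using exhaust_3[of i] exhaust_3[of j]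
        by (auto simp: substitute_br substitute_diff br_minus_left br_minus_right)
    next
      case (6 i)
      then show ?thesis using exhaust_3[of i]
        by (auto simp: substitute_br substitute_add substitute_diff sum_minus_3 br_minus_left br_minus_right)
    next
      case (7 s i j k)
      then show ?thesis using exhaust_3[of i] exhaust_3[of j] exhaust_3[of k]
        by (auto simp: substitute_br)
    next
      case (8 s i j)
      then show ?thesis using exhaust_3[of i] exhaust_3[of j]
        by (auto simp: substitute_br substitute_add)
    next
      case (9 i j k)
      then show ?thesis using exhaust_3[of i] exhaust_3[of j] exhaust_3[of k]
        by (auto simp: substitute_br substitute_add)
    qed (auto simp: substitute_diff)
    then show "substitute forget3 r \<in> {0}" by simp
  qed simp
  then show ?thesis by simp
qed

lemma substitute_zero_letters:
  fixes f :: "'a::finite series"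
  assumes "f \<in> lie_series"
  shows "substitute (\<lambda>a. 0 :: 'b::finite series) f = 0"
proof -
  have "substitute (\<lambda>a. 0 :: 'b series) f \<in> {0}"
    by (rule zero.twisted_derivation_in_ideal[of _ "substitute (\<lambda>a. 0)" "\<lambda>f. 0"])
      (use assms in \<open>auto simp: substitute_br lie_hom_def\<close>)
  then show ?thesis by simp
qed

text \<open>If one argument is 0 the two arguments commute, and a Lie series evaluated at commuting
  elements reduces to its linear part.\<close>

lemma ev_zero_arg:
  fixes a b :: "'b::finite series"
  assumes "\<psi> \<in> lie_series" "\<And>l. wcoeff \<psi> [l] = 0" "a \<in> lie_series" "b \<in> lie_series" "a = 0 \<or> b = 0"
  shows "ev \<psi> a b = 0"
proof -
  have "ev \<psi> (0 + a) (0 + b) - ev \<psi> 0 0 \<in> {0}"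
    by (rule zero.ev_central_shift) (use assms in auto)
  moreover have "case_ab 0 0 = (\<lambda>l. 0 :: 'b series)"
    by (auto split: ab.splits)
  then have "ev \<psi> 0 0 = (0 :: 'b series)"
    using substitute_zero_letters[OF assms(1)] by (simp add: ev_def)
  ultimately show ?thesis by simp
qed

context ell
begin

lemma forget3_ins:
  "substitute forget3 (ins 1 f) = f" "substitute forget3 (ins 2 f) = substitute (\<lambda>s. - letter s) f"
  "f \<in> lie_series \<Longrightarrow> substitute forget3 (ins 3 f) = 0"
  unfolding ins_def by (simp_all add: substitute_substitute substitute_letter_id substitute_zero_letters)

lemma forget3_psi3: "substitute forget3 (psi3 \<psi> 1 2 3) = 0" "substitute forget3 (psi3 \<psi> 2 1 3) = 0"
  unfolding psi3_def by (simp_all add: substitute_ev ev_zero_arg)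

lemma u_odd: "substitute (\<lambda>s. - letter s) (u s) = - u s"
proof -
  have "substitute forget3 (ell_xi \<psi> u s + ell_eta \<psi> u s + ins 3 (u s)) = 0"
    by (rule forget3_ideal[OF sum_rel])
  then have "u s + substitute (\<lambda>s. - letter s) (u s) = 0"
    by (simp add: ell_xi_def ell_eta_def substitute_add substitute_diff substitute_br forget3_ins forget3_psi3)
  then show ?thesis by (simp add: add_eq_0_iff)
qed

lemma u_omega: "deriv u omega = 0"
proof -
  have nc: "nc u" by (intro nc_lie u_lie)
  have "substitute forget3 (br (ell_xi \<psi> u SPlus) (gx SMinus 2) + br (gx SPlus 1) (ell_eta \<psi> u SMinus)) = 0"
    by (rule forget3_ideal[OF t_rel])
  then have "br (u SPlus) (- letter SMinus) + br (letter SPlus) (- u SMinus) = 0"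
    by (simp add: ell_xi_def ell_eta_def substitute_add substitute_diff substitute_br forget3_ins forget3_psi3 u_odd)
  then have "- (br (u SPlus) (letter SMinus) + br (letter SPlus) (u SMinus)) = 0"
    by (simp add: br_minus_right)
  then show ?thesis using nc by (simp only: deriv_br[OF nc] der_letter[OF nc_letter nc] neg_equal_0_iff_equal)
qed

end

subsection \<open>A matrix representation\<close>

text \<open>The quotient of \<open>\<tt>\<^bsub>1,3\<^esub>\<close> by the commutator subalgebra of the ideal of \<open>t\<^sub>1\<^sub>2\<close> is an extension of two
  commuting copies of the free Lie algebra (generated by the \<open>x\<^sub>1\<close> and the \<open>x\<^sub>2\<close>) by a bimodule \<open>T t\<^sub>1\<^sub>2\<close>.
  It acts by \<open>4 \<times> 4\<close> matrices over \<open>T\<close>, in which \<open>t\<^sub>1\<^sub>2\<close> is the elementary matrix in the upper right corner.\<close>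

datatype st = SL | SM sgn | SR

lemma UNIV_st: "(UNIV :: st set) = {SL, SM SPlus, SM SMinus, SR}"
  by (auto, metis st.exhaust sgn.exhaust)

instance st :: finite
  by standard (simp add: UNIV_st)

lemma sum_st: "(\<Sum>j\<in>UNIV. f j) = f SL + f (SM SPlus) + f (SM SMinus) + f SR"
  for f :: "st \<Rightarrow> 'a::ab_group_add"
  by (simp add: UNIV_st add.assoc)

fun eps :: "sgn \<Rightarrow> sgn \<Rightarrow> rat" where
  "eps SPlus SMinus = 1"
| "eps SMinus SPlus = - 1"
| "eps _ _ = 0"

text \<open>The row into the middle block makes a word in the x_1 act by its right quotients.
  Dually, \<open>mx2\<close> pairs the first letter of a word in the x_2 with the middle index by
  \<open>eps\<close>, so [x_1^+, x_2^-] is the upper right elementary matrix.\<close>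

fun mx1 :: "sgn \<Rightarrow> st \<Rightarrow> st \<Rightarrow> sgn series" where
  "mx1 s SL SL = letter s"
| "mx1 s SL (SM t) = (if s = t then 1 else 0)"
| "mx1 s _ _ = 0"

fun mx2 :: "sgn \<Rightarrow> st \<Rightarrow> st \<Rightarrow> sgn series" where
  "mx2 s SR SR = letter s"
| "mx2 s (SM t) SR = qscale (eps t s) 1"
| "mx2 s _ _ = 0"

fun mt12 :: "st \<Rightarrow> st \<Rightarrow> sgn series" where
  "mt12 SL SR = 1"
| "mt12 _ _ = 0"

text \<open>Forced by t_13 = [x_1^+, x_3^-] with x_3 = -x_1 - x_2, that is -[x_1^+, x_1^-] - t_12.
  In the same way \<open>mt23\<close> is -[x_2^+, x_2^-] - t_12.\<close>

fun mt13 :: "st \<Rightarrow> st \<Rightarrow> sgn series" where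
  "mt13 SL SL = - omega"
| "mt13 SL (SM SPlus) = letter SMinus"
| "mt13 SL (SM SMinus) = - letter SPlus"
| "mt13 SL SR = - 1"
| "mt13 _ _ = 0"

fun mt23 :: "st \<Rightarrow> st \<Rightarrow> sgn series" where
  "mt23 SR SR = - omega"
| "mt23 (SM SPlus) SR = letter SPlus"
| "mt23 (SM SMinus) SR = letter SMinus"
| "mt23 SL SR = - 1"
| "mt23 _ _ = 0"

primrec mgen :: "3 ell_gen \<Rightarrow> st \<Rightarrow> st \<Rightarrow> sgn series" where
  "mgen (GX s i) p q = (if i = 1 then mx1 s p q else if i = 2 then mx2 s p q else - mx1 s p q - mx2 s p q)"
| "mgen (GT i j) p q = (if i = j then 0 else if i \<noteq> 3 \<and> j \<noteq> 3 then mt12 p q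
     else if i \<noteq> 2 \<and> j \<noteq> 2 then mt13 p q else mt23 p q)"

primrec mword :: "3 ell_gen list \<Rightarrow> st \<Rightarrow> st \<Rightarrow> sgn series" where
  "mword [] p q = (if p = q then 1 else 0)"
| "mword (a # w) p q = (\<Sum>j\<in>UNIV. mgen a p j * mword w j q)"

text \<open>The bound 2 is the largest possible loss of degree: a path from \<open>SL\<close> to
  \<open>SR\<close> may use two entries of degree zero.\<close>

definition mrep :: "3 ell_gen series \<Rightarrow> st \<Rightarrow> st \<Rightarrow> sgn series" where
  "mrep f p q = wsumd 2 f (\<lambda>w. mword w p q)"

text \<open>The entries of degree zero lie strictly above the diagonal blocks, so \<open>mgen\<close> raises the degree once that
  is shifted by these weights.\<close>

primrec wt :: "st \<Rightarrow> nat" where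
  "wt SL = 0" | "wt (SM _) = 1" | "wt SR = 2"

lemma st_cases:
  obtains "p = SL" | "p = SM SPlus" | "p = SM SMinus" | "p = SR"
  by (metis st.exhaust sgn.exhaust)

lemma vanish_mgen: "vanish (1 + wt p - wt q) (mgen a p q)"
proof -
  have "vanish (1 + wt p - wt q) (mx1 s p q)" "vanish (1 + wt p - wt q) (mx2 s p q)"
    "vanish (1 + wt p - wt q) (mt12 p q)" "vanish (1 + wt p - wt q) (mt13 p q)"
    "vanish (1 + wt p - wt q) (mt23 p q)" for s
    by (cases p rule: st_cases; cases q rule: st_cases; simp add: vanish_1_iff)+
  then show ?thesis by (cases a) (simp_all add: vanish_diff vanish_uminus)
qed

lemma vanish_sum: "(\<And>x. x \<in> A \<Longrightarrow> vanish n (f x)) \<Longrightarrow> vanish n (sum f A)"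
  by (induction A rule: infinite_finite_induct) (auto intro: vanish_add)

lemma vanish_mword: "vanish (length w + wt p - wt q) (mword w p q)"
proof (induction w arbitrary: p)
  case (Cons a w)
  show ?case
    unfolding mword.simps
  proof (rule vanish_sum)
    fix j
    have "vanish ((1 + wt p - wt j) + (length w + wt j - wt q)) (mgen a p j * mword w j q)"
      by (intro vanish_mult vanish_mgen Cons)
    then show "vanish (length (a # w) + wt p - wt q) (mgen a p j * mword w j q)"
      by (rule vanish_mono) simp
  qed
qed simp

lemma vanish_mword': "vanish (length w - 2) (mword w p q)"
  by (rule vanish_mono[OF vanish_mword]) (cases q; simp)

lemma clin_mrep: "clin (\<lambda>f. mrep f p q)"
  unfolding mrep_def by (rule clin_wsumd)

lemmas mrep_arg = clin_add[OF clin_mrep] clin_diff[OF clin_mrep] clin_zero[OF clin_mrep]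
  clin_scale[OF clin_mrep] clin_sum[OF clin_mrep]

lemma mrep_mon: "mrep (mon w) p q = mword w p q"
  unfolding mrep_def by (rule wsumd_mon[OF vanish_mword'])

lemma mword_append: "mword (u @ v) p q = (\<Sum>j\<in>UNIV. mword u p j * mword v j q)"
proof (induction u arbitrary: p)
  case Nil
  have "(\<Sum>j\<in>UNIV. mword [] p j * mword v j q) = (\<Sum>j\<in>UNIV. if p = j then mword v j q else 0)"
    by (rule sum.cong) auto
  then show ?case by simp
next
  case (Cons a u)
  have "(\<Sum>j\<in>UNIV. mgen a p j * (\<Sum>k\<in>UNIV. mword u j k * mword v k q)) =
      (\<Sum>k\<in>UNIV. (\<Sum>j\<in>UNIV. mgen a p j * mword u j k) * mword v k q)"
    unfolding sum_distrib_left sum_distrib_right by (subst sum.swap) (simp add: mult.assoc)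
  then show ?case by (simp add: Cons)
qed

lemma mword_single: "mword [a] p q = mgen a p q"
proof -
  have "mword [a] p q = (\<Sum>j\<in>UNIV. if j = q then mgen a p j else 0)"
    unfolding mword.simps by (rule sum.cong) auto
  then show ?thesis by simp
qed

lemma mrep_letter: "mrep (letter a) p q = mgen a p q"
  using mrep_mon[of "[a]"] by (simp only: mon_single mword_single)

lemma mrep_mult: "mrep (f * g) p q = (\<Sum>j\<in>UNIV. mrep f p j * mrep g j q)"
proof (rule bilinear_ext[of "\<lambda>f g. mrep (f * g) p q" "\<lambda>f g. \<Sum>j\<in>UNIV. mrep f p j * mrep g j q"])
  show "clin (\<lambda>f. mrep (f * g) p q)" "clin (\<lambda>g. mrep (f * g) p q)" for f g
    by (intro clin_comp[OF clin_mrep] clin_mult_left clin_mult_right clin_id)+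
  show "clin (\<lambda>f. \<Sum>j\<in>UNIV. mrep f p j * mrep g j q)" "clin (\<lambda>g. \<Sum>j\<in>UNIV. mrep f p j * mrep g j q)" for f g
    by (intro clin_sumI clin_mult_left clin_mult_right clin_mrep)+
qed (simp add: mon_mult mrep_mon mword_append)

lemma mrep_br: "mrep (br f g) p q = (\<Sum>j\<in>UNIV. mrep f p j * mrep g j q) - (\<Sum>j\<in>UNIV. mrep g p j * mrep f j q)"
  by (simp add: br_def mrep_arg mrep_mult)

lemma mrep_rel:
  assumes "r \<in> ell_rels"
  shows "mrep r p q = 0"
  using assms
proof (cases rule: ell_rels_cases)
  case (1 i)
  then show ?thesis by (simp add: mrep_letter)
next
  case (2 i j)
  then show ?thesis by (simp add: mrep_arg mrep_letter)
next
  case (3 s)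
  then show ?thesis by (simp add: sum_3 mrep_arg mrep_letter)
next
  case (4 s i j)
  show ?thesis
    unfolding 4(2) mrep_br mrep_letter sum_st
    using 4(1) exhaust_3[of i] exhaust_3[of j]
    by (elim disjE; cases p rule: st_cases; cases q rule: st_cases; cases s)
      (simp_all add: algebra_simps qscale_mult_left qscale_mult_right qscale_minus_one)
next
  case (5 i j)
  show ?thesis
    unfolding 5(2) mrep_arg mrep_br mrep_letter sum_st
    using 5(1) exhaust_3[of i] exhaust_3[of j]
    by (elim disjE; cases p rule: st_cases; cases q rule: st_cases)
      (simp_all add: br_def algebra_simps qscale_mult_left qscale_mult_right qscale_minus_one)
next
  case (6 i)
  show ?thesis
    unfolding 6 sum_minus_3 mrep_arg mrep_br mrep_letter sum_st
    using exhaust_3[of i]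
    by (elim disjE; cases p rule: st_cases; cases q rule: st_cases)
      (simp_all add: br_def algebra_simps qscale_mult_left qscale_mult_right qscale_minus_one)
next
  case (7 s i j k)
  show ?thesis
    unfolding 7(2) mrep_br mrep_letter sum_st
    using 7(1) exhaust_3[of i] exhaust_3[of j] exhaust_3[of k]
    by (elim disjE; cases p rule: st_cases; cases q rule: st_cases; cases s)
      (simp_all add: br_def algebra_simps qscale_mult_left qscale_mult_right qscale_minus_one)
next
  case (8 s i j)
  show ?thesis
    unfolding 8(2) mrep_br mrep_arg mrep_letter sum_st
    using 8(1) exhaust_3[of i] exhaust_3[of j]
    by (elim disjE; cases p rule: st_cases; cases q rule: st_cases; cases s)
      (simp_all add: br_def algebra_simps qscale_mult_left qscale_mult_right qscale_minus_one)
next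
  case (9 i j k)
  show ?thesis
    unfolding 9(2) mrep_br mrep_arg mrep_letter sum_st
    using 9(1) exhaust_3[of i] exhaust_3[of j] exhaust_3[of k]
    by (elim disjE; cases p rule: st_cases; cases q rule: st_cases)
      (simp_all add: br_def algebra_simps)
qed

lemma mrep_ideal:
  assumes "f \<in> I3"
  shows "mrep f p q = 0"
proof -
  have "\<forall>p q. mrep g p q = 0" if "g \<in> lie_ideal ell_rels" for g
    using that by induction (simp_all add: mrep_rel mrep_arg mrep_br)
  then have "mrep f p q \<in> {0}"
    by (intro zero.ideal_image[OF clin_mrep assms[unfolded quot_def]]) simp
  then show ?thesis by simp
qed

lemma mrep_substitute:
  fixes g :: "'a::finite \<Rightarrow> 3 ell_gen"
  shows "mrep (substitute (\<lambda>l. letter (g l)) f) p q = wsumd 2 f (\<lambda>w. mword (map g w) p q)"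
proof (rule clin_ext[of "\<lambda>f. mrep (substitute (\<lambda>l. letter (g l)) f) p q"])
  show "clin (\<lambda>f. mrep (substitute (\<lambda>l. letter (g l)) f) p q)"
    by (intro clin_comp[OF clin_mrep] clin_substitute)
  fix w
  have "prod_list (map (\<lambda>l. letter (g l)) w) = mon (map g w)"
    using prod_list_letter[of "map g w"] by (simp add: comp_def)
  then show "mrep (substitute (\<lambda>l. letter (g l)) (mon w)) p q = wsumd 2 (mon w) (\<lambda>w. mword (map g w) p q)"
    using vanish_mword'[of "map g w" p q] by (simp add: substitute_mon mrep_mon wsumd_mon)
qed (rule clin_wsumd)

subsection \<open>The upper right matrix entry\<close>

text \<open>The index k is the gap of v in which the contracted pair stood.\<close>

definition contract :: "sgn series \<Rightarrow> sgn list \<Rightarrow> rat" where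
  "contract f v = (\<Sum>k\<le>length v. \<Sum>i\<in>UNIV. \<Sum>j\<in>UNIV. eps i j * wcoeff f (take k v @ [i, j] @ drop k v))"

lemma mword_x3_SR: "mword (map (\<lambda>s. GX s 3) w) SR SR = qscale ((- 1) ^ length w) (mon w)"
proof (induction w)
  case (Cons a w)
  then show ?case
    by (simp add: sum_st qscale_mult_right letter_mult_mon)
qed simp

lemma mword_x3_SM:
  "wcoeff (mword (map (\<lambda>s. GX s 3) w) (SM t) SR) v =
    - ((- 1) ^ length v) * (\<Sum>j\<in>UNIV. eps t j * (if w = j # v then 1 else 0))"
proof (cases w)
  case (Cons b u)
  have "wcoeff (mword (map (\<lambda>s. GX s 3) w) (SM t) SR) v = - (eps t b * ((- 1) ^ length u * (if v = u then 1 else 0)))"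
    by (cases t; simp add: Cons sum_st mword_x3_SR qscale_mult_left del: wcoeff_mon) (simp_all add: Cons)
  also have "\<dots> = - ((- 1) ^ length v) * (\<Sum>j\<in>UNIV. if j = b then eps t b * (if u = v then 1 else 0) else 0)"
    by simp
  also have "(\<Sum>j\<in>UNIV. if j = b then eps t b * (if u = v then 1 else 0) else 0) =
      (\<Sum>j\<in>UNIV. eps t j * (if w = j # v then 1 else 0))"
    by (rule sum.cong) (auto simp: Cons)
  finally show ?thesis .
qed simp

text \<open>The middle block has no diagonal entries, so a path from \<open>SL\<close> to
  \<open>SR\<close> crosses it with two consecutive letters, which get contracted. Each letter of
  x_3 = -x_1 - x_2 carries a sign; the two signs of the contracted pair cancel.\<close>

lemma mword_x3_SL:
  "wcoeff (mword (map (\<lambda>s. GX s 3) w) SL SR) v = (- 1) ^ length v *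
    (\<Sum>k\<le>length v. \<Sum>i\<in>UNIV. \<Sum>j\<in>UNIV. eps i j * (if w = take k v @ [i, j] @ drop k v then 1 else 0))"
proof (induction w arbitrary: v)
  case (Cons a w)
  let ?Q = "\<lambda>w v. \<Sum>k\<le>length v. \<Sum>i\<in>UNIV. \<Sum>j\<in>UNIV. eps i j * (if w = take k v @ [i, j] @ drop k v then 1 else (0::rat))"
  have "wcoeff (mword (map (\<lambda>s. GX s 3) (a # w)) SL SR) v =
      - wcoeff (letter a * mword (map (\<lambda>s. GX s 3) w) SL SR) v - wcoeff (mword (map (\<lambda>s. GX s 3) w) (SM a) SR) v"
    by (cases a) (simp_all add: sum_st)
  also have "wcoeff (mword (map (\<lambda>s. GX s 3) w) (SM a) SR) v =
      - ((- 1) ^ length v) * (\<Sum>j\<in>UNIV. eps a j * (if w = j # v then 1 else 0))"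
    by (rule mword_x3_SM)
  also have "(\<Sum>j\<in>UNIV. eps a j * (if w = j # v then 1 else 0)) =
      (\<Sum>i\<in>UNIV. \<Sum>j\<in>UNIV. eps i j * (if a # w = [i, j] @ v then 1 else 0))"
    by (cases a) (simp_all add: UNIV_sgn)
  finally have 1: "wcoeff (mword (map (\<lambda>s. GX s 3) (a # w)) SL SR) v =
      - wcoeff (letter a * mword (map (\<lambda>s. GX s 3) w) SL SR) v +
      (- 1) ^ length v * (\<Sum>i\<in>UNIV. \<Sum>j\<in>UNIV. eps i j * (if a # w = [i, j] @ v then 1 else 0))"
    by simp
  show ?case
  proof (cases v)
    case Nil
    then show ?thesis unfolding 1 by (simp add: wcoeff_letter_mult)
  next
    case (Cons b v')
    have Q: "?Q (a # w) (b # v') = (\<Sum>i\<in>UNIV. \<Sum>j\<in>UNIV. eps i j * (if a # w = [i, j] @ b # v' then 1 else 0)) +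
        (if a = b then ?Q w v' else 0)"
      unfolding sum_take_drop_Cons[where h = "\<lambda>p q. \<Sum>i\<in>UNIV. \<Sum>j\<in>UNIV. eps i j * (if a # w = p @ [i, j] @ q then 1 else (0::rat))"]
      by simp
    show ?thesis
      unfolding 1 unfolding Cons unfolding Q using Cons.IH[of v'] by (simp add: wcoeff_letter_mult algebra_simps)
  qed
qed (simp add: sum.neutral)

lemma mrep_ins3: "wcoeff (mrep (ins 3 f) SL SR) v = (- 1) ^ length v * contract f v"
proof -
  let ?W = "{w :: sgn list. length w \<le> length v + 2}"
  have "wcoeff (mrep (ins 3 f) SL SR) v = (\<Sum>w\<in>?W. wcoeff f w * wcoeff (mword (map (\<lambda>s. GX s 3) w) SL SR) v)"
    unfolding ins_def mrep_substitute[of "\<lambda>s. GX s 3"] wcoeff_wsumd ..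
  also have "\<dots> = (\<Sum>w\<in>?W. \<Sum>k\<le>length v. \<Sum>i\<in>UNIV. \<Sum>j\<in>UNIV.
      (- 1) ^ length v * eps i j * (if w = take k v @ [i, j] @ drop k v then wcoeff f w else 0))"
    unfolding mword_x3_SL sum_distrib_left by (intro sum.cong refl) simp
  also have "\<dots> = (\<Sum>k\<le>length v. \<Sum>i\<in>UNIV. \<Sum>j\<in>UNIV. \<Sum>w\<in>?W.
      (- 1) ^ length v * eps i j * (if w = take k v @ [i, j] @ drop k v then wcoeff f w else 0))"
    by (subst sum.swap, intro sum.cong refl, subst sum.swap, intro sum.cong refl, subst sum.swap) (rule refl)
  also have "\<dots> = (- 1) ^ length v * contract f v"
    unfolding contract_def sum_distrib_left
  proof (intro sum.cong refl)
    fix k i j assume "k \<in> {..length v}"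
    let ?u = "take k v @ [i, j] @ drop k v"
    have u: "?u \<in> ?W" by simp
    have "(\<Sum>w\<in>?W. (- 1) ^ length v * eps i j * (if w = ?u then wcoeff f w else 0)) =
        (- 1) ^ length v * eps i j * (\<Sum>w\<in>?W. if w = ?u then wcoeff f ?u else 0)"
      unfolding sum_distrib_left by (intro sum.cong) auto
    also have "(\<Sum>w\<in>?W. if w = ?u then wcoeff f ?u else 0) = wcoeff f ?u"
      using u by (simp only: sum.delta finite_words_le if_True)
    finally show "(\<Sum>w\<in>?W. (- 1) ^ length v * eps i j * (if w = ?u then wcoeff f w else 0)) =
        (- 1) ^ length v * (eps i j * wcoeff f ?u)"
      by (simp only: mult.assoc)
  qed
  finally show ?thesis .
qed

text \<open>Letters x_1 alone never leave the middle block, and letters x_2 alone never leave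
  \<open>SL\<close>.\<close>

lemma mrep_ins_1_2: "mrep (ins 1 f) SL SR = 0" "mrep (ins 2 f) SL SR = 0"
proof -
  have 1: "mword (map (\<lambda>s. GX s 1) w) SL SR = 0" for w :: "sgn list"
  proof -
    have *: "mword (map (\<lambda>s. GX s 1) w) (SM t) SR = 0" for w :: "sgn list" and t
      by (cases w) (simp_all add: sum_st)
    show ?thesis by (induction w) (simp_all add: sum_st *)
  qed
  have 2: "mword (map (\<lambda>s. GX s 2) w) SL SR = 0" for w :: "sgn list"
    by (cases w) (simp_all add: sum_st)
  have "wcoeff (mrep (ins i f) SL SR) v = 0" if "\<And>w :: sgn list. mword (map (\<lambda>s. GX s i) w) SL SR = 0" for i v
    unfolding ins_def mrep_substitute[of "\<lambda>s. GX s i"] wcoeff_wsumd that by simp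
  then show "mrep (ins 1 f) SL SR = 0" "mrep (ins 2 f) SL SR = 0"
    using 1 2 by (auto intro!: series_eqI)
qed

text \<open>All factors of a power of one letter are again its powers, so the coefficient in f g is
  symmetric in f and g and cancels in the bracket.\<close>

lemma lie_poly_power_letter:
  assumes "f \<in> lie_poly" "n \<ge> 2"
  shows "wcoeff f (replicate n x) = 0"
  using assms(1)
proof induction
  case (letter a)
  then show ?case using assms(2) by (cases n) auto
next
  case (br f g)
  have "wcoeff (f * g) (replicate n x) = (\<Sum>i\<le>n. wcoeff f (replicate i x) * wcoeff g (replicate (n - i) x))" for f g
    unfolding wcoeff_mult by (simp add: min_def)
  moreover have "(\<Sum>i\<le>n. wcoeff f (replicate i x) * wcoeff g (replicate (n - i) x)) =
      (\<Sum>i\<le>n. wcoeff g (replicate i x) * wcoeff f (replicate (n - i) x))"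
    by (rule sum.reindex_bij_witness[of _ "\<lambda>i. n - i" "\<lambda>i. n - i"]) auto
  ultimately show ?case by (simp add: br_def)
qed simp_all

lemma lie_series_power_letter:
  assumes "f \<in> lie_series" "wcoeff f [x] = 0"
  shows "wcoeff f (replicate n x) = 0"
proof -
  consider "n = 0" | "n = 1" | "n \<ge> 2" by linarith
  then show ?thesis
  proof cases
    case 3
    obtain g where "g \<in> lie_poly" "vanish (Suc n) (f - g)"
      using assms(1) unfolding lie_series_def by (rule deg_closureD)
    then show ?thesis using lie_poly_power_letter[OF _ 3, of g x] by (simp add: vanish_def)
  qed (use assms in \<open>simp_all add: lie_series_Nil\<close>)
qed

lemma power_minus_omega: "(- omega) ^ k = qscale ((- 1) ^ k) (omega ^ k)"
  by (induction k) (simp_all add: qscale_mult_right)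

lemma wsumd_omega_powers:
  fixes word :: "nat \<Rightarrow> ab list" and F :: "ab list \<Rightarrow> sgn series"
  assumes len: "\<And>k. length (word k) = Suc k" and F: "\<And>k. F (word k) = (- omega) ^ k"
    and other: "\<And>w. wcoeff \<psi> w \<noteq> 0 \<Longrightarrow> F w \<noteq> 0 \<Longrightarrow> \<exists>k. w = word k"
  shows "wsumd 2 \<psi> F = fps_eval (Abs_fps (\<lambda>k. (- 1) ^ k * wcoeff \<psi> (word k))) omega"
proof (rule series_eqI)
  fix v :: "sgn list"
  let ?W = "{w :: ab list. length w \<le> length v + 2}"
  have inj: "inj_on word A" for A by (rule inj_onI) (metis len nat.inject)
  have "wcoeff (wsumd 2 \<psi> F) v = (\<Sum>w\<in>word ` {..length v + 1}. wcoeff \<psi> w * wcoeff (F w) v)"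
    unfolding wcoeff_wsumd
  proof (rule sum.mono_neutral_right)
    show "\<forall>w\<in>?W - word ` {..length v + 1}. wcoeff \<psi> w * wcoeff (F w) v = 0"
    proof (intro ballI, rule ccontr)
      fix w assume w: "w \<in> ?W - word ` {..length v + 1}" and "wcoeff \<psi> w * wcoeff (F w) v \<noteq> 0"
      then have "wcoeff \<psi> w \<noteq> 0" "F w \<noteq> 0" by auto
      then obtain k where "w = word k" using other by blast
      then show False using w by (auto simp: len)
    qed
  qed (auto simp: finite_words_le len)
  also have "\<dots> = (\<Sum>k\<le>length v + 1. (- 1) ^ k * wcoeff \<psi> (word k) * wcoeff (omega ^ k) v)"
    by (subst sum.reindex[OF inj]) (simp add: F power_minus_omega mult_ac)
  \<comment> \<open>Words of length at most \<open>length v + 2\<close> allow k up to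
    \<open>length v + 1\<close>, but that last power of \<open>omega\<close> starts beyond
    v.\<close>
  also have "\<dots> = (\<Sum>k\<le>length v. (- 1) ^ k * wcoeff \<psi> (word k) * wcoeff (omega ^ k) v)"
    using vanish_power[OF omega_Nil, of "length v + 1"] by (simp add: vanish_def)
  finally show "wcoeff (wsumd 2 \<psi> F) v =
      wcoeff (fps_eval (Abs_fps (\<lambda>k. (- 1) ^ k * wcoeff \<psi> (word k))) omega) v"
    by (simp add: wcoeff_fps_eval)
qed

text \<open>A path ending in \<open>SR\<close> is there after one letter, and at \<open>SR\<close>
  the matrix of t_12 is zero while t_23 acts by -\<open>omega\<close>.\<close>

lemma mword_t12_t23:
  fixes w :: "ab list"
  defines "m \<equiv> \<lambda>w :: ab list. mword (map (case_ab (GT 1 2) (GT 2 3)) w)"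
  shows "m w SR SR = (if w = replicate (length w) LB then (- omega) ^ length w else 0)"
    and "m (l # w) SL SR = (if l = LA then m w SR SR else - m w SR SR)"
    and "m (l # w) (SM t) SR = (if l = LA then 0 else mt23 (SM t) SR * m w SR SR)"
proof -
  show "m w SR SR = (if w = replicate (length w) LB then (- omega) ^ length w else 0)"
  proof (induction w)
    case (Cons l w)
    then show ?case by (cases l) (simp_all add: m_def sum_st)
  qed (simp add: m_def)
  show "m (l # w) SL SR = (if l = LA then m w SR SR else - m w SR SR)"
    "m (l # w) (SM t) SR = (if l = LA then 0 else mt23 (SM t) SR * m w SR SR)"
    by (cases l; cases t; simp add: m_def sum_st)+
qed

text \<open>Mirror image: a path that starts at \<open>SL\<close> stays there until its last letter,
  with t_13 acting by -\<open>omega\<close>.\<close>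

lemma mword_t21_t13:
  fixes w :: "ab list"
  defines "m \<equiv> \<lambda>w :: ab list. mword (map (case_ab (GT 2 1) (GT 1 3)) w)"
  shows "m w SL SL = (if w = replicate (length w) LB then (- omega) ^ length w else 0)"
    and "m (w @ [l]) SL SR = (if l = LA then m w SL SL else - m w SL SL)"
    and "m (w @ [l]) SL (SM t) = (if l = LA then 0 else m w SL SL * mt13 SL (SM t))"
proof -
  have 0: "m w (SM t) SL = 0" "m w SR SL = 0" for w t
    by (cases w; (cases "hd w")?; cases t; simp add: m_def sum_st)+
  show "m w SL SL = (if w = replicate (length w) LB then (- omega) ^ length w else 0)"
  proof (induction w)
    case (Cons l w)
    then show ?case using 0 by (cases l) (simp_all add: m_def sum_st)
  qed (simp add: m_def)
  show "m (w @ [l]) SL SR = (if l = LA then m w SL SL else - m w SL SL)"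
    "m (w @ [l]) SL (SM t) = (if l = LA then 0 else m w SL SL * mt13 SL (SM t))"
    unfolding m_def map_append list.map mword_append mword_single sum_st by (cases l; cases t; simp)+
qed

context ell
begin

text \<open>The coefficients of the words A B^k of \<psi>; the signs come from t_23 acting by
  -\<open>omega\<close>.\<close>

definition "left_fps = Abs_fps (\<lambda>k. (- 1) ^ k * wcoeff \<psi> (LA # replicate k LB))"
definition "right_fps = Abs_fps (\<lambda>k. (- 1) ^ k * wcoeff \<psi> (replicate k LB @ [LA]))"

lemma psi_power [simp]: "wcoeff \<psi> (replicate n l) = 0"
  by (rule lie_series_power_letter) simp_all

lemma mrep_psi3:
  "mrep (psi3 \<psi> i j k) p q = wsumd 2 \<psi> (\<lambda>w. mword (map (case_ab (GT i j) (GT j k)) w) p q)"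
proof -
  have "case_ab (gt i j) (gt j k) = (\<lambda>l. letter (case_ab (GT i j) (GT j k) l))"
    by (auto split: ab.splits)
  then show ?thesis by (simp add: psi3_def ev_def mrep_substitute)
qed

lemma wsumd_eq_0:
  assumes "\<And>w. wcoeff \<psi> w \<noteq> 0 \<Longrightarrow> F w = 0"
  shows "wsumd 2 \<psi> F = (0 :: sgn series)"
proof (rule series_eqI)
  fix v
  have "wcoeff \<psi> w * wcoeff (F w) v = 0" for w using assms[of w] by (cases "wcoeff \<psi> w = 0") simp_all
  then show "wcoeff (wsumd 2 \<psi> F) v = wcoeff 0 v"
    by (simp only: wcoeff_wsumd sum.neutral_const zero_series.rep_eq)
qed

lemma mrep_psi3_123:
  "mrep (psi3 \<psi> 1 2 3) SL SR = fps_eval left_fps omega" "mrep (psi3 \<psi> 1 2 3) (SM t) SR = 0"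
proof -
  note m = mword_t12_t23
  show "mrep (psi3 \<psi> 1 2 3) SL SR = fps_eval left_fps omega"
    unfolding mrep_psi3 left_fps_def
  proof (rule wsumd_omega_powers)
    show "mword (map (case_ab (GT 1 2) (GT 2 3)) (LA # replicate k LB)) SL SR = (- omega) ^ k" for k
      unfolding m(2) m(1) by simp
    fix w assume w: "wcoeff \<psi> w \<noteq> 0" "mword (map (case_ab (GT 1 2) (GT 2 3)) w) SL SR \<noteq> 0"
    then obtain l u where lu: "w = l # u" by (cases w) auto
    have u: "u = replicate (length u) LB"
      using w(2) unfolding lu m(2) m(1) by (metis neg_equal_0_iff_equal)
    have "l = LA"
    proof (rule ccontr)
      assume "l \<noteq> LA"
      then have "w = replicate (Suc (length u)) LB" using lu u by (cases l) simp_all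
      then show False using w(1) by (metis psi_power)
    qed
    then show "\<exists>k. w = LA # replicate k LB" using lu u by blast
  qed simp
  show "mrep (psi3 \<psi> 1 2 3) (SM t) SR = 0"
    unfolding mrep_psi3
  proof (rule wsumd_eq_0, rule ccontr)
    fix w assume w: "wcoeff \<psi> w \<noteq> 0" "mword (map (case_ab (GT 1 2) (GT 2 3)) w) (SM t) SR \<noteq> 0"
    then obtain l u where lu: "w = l # u" by (cases w) auto
    have u: "u = replicate (length u) LB" "l \<noteq> LA"
      using w(2) unfolding lu m(3) m(1) by (metis mult_zero_right)+
    then have "w = replicate (Suc (length u)) LB" using lu by (cases l) simp_all
    then show False using w(1) by (metis psi_power)
  qed
qed

lemma mrep_psi3_213:
  "mrep (psi3 \<psi> 2 1 3) SL SR = fps_eval right_fps omega" "mrep (psi3 \<psi> 2 1 3) SL (SM t) = 0"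
proof -
  note m = mword_t21_t13
  have snoc: "w = replicate (Suc (length u)) LB" if "w = u @ [l]" "u = replicate (length u) LB" "l \<noteq> LA" for w u l
    using that by (cases l) (metis replicate_append_same replicate_Suc)+
  show "mrep (psi3 \<psi> 2 1 3) SL SR = fps_eval right_fps omega"
    unfolding mrep_psi3 right_fps_def
  proof (rule wsumd_omega_powers)
    show "mword (map (case_ab (GT 2 1) (GT 1 3)) (replicate k LB @ [LA])) SL SR = (- omega) ^ k" for k
      unfolding m(2) m(1) by simp
    fix w assume w: "wcoeff \<psi> w \<noteq> 0" "mword (map (case_ab (GT 2 1) (GT 1 3)) w) SL SR \<noteq> 0"
    then obtain u l where lu: "w = u @ [l]" by (cases w rule: rev_cases) auto
    have u: "u = replicate (length u) LB"
      using w(2) unfolding lu m(2) m(1) by (metis neg_equal_0_iff_equal)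
    have "l = LA"
      using snoc[OF lu u] w(1) by (metis psi_power)
    then show "\<exists>k. w = replicate k LB @ [LA]" using lu u by blast
  qed simp
  show "mrep (psi3 \<psi> 2 1 3) SL (SM t) = 0"
    unfolding mrep_psi3
  proof (rule wsumd_eq_0, rule ccontr)
    fix w assume w: "wcoeff \<psi> w \<noteq> 0" "mword (map (case_ab (GT 2 1) (GT 1 3)) w) SL (SM t) \<noteq> 0"
    then obtain u l where lu: "w = u @ [l]" by (cases w rule: rev_cases) auto
    have "u = replicate (length u) LB" "l \<noteq> LA"
      using w(2) unfolding lu m(3) m(1) by (metis mult_zero_left)+
    then show False using snoc[OF lu] w(1) by (metis psi_power)
  qed
qed

text \<open>Strands 1 and 2 contribute nothing to this entry apart from the two brackets with
  \<psi>, and each of those keeps only one of its two products.\<close>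

lemma mrep_sum_rel:
  "mrep (ins 3 (u s)) SL SR = fps_eval right_fps omega * letter s - letter s * fps_eval left_fps omega"
proof -
  have "mrep (ell_xi \<psi> u s + ell_eta \<psi> u s + ins 3 (u s)) SL SR = 0"
    by (rule mrep_ideal[OF sum_rel])
  then have "mrep (ins 3 (u s)) SL SR = mrep (br (psi3 \<psi> 1 2 3) (gx s 1)) SL SR + mrep (br (psi3 \<psi> 2 1 3) (gx s 2)) SL SR"
    by (simp add: ell_xi_def ell_eta_def mrep_arg mrep_ins_1_2 algebra_simps)
  then show ?thesis
    by (cases s) (simp_all add: mrep_br sum_st mrep_letter mrep_psi3_123 mrep_psi3_213)
qed

end

lemma wcoeff_omega_power: "length v \<noteq> 2 * k \<Longrightarrow> wcoeff (omega ^ k) v = 0"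
proof (induction k arbitrary: v)
  case (Suc k)
  have omega: "wcoeff omega w = 0" if "length w \<noteq> 2" for w
    using that by (cases w) (auto simp: br_def wcoeff_letter_mult split: list.splits)
  have "wcoeff omega (take i v) * wcoeff (omega ^ k) (drop i v) = 0" if "i \<le> length v" for i
  proof (cases "i = 2")
    case True
    then show ?thesis using Suc.IH[of "drop i v"] Suc.prems that by simp
  next
    case False
    then show ?thesis using omega[of "take i v"] that by simp
  qed
  then show ?case unfolding power_Suc wcoeff_mult by (intro sum.neutral) auto
qed simp

lemma wcoeff_fps_eval_omega:
  "wcoeff (fps_eval p omega) v = (if even (length v) then fps_nth p (length v div 2) * wcoeff (omega ^ (length v div 2)) v else 0)"
proof -
  have "wcoeff (fps_eval p omega) v = (\<Sum>k\<le>length v. if k = length v div 2 \<and> even (length v) then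
      fps_nth p (length v div 2) * wcoeff (omega ^ (length v div 2)) v else 0)"
    unfolding wcoeff_fps_eval
  proof (intro sum.cong refl)
    fix k
    show "fps_nth p k * wcoeff (omega ^ k) v = (if k = length v div 2 \<and> even (length v) then
      fps_nth p (length v div 2) * wcoeff (omega ^ (length v div 2)) v else 0)"
      using wcoeff_omega_power[of v k] by (cases "length v = 2 * k") auto
  qed
  then show ?thesis by (cases "even (length v)") simp_all
qed

text \<open>Series in \<open>omega\<close> live in even degrees, so both sides vanish on even words,
  and on odd words the sign of \<open>mrep_ins3\<close> is -1.\<close>

lemma (in ell) contract_u:
  "contract (u s) v = wcoeff (letter s * fps_eval left_fps omega - fps_eval right_fps omega * letter s) v"
proof (cases "even (length v)")
  case True
  have "wcoeff (letter s * fps_eval p omega) v = 0" for p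
    using True by (auto simp: wcoeff_letter_mult wcoeff_fps_eval_omega split: list.splits)
  moreover have "wcoeff (fps_eval p omega * letter s) v = 0" for p
    using True by (cases v rule: rev_cases) (auto simp: wcoeff_mult_letter_snoc wcoeff_fps_eval_omega)
  ultimately show ?thesis using mrep_ins3[of "u s" v] True by (simp add: mrep_sum_rel)
next
  case False
  then show ?thesis using mrep_ins3[of "u s" v] by (simp add: mrep_sum_rel)
qed

subsection \<open>Cyclic sums\<close>

text \<open>These functionals are constant on rotation orbits and vanish on commutators; together
  with the constant term they detect cyclic words.\<close>

definition cycsum :: "'a series \<Rightarrow> 'a list \<Rightarrow> rat" where
  "cycsum f w = (\<Sum>k<length w. wcoeff f (rotate k w))"

lemma cycsum_add: "cycsum (f + g) w = cycsum f w + cycsum g w"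
  and cycsum_diff: "cycsum (f - g) w = cycsum f w - cycsum g w"
  and cycsum_uminus: "cycsum (- f) w = - cycsum f w"
  by (simp_all add: cycsum_def sum.distrib sum_subtractf sum_negf)

lemma sum_rotate_shift:
  "(\<Sum>k<length w. h (rotate k (rotate i w))) = (\<Sum>k<length w. h (rotate k w))" for h :: "'a list \<Rightarrow> rat"
proof (induction i)
  case (Suc i)
  let ?w = "rotate i w"
  have "(\<Sum>k<length w. h (rotate (Suc k) ?w)) + h ?w = (\<Sum>k<Suc (length w). h (rotate k ?w))"
    unfolding sum.lessThan_Suc_shift by simp
  also have "\<dots> = (\<Sum>k<length w. h (rotate k ?w)) + h ?w"
    using rotate_length01[of ?w] by (simp add: rotate_conv_mod[of "length w"])
  finally have "(\<Sum>k<length w. h (rotate (Suc k) ?w)) = (\<Sum>k<length w. h (rotate k ?w))" by simp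
  moreover have "rotate k (rotate (Suc i) w) = rotate (Suc k) ?w" for k
    by (simp only: rotate_rotate add_Suc_right add_Suc)
  ultimately show ?case using Suc by simp
qed simp

lemma cycsum_rotate: "cycsum f (rotate i w) = cycsum f w"
  unfolding cycsum_def using sum_rotate_shift[of "wcoeff f" i w] by simp

text \<open>Rotating a word by the length of its first factor exchanges the two factors.\<close>

lemma cycsum_mult_commute: "cycsum (f * g) w = cycsum (g * f) w"
proof -
  let ?n = "length w"
  have "cycsum (f * g) w = (\<Sum>i\<le>?n. \<Sum>k<?n. wcoeff f (take i (rotate k w)) * wcoeff g (drop i (rotate k w)))"
    unfolding cycsum_def wcoeff_mult by (subst sum.swap) simp
  also have "\<dots> = (\<Sum>i\<le>?n. \<Sum>k<?n. wcoeff g (take (?n - i) (rotate k w)) * wcoeff f (drop (?n - i) (rotate k w)))"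
  proof (rule sum.cong)
    fix i assume i: "i \<in> {..?n}"
    let ?h = "\<lambda>x. wcoeff g (take (?n - i) x) * wcoeff f (drop (?n - i) x)"
    have "rotate i x = drop i x @ take i x" if "length x = ?n" for x :: "'a list"
      using i that by (cases "i = ?n") (auto simp: rotate_drop_take)
    then have "?h (rotate k (rotate i w)) = wcoeff f (take i (rotate k w)) * wcoeff g (drop i (rotate k w))" for k
      unfolding rotate_rotate add.commute[of k] unfolding rotate_rotate[symmetric] using i by simp
    then show "(\<Sum>k<?n. wcoeff f (take i (rotate k w)) * wcoeff g (drop i (rotate k w))) = (\<Sum>k<?n. ?h (rotate k w))"
      using sum_rotate_shift[of ?h i w] by simp
  qed simp
  also have "\<dots> = (\<Sum>i\<le>?n. \<Sum>k<?n. wcoeff g (take i (rotate k w)) * wcoeff f (drop i (rotate k w)))"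
    by (rule sum.reindex_bij_witness[of _ "\<lambda>i. ?n - i" "\<lambda>i. ?n - i"]) auto
  also have "\<dots> = cycsum (g * f) w"
    unfolding cycsum_def wcoeff_mult by (subst sum.swap) simp
  finally show ?thesis .
qed

lemma bij_rotate: "bij_betw (rotate k) {w :: 'a list. length w = n} {w. length w = n}"
proof -
  have inverse: "rotate (n - k mod n) (rotate k w) = w" "rotate k (rotate (n - k mod n) w) = w"
    if "length w = n" for w :: "'a list"
  proof -
    have "rotate (n - k mod n + k) w = w"
    proof (cases "n = 0")
      case False
      then have "k mod n < n" by simp
      then have "n - k mod n + k = n + n * (k div n)" using mult_div_mod_eq[of n k] by linarith
      then have "(n - k mod n + k) mod length w = 0" using that by simp
      then show ?thesis by (simp add: rotate_conv_mod[of _ w])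
    qed (use that in auto)
    then show "rotate (n - k mod n) (rotate k w) = w" "rotate k (rotate (n - k mod n) w) = w"
      by (simp_all add: rotate_rotate add.commute)
  qed
  show ?thesis
    by (rule bij_betw_byWitness[where f' = "rotate (n - k mod n)"]) (use inverse in auto)
qed

text \<open>A word and its rotation differ by a commutator, so in each positive degree f is
  congruent to its average over rotations, whose coefficients are the cyclic sums divided by the
  degree.\<close>

lemma comms_if_cycsum_eq_0:
  fixes f :: "'a::finite series"
  assumes f0: "wcoeff f [] = 0" and f: "\<And>w. cycsum f w = 0"
  shows "f \<in> comms"
  unfolding comms_def deg_closure_iff
proof
  fix n
  let ?S = "series.span {g * h - h * g |g h :: 'a series. True}"
  let ?part = "\<lambda>m. \<Sum>w | length w = m. qscale (wcoeff f w) (mon w)"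
  have fin: "finite {w :: 'a list. length w = m}" for m
    by (rule finite_subset[OF _ finite_words_le[of m]]) auto
  have part: "?part m \<in> ?S" for m
  proof (cases m)
    case 0
    then show ?thesis using f0 by (simp add: series.span_zero)
  next
    case (Suc m')
    have rot: "mon (rotate k w) - mon w \<in> ?S" for k and w :: "'a list"
    proof -
      let ?k = "k mod length w"
      have "mon (drop ?k w) * mon (take ?k w) - mon (take ?k w) * mon (drop ?k w) = mon (rotate k w) - mon w"
        by (simp add: mon_mult rotate_drop_take)
      then show ?thesis by (intro series.span_base) (metis (mono_tags, lifting) mem_Collect_eq)
    qed
    have "qscale (of_nat k) g = (\<Sum>i<k. g)" for k and g :: "'a series"
      by (induction k) (simp_all add: series.scale_left_distrib algebra_simps)
    \<comment> \<open>Each of the m copies is reindexed by its own rotation; replacing rotated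
      monomials by the original ones costs commutators and leaves the cyclic sums.\<close>
    then have "qscale (of_nat m) (?part m) = (\<Sum>k<m. ?part m)" .
    also have "\<dots> = (\<Sum>k<m. \<Sum>w | length w = m. qscale (wcoeff f (rotate k w)) (mon (rotate k w)))"
      using sum.reindex_bij_betw[OF bij_rotate, of "\<lambda>w. qscale (wcoeff f w) (mon w)" _ m] by simp
    also have "\<dots> = (\<Sum>k<m. \<Sum>w | length w = m. qscale (wcoeff f (rotate k w)) (mon (rotate k w) - mon w)) +
        (\<Sum>k<m. \<Sum>w | length w = m. qscale (wcoeff f (rotate k w)) (mon w))"
      by (simp add: qscale_diff sum_subtractf)
    also have "(\<Sum>k<m. \<Sum>w | length w = m. qscale (wcoeff f (rotate k w)) (mon w)) =
        (\<Sum>w | length w = m. \<Sum>k<m. qscale (wcoeff f (rotate k w)) (mon w))"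
      by (rule sum.swap)
    also have "\<dots> = (\<Sum>w | length w = m. qscale (cycsum f w) (mon w))"
      unfolding cycsum_def by (intro sum.cong) (auto simp: series.scale_sum_left)
    also have "\<dots> = 0" by (simp add: f)
    finally have eq: "qscale (of_nat m) (?part m) =
        (\<Sum>k<m. \<Sum>w | length w = m. qscale (wcoeff f (rotate k w)) (mon (rotate k w) - mon w))" by simp
    have "qscale (of_nat m) (?part m) \<in> ?S"
      unfolding eq by (intro series.span_sum series.span_scale rot)
    then have "qscale (1 / of_nat m) (qscale (of_nat m) (?part m)) \<in> ?S" by (rule series.span_scale)
    then show ?thesis using Suc by simp
  qed
  have "(\<Sum>w | length w < n. qscale (wcoeff f w) (mon w)) = (\<Sum>m<n. ?part m)"
  proof -
    have "{w :: 'a list. length w < n} = (\<Union>m<n. {w. length w = m})" by auto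
    then show ?thesis using fin by (simp only:) (subst sum.UNION_disjoint; auto)
  qed
  then have "(\<Sum>w | length w < n. qscale (wcoeff f w) (mon w)) \<in> ?S"
    using part by (simp add: series.span_sum)
  moreover have "vanish n (f - (\<Sum>w | length w < n. qscale (wcoeff f w) (mon w)))"
    by (rule vanishI) (simp add: wcoeff_trunc)
  ultimately show "\<exists>g\<in>?S. vanish n (f - g)" by blast
qed

subsection \<open>The divergence\<close>

text \<open>Only words of even positive length contribute, and the extra factor \<open>omega\<close>
  shifts the index by one.\<close>

lemma wcoeff_fps_eval_mult_omega:
  "wcoeff (fps_eval q omega * omega) x = (if even (length x) \<and> x \<noteq> []
    then fps_nth q (length x div 2 - 1) * wcoeff (omega ^ (length x div 2)) x else 0)"
proof -
  let ?n = "Suc (length x)"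
  have "vanish (?n + 0) ((fps_eval q omega - (\<Sum>k<?n. qscale (fps_nth q k) (omega ^ k))) * omega)"
    by (intro vanish_mult fps_eval_approx) simp_all
  then have "wcoeff (fps_eval q omega * omega) x = wcoeff (\<Sum>k<?n. qscale (fps_nth q k) (omega ^ k * omega)) x"
    by (simp add: vanish_def left_diff_distrib sum_distrib_right qscale_mult_left del: sum.lessThan_Suc)
  also have "\<dots> = (\<Sum>k<?n. fps_nth q k * wcoeff (omega ^ Suc k) x)"
    by (simp add: wcoeff_sum power_commutes del: sum.lessThan_Suc)
  also have "\<dots> = (\<Sum>k<?n. if k = length x div 2 - 1 then (if even (length x) \<and> x \<noteq> []
      then fps_nth q (length x div 2 - 1) * wcoeff (omega ^ (length x div 2)) x else 0) else 0)"
  proof (intro sum.cong refl)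
    fix k
    show "fps_nth q k * wcoeff (omega ^ Suc k) x = (if k = length x div 2 - 1 then (if even (length x) \<and> x \<noteq> []
      then fps_nth q (length x div 2 - 1) * wcoeff (omega ^ (length x div 2)) x else 0) else 0)"
    proof (cases "length x = 2 * Suc k")
      case True
      then have "even (length x)" "length x div 2 = Suc k" "x \<noteq> []" by auto
      then show ?thesis by simp
    next
      case False
      have "\<not> (k = length x div 2 - 1 \<and> even (length x) \<and> x \<noteq> [])"
      proof
        assume a: "k = length x div 2 - 1 \<and> even (length x) \<and> x \<noteq> []"
        then obtain m where m: "length x = 2 * m" by (auto elim: evenE)
        then have "m \<noteq> 0" using a by (cases m) auto
        then show False using a m False by simp
      qed
      then show ?thesis using wcoeff_omega_power[OF False] by auto
    qed
  qed
  also have "\<dots> = (if even (length x) \<and> x \<noteq> []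
    then fps_nth q (length x div 2 - 1) * wcoeff (omega ^ (length x div 2)) x else 0)"
    by (subst sum.delta) auto
  finally show ?thesis .
qed

context ell
begin

text \<open>The cyclic word whose cyclic derivatives are \<open>u\<^sub>-\<close> and \<open>u\<^sub>+\<close>, up to sign; its cyclic invariance
  \<open>hamiltonian_eq\<close> is the condition \<open>u([c\<^sub>1, c\<^sub>2]) = 0\<close>.\<close>

definition hamiltonian :: "sgn series" where
  "hamiltonian = u SPlus * letter SMinus - u SMinus * letter SPlus"

lemma hamiltonian_eq: "hamiltonian = letter SMinus * u SPlus - letter SPlus * u SMinus"
proof -
  have nc: "nc u" by (intro nc_lie u_lie)
  have "br (u SPlus) (letter SMinus) + br (letter SPlus) (u SMinus) = 0"
    using u_omega unfolding deriv_br[OF nc] der_letter[OF nc_letter nc] .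
  then show ?thesis by (simp add: hamiltonian_def br_def algebra_simps)
qed

lemma hamiltonian_snoc: "wcoeff hamiltonian (x @ [l]) = (if l = SMinus then wcoeff (u SPlus) x else - wcoeff (u SMinus) x)"
  by (cases l) (simp_all add: hamiltonian_def wcoeff_mult_letter_snoc)

lemma hamiltonian_Cons: "wcoeff hamiltonian (l # x) = wcoeff hamiltonian (x @ [l])"
  unfolding hamiltonian_snoc by (cases l) (simp_all add: hamiltonian_eq wcoeff_letter_mult)

lemma hamiltonian_cyclic: "wcoeff hamiltonian (x @ y) = wcoeff hamiltonian (y @ x)"
proof (induction x arbitrary: y)
  case (Cons l x)
  show ?case using hamiltonian_Cons[of l "x @ y"] Cons[of "y @ [l]"] by simp
qed simp

text \<open>The divergence contracts the last two letters of the Hamiltonian.\<close>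

lemma div_rep_hamiltonian: "wcoeff (div_rep u) w = (\<Sum>i\<in>UNIV. \<Sum>j\<in>UNIV. eps i j * wcoeff hamiltonian (w @ [i, j]))"
  using hamiltonian_snoc[of "w @ [SPlus]" SMinus] hamiltonian_snoc[of "w @ [SMinus]" SPlus]
  by (simp add: div_rep_def UNIV_sgn)

abbreviation "\<rho> \<equiv> fps_eval left_fps omega"
abbreviation "\<rho>' \<equiv> fps_eval right_fps omega"

text \<open>Rotating w moves the contracted pair through all gaps of v while the last letter l stays
  outside. By cyclic invariance the sum becomes the full contraction of u_+ or u_-, selected by
  l.\<close>

lemma cycsum_div_rep:
  assumes "w \<noteq> []"
  shows "cycsum (div_rep u) w = wcoeff ((letter SPlus * \<rho> - \<rho>' * letter SPlus) * letter SMinus -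
     (letter SMinus * \<rho> - \<rho>' * letter SMinus) * letter SPlus) w"
proof -
  obtain v l where w: "w = v @ [l]" using assms by (cases w rule: rev_cases) auto
  have "wcoeff hamiltonian (rotate k w @ [i, j]) = wcoeff hamiltonian ((take k v @ [i, j] @ drop k v) @ [l])"
    if "k \<le> length v" for k i j
  proof -
    have "rotate k w = drop k v @ [l] @ take k v" using that by (simp add: w rotate_drop_take)
    then show ?thesis using hamiltonian_cyclic[of "drop k v @ [l]" "take k v @ [i, j]"] by simp
  qed
  then have "cycsum (div_rep u) w = (\<Sum>k\<le>length v. \<Sum>i\<in>UNIV. \<Sum>j\<in>UNIV. eps i j *
      wcoeff hamiltonian ((take k v @ [i, j] @ drop k v) @ [l]))"
    unfolding cycsum_def div_rep_hamiltonian by (intro sum.cong) (auto simp: w)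
  also have "\<dots> = (if l = SMinus then contract (u SPlus) v else - contract (u SMinus) v)"
    unfolding hamiltonian_snoc contract_def by (simp add: sum_negf)
  finally show ?thesis
    unfolding contract_u by (cases l) (simp_all add: w wcoeff_mult_letter_snoc)
qed

text \<open>Euler's formula: summing over rotations multiplies the left side by the length, and
  under the cyclic sum the four products on the right combine into one multiple of
  \<open>omega\<close>.\<close>

lemma length_cycsum_div_rep:
  "of_nat (length w) * cycsum (div_rep u) w = - cycsum (fps_eval (left_fps + right_fps) omega * omega) w"
proof (cases "w = []")
  case False
  let ?C = "(letter SPlus * \<rho> - \<rho>' * letter SPlus) * letter SMinus -
     (letter SMinus * \<rho> - \<rho>' * letter SMinus) * letter SPlus"
  have "of_nat (length w) * cycsum (div_rep u) w = (\<Sum>k<length w. cycsum (div_rep u) (rotate k w))"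
    by (simp add: cycsum_rotate)
  also have "\<dots> = cycsum ?C w"
    unfolding cycsum_def[of ?C] using False by (intro sum.cong cycsum_div_rep) auto
  also have "?C = letter SPlus * (\<rho> * letter SMinus) - \<rho>' * (letter SPlus * letter SMinus) -
      letter SMinus * (\<rho> * letter SPlus) + (\<rho>' * letter SMinus) * letter SPlus"
    by (simp add: algebra_simps)
  also have "cycsum \<dots> w = cycsum (\<rho> * letter SMinus * letter SPlus) w - cycsum (\<rho>' * (letter SPlus * letter SMinus)) w -
      cycsum (\<rho> * letter SPlus * letter SMinus) w + cycsum (\<rho>' * letter SMinus * letter SPlus) w"
    by (simp only: cycsum_add cycsum_diff cycsum_mult_commute[of "letter _" "\<rho> * _"])
  also have "\<dots> = - cycsum (fps_eval (left_fps + right_fps) omega * omega) w"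
    by (simp add: cycsum_add[symmetric] cycsum_diff[symmetric] cycsum_uminus[symmetric] fps_eval_add br_def)
      (simp add: algebra_simps)
  finally show ?thesis .
qed (simp add: cycsum_def)

text \<open>The word length 2k of the k-th power of \<open>omega\<close> is the Euler factor to be
  divided out. The constant term is copied, since cyclic sums at the empty word are empty.\<close>

definition div_fps :: "rat fps" where
  "div_fps = Abs_fps (\<lambda>k. if k = 0 then wcoeff (div_rep u) []
     else - fps_nth (left_fps + right_fps) (k - 1) / of_nat (2 * k))"

lemma length_div_fps:
  assumes "x \<noteq> []"
  shows "of_nat (length x) * wcoeff (fps_eval div_fps omega) x =
    - wcoeff (fps_eval (left_fps + right_fps) omega * omega) x"
proof (cases "even (length x)")
  case True
  then obtain m where m: "length x = 2 * m" by (rule evenE)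
  moreover have "m > 0" using assms m by (cases m) auto
  ultimately show ?thesis
    using assms by (simp add: wcoeff_fps_eval_omega wcoeff_fps_eval_mult_omega div_fps_def)
      (simp add: algebra_simps)
qed (simp add: wcoeff_fps_eval_omega wcoeff_fps_eval_mult_omega)

lemma div_rep_comms: "div_rep u - fps_eval div_fps omega \<in> comms"
proof (rule comms_if_cycsum_eq_0)
  show "wcoeff (div_rep u - fps_eval div_fps omega) [] = 0"
    by (simp add: wcoeff_fps_eval div_fps_def)
  fix w
  have "of_nat (length w) * cycsum (fps_eval div_fps omega) w =
      (\<Sum>k<length w. of_nat (length (rotate k w)) * wcoeff (fps_eval div_fps omega) (rotate k w))"
    by (simp add: cycsum_def sum_distrib_left)
  also have "\<dots> = - cycsum (fps_eval (left_fps + right_fps) omega * omega) w"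
    unfolding cycsum_def sum_negf[symmetric] by (intro sum.cong refl length_div_fps) auto
  finally have "of_nat (length w) * cycsum (div_rep u - fps_eval div_fps omega) w = 0"
    by (simp add: cycsum_diff right_diff_distrib length_cycsum_div_rep)
  then show "cycsum (div_rep u - fps_eval div_fps omega) w = 0"
    by (cases "w = []") (auto simp: cycsum_def)
qed

lemma u_krv_fields: "u \<in> krv_fields"
  using div_rep_comms u_omega by (auto simp: krv_fields_def)

end

subsection \<open>The homomorphism\<close>

lemma ell_xi_add: "ell_xi (\<psi> + \<phi>) (\<lambda>s. u s + v s) s = ell_xi \<psi> u s + ell_xi \<phi> v s"
  and ell_eta_add: "ell_eta (\<psi> + \<phi>) (\<lambda>s. u s + v s) s = ell_eta \<psi> u s + ell_eta \<phi> v s"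
  and ell_xi_qscale: "ell_xi (qscale c \<psi>) (\<lambda>s. qscale c (u s)) s = qscale c (ell_xi \<psi> u s)"
  and ell_eta_qscale: "ell_eta (qscale c \<psi>) (\<lambda>s. qscale c (u s)) s = qscale c (ell_eta \<psi> u s)"
  and ins_add: "ins i (f + g) = ins i f + ins i g"
  and ins_qscale: "ins i (qscale c f) = qscale c (ins i f)"
  by (simp_all add: ell_xi_def ell_eta_def ins_def psi3_def ev_def substitute_add substitute_qscale br_add_left
      br_qscale qscale_diff)

lemma grt1_ell_iff:
  "(\<psi>, u) \<in> grt1_ell \<longleftrightarrow> \<psi> \<in> grt1 \<and> (\<forall>s. u s \<in> lie_series) \<and>
     (\<forall>s. ell_xi \<psi> u s + ell_eta \<psi> u s + ins 3 (u s) \<in> I3) \<and>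
     (\<forall>s. br (ell_xi \<psi> u s) (gx s 3) + br (gx s 1) (ins 3 (u s)) \<in> I3) \<and>
     br (ell_xi \<psi> u SPlus) (gx SMinus 2) + br (gx SPlus 1) (ell_eta \<psi> u SMinus) \<in> I3"
  by (auto simp: grt1_ell_def lie_cong_iff)

lemma grt1_ell_add:
  assumes "(\<psi>, u) \<in> grt1_ell" "(\<phi>, v) \<in> grt1_ell"
  shows "(\<psi> + \<phi>, \<lambda>s. u s + v s) \<in> grt1_ell"
proof -
  have e1: "ell_xi \<psi> u s + ell_xi \<phi> v s + (ell_eta \<psi> u s + ell_eta \<phi> v s) + (ins 3 (u s) + ins 3 (v s)) =
      (ell_xi \<psi> u s + ell_eta \<psi> u s + ins 3 (u s)) + (ell_xi \<phi> v s + ell_eta \<phi> v s + ins 3 (v s))" for s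
    by (simp add: algebra_simps)
  have e2: "br (a + a') x + br y (b + b') = (br a x + br y b) + (br a' x + br y b')" for a a' b b' x y :: "3 ell_gen series"
    by (simp add: br_add_left br_add_right algebra_simps)
  show ?thesis
    using assms unfolding grt1_ell_iff ell_xi_add ell_eta_add ins_add e1 e2
    by (simp add: grt1_add t13.ideal_add)
qed

lemma grt1_ell_qscale:
  assumes "(\<psi>, u) \<in> grt1_ell"
  shows "(qscale c \<psi>, \<lambda>s. qscale c (u s)) \<in> grt1_ell"
  using assms unfolding grt1_ell_iff ell_xi_qscale ell_eta_qscale ins_qscale br_qscale qscale_add[symmetric]
  by (simp add: grt1_qscale t13.ideal_qscale)

lemma vector_space_scale_ell: "vector_space scale_ell"
  by unfold_locales (auto simp: scale_ell_def fun_eq_iff qscale_add series.scale_left_distrib)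

lemma lie_algebra_grt1_ell: "lie_algebra scale_ell grt1_ell ell_bracket"
proof -
  interpret vector_space scale_ell by (rule vector_space_scale_ell)
  have nc: "nc u" if "(\<psi>, u) \<in> grt1_ell" for \<psi> u
    using that by (intro nc_lie) (simp add: grt1_ell_iff)
  have sub: "subspace grt1_ell"
  proof (rule subspaceI)
    show "0 \<in> grt1_ell"
      by (simp add: zero_prod_def zero_fun_def grt1_ell_iff grt1_zero ell_xi_def ell_eta_def ins_def psi3_def ev_def)
    show "x + y \<in> grt1_ell" if "x \<in> grt1_ell" "y \<in> grt1_ell" for x y
      using that grt1_ell_add by (cases x; cases y) (simp add: plus_fun_def)
    show "scale_ell c x \<in> grt1_ell" if "x \<in> grt1_ell" for c x
      using that grt1_ell_qscale by (cases x) (simp add: scale_ell_def)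
  qed
  have der_fun_add: "deriv (u + v) f = deriv u f + deriv v f" if "nc u" "nc v" for u v and f :: "sgn series"
    using deriv_add_field[OF that] by (simp add: plus_fun_def)
  show ?thesis
  proof unfold_locales
    fix x y z :: "ab series \<times> (sgn \<Rightarrow> sgn series)" and c
    assume x: "x \<in> grt1_ell" and y: "y \<in> grt1_ell"
    obtain \<psi> u \<phi> v where xy: "x = (\<psi>, u)" "y = (\<phi>, v)" by (cases x, cases y)
    note nc_xy = nc[OF x[unfolded xy]] nc[OF y[unfolded xy]]
    show "ell_bracket x y \<in> grt1_ell" using ell_bracket_closed x y by (simp add: xy)
    show "ell_bracket (scale_ell c x) y = scale_ell c (ell_bracket x y)"
      by (simp add: xy ell_bracket_def scale_ell_def ihara_bracket_scale_left deriv_qscale_field[OF nc_xy(1)]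
          der_qscale qscale_diff)
    show "ell_bracket x (scale_ell c y) = scale_ell c (ell_bracket x y)"
      by (simp add: xy ell_bracket_def scale_ell_def ihara_bracket_scale_right deriv_qscale_field[OF nc_xy(2)]
          der_qscale qscale_diff)
    show "ell_bracket x x = 0"
      by (simp add: xy ell_bracket_def ihara_bracket_self zero_prod_def zero_fun_def)
    assume z: "z \<in> grt1_ell"
    obtain \<kappa> w where zw: "z = (\<kappa>, w)" by (cases z)
    note nc_z = nc[OF z[unfolded zw]]
    show "ell_bracket (x + y) z = ell_bracket x z + ell_bracket y z"
      by (simp add: xy zw ell_bracket_def ihara_bracket_add_left der_fun_add[OF nc_xy] der_add fun_eq_iff)
    show "ell_bracket x (y + z) = ell_bracket x y + ell_bracket x z"
      by (simp add: xy zw ell_bracket_def ihara_bracket_add_right der_fun_add[OF nc_xy(2) nc_z] der_add fun_eq_iff)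
    show "ell_bracket x (ell_bracket y z) + ell_bracket y (ell_bracket z x) + ell_bracket z (ell_bracket x y) = 0"
      by (simp add: xy zw ell_bracket_def ihara_jacobi deriv_commutator nc_xy nc_z der_diff zero_prod_def
          fun_eq_iff)
  qed (rule sub)
qed

theorem theorem2:
  shows "lie_algebra_hom
    scale_ell grt1_ell ell_bracket
    scale_Der krv11 commutator
    (\<lambda>(\<psi>, u). derivation_of u)"
proof -
  interpret dom: lie_algebra scale_ell grt1_ell ell_bracket by (rule lie_algebra_grt1_ell)
  interpret cod: lie_algebra scale_Der krv11 commutator by (rule lie_algebra_krv11)
  have lie: "u s \<in> lie_series" if "(\<psi>, u) \<in> grt1_ell" for \<psi> u s
    using that by (simp add: grt1_ell_iff)
  show ?thesis
  proof unfold_locales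
    fix x y :: "ab series \<times> (sgn \<Rightarrow> sgn series)" and c
    assume x: "x \<in> grt1_ell"
    obtain \<psi> u where xu: "x = (\<psi>, u)" by (cases x)
    note lie_u = lie[OF x[unfolded xu]]
    interpret ell \<psi> u by unfold_locales (use x xu in simp)
    show "(case x of (\<psi>, u) \<Rightarrow> derivation_of u) \<in> krv11"
      using u_krv_fields by (simp add: xu derivation_of_krv11)
    show "(case scale_ell c x of (\<psi>, u) \<Rightarrow> derivation_of u) = scale_Der c (case x of (\<psi>, u) \<Rightarrow> derivation_of u)"
      by (simp add: xu scale_ell_def derivation_of_scale nc_lie lie_u)
    assume y: "y \<in> grt1_ell"
    obtain \<phi> v where yv: "y = (\<phi>, v)" by (cases y)
    note lie_v = lie[OF y[unfolded yv]]
    show "(case x + y of (\<psi>, u) \<Rightarrow> derivation_of u) =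
        (case x of (\<psi>, u) \<Rightarrow> derivation_of u) + (case y of (\<psi>, u) \<Rightarrow> derivation_of u)"
      using derivation_of_add[OF nc_lie nc_lie, of u v] lie_u lie_v by (simp add: xu yv plus_fun_def)
    show "(case ell_bracket x y of (\<psi>, u) \<Rightarrow> derivation_of u) =
        commutator (case x of (\<psi>, u) \<Rightarrow> derivation_of u) (case y of (\<psi>, u) \<Rightarrow> derivation_of u)"
      using derivation_of_commutator[of u v] lie_u lie_v by (simp add: xu yv ell_bracket_def)
  qed
qed

end
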